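(* Let $n\in\mathbb{N}$ and $L=\mathrm{LCM}(2,3,\ldots,n)$. There is an $n$-player discrete envy free cake-cutting protocol with the following properties: (1) in the worst case it uses $\left\lceil\frac{n^2-2n+2}{2}\right\rceil\omega+(L-1)$ cuts; (2) in the average case it uses $(n+o(1))\omega+(L-1)$ cuts, where the average case is understood as follows: in each round of the protocol, one fixed player $A_1$ cuts the remaining cake into $L$ pieces she considers equal, and each other player declares whether he considers all $L$ pieces equal or not; the average is taken under the assumption that this partition of $A_2,\ldots,A_n$ into those who consider the pieces equal and those who do not is uniformly random, independently in each round.
   Context: A cake $C$ is divided among players $A_1,\ldots,A_n$. Each player has a valuation: a nonnegative additive function on (well-behaved) subsets of the cake, assigning value $1$ to the whole cake; different players may have different valuations. A division (an assignment of disjoint pieces to the players, covering the cake) is envy free if every player values his own piece at least as much as the piece of any other player. A discrete protocol is a procedure consisting only of discrete steps (players making cuts and reporting/choosing based on their valuations) that ends with a division of the cake; it is an $n$-player envy free protocol if it always ends in an envy free division provided each player follows the recommended strategy (a player who deviates cannot harm the others' guarantee). For an ordinal $\zeta$, a protocol takes (uses) $\zeta$ cuts if: the protocol starts with $\zeta$ in a counter; every time a cut is made, an outside observer who knows only what all players know at that time (and wants the protocol to succeed) replaces the counter's value by a strictly smaller ordinal; and at the end of the protocol the counter is still $\ge 0$. For example, with $\omega$ in the counter, after a cut it is replaced by some natural number (however large), namely a bound on the number of further cuts then known to be needed. Ordinal arithmetic is used, so $k\omega+(L-1)$ means $\omega$ taken $k$ times followed by $L-1$. *)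

theory Defs
  imports "HOL-Probability.Probability" "HOL-Library.Landau_Symbols"
begin

section \<open>Cakes, valuations and divisions\<close>

text \<open>
  A cake is a set \<open>C\<close> with an algebra \<open>M\<close> of admissible pieces. The last clause makes explicit
  the standing assumption that a player can cut any piece in any ratio he likes; without it
  ``cut into \<open>L\<close> pieces which she considers equal'' would not be a meaningful instruction.
  Only finite additivity is required, so atomless probability measures on a sigma-algebra are a
  special case.
\<close>

definition valuation :: "'a set \<Rightarrow> 'a set set \<Rightarrow> ('a set \<Rightarrow> real) \<Rightarrow> bool" where
  "valuation C M v \<longleftrightarrow>
     (\<forall>X\<in>M. 0 \<le> v X) \<and> additive M v \<and> v C = 1 \<and>
     (\<forall>X\<in>M. \<forall>t. 0 \<le> t \<and> t \<le> v X \<longrightarrow> (\<exists>Q\<in>M. Q \<subseteq> X \<and> v Q = t))"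

text \<open>The players \<open>A\<^sub>1, \<dots>, A\<^sub>n\<close> are the numbers \<open>1, \<dots>, n\<close>.\<close>

definition division :: "'a set \<Rightarrow> 'a set set \<Rightarrow> nat \<Rightarrow> (nat \<Rightarrow> 'a set) \<Rightarrow> bool" where
  "division C M n X \<longleftrightarrow>
     (\<forall>i\<in>{1..n}. X i \<in> M) \<and> disjoint_family_on X {1..n} \<and> (\<Union>i\<in>{1..n}. X i) = C"

definition envies_nobody :: "nat \<Rightarrow> ('a set \<Rightarrow> real) \<Rightarrow> (nat \<Rightarrow> 'a set) \<Rightarrow> nat \<Rightarrow> bool" where
  "envies_nobody n v X i \<longleftrightarrow> (\<forall>j\<in>{1..n}. v (X j) \<le> v (X i))"

definition considers_equal :: "('a set \<Rightarrow> real) \<Rightarrow> 'a set list \<Rightarrow> bool" where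
  "considers_equal v Qs \<longleftrightarrow> (\<forall>Q\<in>set Qs. \<forall>Q'\<in>set Qs. v Q = v Q')"


section \<open>Discrete protocols\<close>

text \<open>
  At any time some cake has been handed out for good (\<open>share\<close>) and the remaining cake is split
  into a list of \<open>pieces\<close>. Cut, join and give keep the indices of the other pieces; a piece that is
  used up becomes the empty set.
\<close>

record 'a state =
  share :: "nat \<Rightarrow> 'a set"
  pieces :: "'a set list"

definition initial :: "'a set \<Rightarrow> 'a state" where
  "initial C = \<lparr>share = (\<lambda>_. {}), pieces = [C]\<rparr>"

definition remaining :: "'a state \<Rightarrow> 'a set" where
  "remaining s = \<Union>(set (pieces s))"

definition cut_piece :: "nat \<Rightarrow> 'a set \<Rightarrow> 'a state \<Rightarrow> 'a state" where
  "cut_piece k Q s = s\<lparr>pieces := (pieces s)[k := Q] @ [pieces s ! k - Q]\<rparr>"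

definition join_pieces :: "nat \<Rightarrow> nat \<Rightarrow> 'a state \<Rightarrow> 'a state" where
  "join_pieces k l s = s\<lparr>pieces := (pieces s)[k := pieces s ! k \<union> pieces s ! l, l := {}]\<rparr>"

definition give_piece :: "nat \<Rightarrow> nat \<Rightarrow> 'a state \<Rightarrow> 'a state" where
  "give_piece i k s =
     s\<lparr>share := (share s)(i := share s i \<union> pieces s ! k), pieces := (pieces s)[k := {}]\<rparr>"

text \<open>
  What a player knows privately: his own value of every player's share and of every current piece.
\<close>

type_synonym view = "(nat \<Rightarrow> real) \<times> real list"

definition view :: "('a set \<Rightarrow> real) \<Rightarrow> 'a state \<Rightarrow> view" where
  "view v s = ((\<lambda>j. v (share s j)), map v (pieces s))"

text \<open>
  A protocol is a well-founded tree of discrete steps, common to all cakes and valuations. The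
  branch taken depends only on public discrete answers. The recommended strategies are part of
  the tree, as functions of the player's own view:
   \<^item> \<open>Ask i f c\<close>: player \<open>i\<close> announces a natural number (an encoded choice, comparison, bound, \<dots>),
     recommended \<open>f (view)\<close>; continue with \<open>c\<close> applied to the announced number;
   \<^item> \<open>Cut i k t p\<close>: player \<open>i\<close> makes one cut, dividing piece \<open>k\<close> in two; he is recommended to make
     the first part worth \<open>t (view)\<close> to him (truncated to the range from 0 to his value of the piece);
   \<^item> \<open>Round c\<close>: player 1 cuts all of the remaining cake into \<open>L\<close> pieces she considers equal
     (\<open>L - 1\<close> cuts), and each other player declares whether he considers all of them equal; continue
     with \<open>c D\<close>, where \<open>D\<close> is the set of players who declared that they do not.
\<close>

datatype protocol =
    Done
  | Ask nat "view \<Rightarrow> nat" "nat \<Rightarrow> protocol"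
  | Cut nat nat "view \<Rightarrow> real" protocol
  | Join nat nat protocol
  | Give nat nat protocol
  | Round "nat set \<Rightarrow> protocol"

abbreviation LCM_upto :: "nat \<Rightarrow> nat" where
  "LCM_upto n \<equiv> Lcm {2..n}"

text \<open>
  \<open>well_formed n p m\<close>: \<open>p\<close> is meaningful for players \<open>1, \<dots>, n\<close> when started with \<open>m\<close> current pieces.
\<close>

primrec well_formed :: "nat \<Rightarrow> protocol \<Rightarrow> nat \<Rightarrow> bool" where
  "well_formed n Done m \<longleftrightarrow> True"
| "well_formed n (Ask i f c) m \<longleftrightarrow> i \<in> {1..n} \<and> (\<forall>a. well_formed n (c a) m)"
| "well_formed n (Cut i k t p) m \<longleftrightarrow> i \<in> {1..n} \<and> k < m \<and> well_formed n p (Suc m)"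
| "well_formed n (Join k l p) m \<longleftrightarrow> k < m \<and> l < m \<and> k \<noteq> l \<and> well_formed n p m"
| "well_formed n (Give i k p) m \<longleftrightarrow> i \<in> {1..n} \<and> k < m \<and> well_formed n p m"
| "well_formed n (Round c) m \<longleftrightarrow> (\<forall>D\<subseteq>{2..n}. well_formed n (c D) (LCM_upto n))"

text \<open>
  Since \<open>Round\<close> opens a round and everything up to the next \<open>Round\<close> belongs to that round, a
  protocol proceeds in rounds iff its very first step is a \<open>Round\<close>.
\<close>

definition proceeds_in_rounds :: "protocol \<Rightarrow> bool" where
  "proceeds_in_rounds p \<longleftrightarrow> (\<exists>c. p = Round c)"

text \<open>
  \<open>play M n H V s p X\<close>: from state \<open>s\<close> the protocol \<open>p\<close> can end with the shares \<open>X\<close>, when the players in \<open>H\<close>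
  follow the recommended strategies for their valuations \<open>V i\<close> and all others act arbitrarily.
\<close>

inductive play ::
  "'a set set \<Rightarrow> nat \<Rightarrow> nat set \<Rightarrow> (nat \<Rightarrow> 'a set \<Rightarrow> real)
     \<Rightarrow> 'a state \<Rightarrow> protocol \<Rightarrow> (nat \<Rightarrow> 'a set) \<Rightarrow> bool"
  for M n H V where
  play_Done: "play M n H V s Done (share s)"
| play_Ask:
    "(i \<in> H \<Longrightarrow> a = f (view (V i) s))
     \<Longrightarrow> play M n H V s (c a) X
     \<Longrightarrow> play M n H V s (Ask i f c) X"
| play_Cut:
    "Q \<in> M \<Longrightarrow> Q \<subseteq> pieces s ! k
     \<Longrightarrow> (i \<in> H \<Longrightarrow> V i Q = max 0 (min (V i (pieces s ! k)) (t (view (V i) s))))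
     \<Longrightarrow> play M n H V (cut_piece k Q s) p X
     \<Longrightarrow> play M n H V s (Cut i k t p) X"
| play_Join:
    "play M n H V (join_pieces k l s) p X \<Longrightarrow> play M n H V s (Join k l p) X"
| play_Give:
    "play M n H V (give_piece i k s) p X \<Longrightarrow> play M n H V s (Give i k p) X"
| play_Round:
    "length Qs = LCM_upto n \<Longrightarrow> set Qs \<subseteq> M
     \<Longrightarrow> disjoint_family_on ((!) Qs) {..<length Qs} \<Longrightarrow> \<Union>(set Qs) = remaining s
     \<Longrightarrow> (1 \<in> H \<Longrightarrow> considers_equal (V 1) Qs)
     \<Longrightarrow> D \<subseteq> {2..n}
     \<Longrightarrow> (\<And>i. i \<in> {2..n} \<Longrightarrow> i \<in> H \<Longrightarrow> i \<in> D \<longleftrightarrow> \<not> considers_equal (V i) Qs)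
     \<Longrightarrow> play M n H V (s\<lparr>pieces := Qs\<rparr>) (c D) X
     \<Longrightarrow> play M n H V s (Round c) X"

text \<open>
  Every play ends in a division, and players who follow the recommended strategy envy nobody,
  whatever the others do. For \<open>H = {1..n}\<close> this says that the resulting division is envy free.
\<close>

definition envy_free_protocol :: "'a set \<Rightarrow> 'a set set \<Rightarrow> nat \<Rightarrow> protocol \<Rightarrow> bool" where
  "envy_free_protocol C M n p \<longleftrightarrow>
     well_formed n p 1 \<and>
     (\<forall>H V X. H \<subseteq> {1..n} \<longrightarrow> (\<forall>i\<in>H. valuation C M (V i)) \<longrightarrow> play M n H V (initial C) p X \<longrightarrow>
        division C M n X \<and> (\<forall>i\<in>H. envies_nobody n (V i) X i))"


text \<open>
  Sanity check: a well-formed protocol never gets stuck, so the condition on all plays in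
  \<open>envy_free_protocol\<close> is not vacuous.
\<close>

lemma disjoint_list_Cons:
  assumes "disjoint_family_on ((!) Qs) {..<length Qs}" and "Q \<inter> \<Union>(set Qs) = {}"
  shows "disjoint_family_on ((!) (Q # Qs)) {..<length (Q # Qs)}"
proof -
  have "Q \<inter> Qs ! j = {}" if "j < length Qs" for j
    using assms(2) nth_mem[OF that] by blast
  then show ?thesis
    using assms(1) unfolding disjoint_family_on_def
    by (auto simp: nth_Cons Int_commute split: nat.splits)
qed

lemma valuation_Diff:
  assumes "algebra C M" "valuation C M v" "X \<in> M" "Q \<in> M" "Q \<subseteq> X"
  shows "v (X - Q) = v X - v Q"
proof -
  interpret algebra C M by fact
  have "v (Q \<union> (X - Q)) = v Q + v (X - Q)"
    using assms unfolding valuation_def additive_def by (metis Diff Diff_disjoint)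
  then show ?thesis using assms(5) by (simp add: Un_absorb1)
qed

lemma equal_pieces_exist:
  assumes C: "algebra C M" and v: "valuation C M v"
  shows "X \<in> M \<Longrightarrow> v X = real (Suc m) * t \<Longrightarrow> 0 \<le> t \<Longrightarrow>
    \<exists>Qs. length Qs = Suc m \<and> set Qs \<subseteq> M \<and> disjoint_family_on ((!) Qs) {..<length Qs} \<and>
         \<Union>(set Qs) = X \<and> (\<forall>Q\<in>set Qs. v Q = t)"
proof (induction m arbitrary: X)
  case 0
  then show ?case
    by (intro exI[of _ "[X]"]) (auto simp: disjoint_family_on_def)
next
  case (Suc m)
  interpret algebra C M by fact
  have "t \<le> v X" using Suc.prems by (simp add: algebra_simps)
  then obtain Q where Q: "Q \<in> M" "Q \<subseteq> X" "v Q = t"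
    using v Suc.prems unfolding valuation_def by blast
  have "v (X - Q) = real (Suc m) * t"
    using valuation_Diff[OF C v Suc.prems(1) Q(1,2)] Q Suc.prems by (simp add: algebra_simps)
  then obtain Qs where Qs: "length Qs = Suc m" "set Qs \<subseteq> M"
      "disjoint_family_on ((!) Qs) {..<length Qs}" "\<Union>(set Qs) = X - Q" "\<forall>Q\<in>set Qs. v Q = t"
    using Suc.IH[of "X - Q"] Suc.prems Q by blast
  have "disjoint_family_on ((!) (Q # Qs)) {..<length (Q # Qs)}"
    by (rule disjoint_list_Cons) (use Qs in auto)
  then show ?case
    using Qs Q by (intro exI[of _ "Q # Qs"]) auto
qed

lemma some_pieces_exist:
  assumes "algebra C M" "X \<in> M"
  shows "\<exists>Qs. length Qs = Suc m \<and> set Qs \<subseteq> M \<and> disjoint_family_on ((!) Qs) {..<length Qs} \<and>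
         \<Union>(set Qs) = X"
proof (induction m)
  case 0
  then show ?case
    using assms by (intro exI[of _ "[X]"]) (auto simp: disjoint_family_on_def)
next
  case (Suc m)
  interpret algebra C M by fact
  obtain Qs where Qs: "length Qs = Suc m" "set Qs \<subseteq> M"
      "disjoint_family_on ((!) Qs) {..<length Qs}" "\<Union>(set Qs) = X"
    using Suc by blast
  have "disjoint_family_on ((!) ({} # Qs)) {..<length ({} # Qs)}"
    by (rule disjoint_list_Cons) (use Qs in auto)
  then show ?case
    using Qs by (intro exI[of _ "{} # Qs"]) auto
qed

lemma play_exists:
  assumes C: "algebra C M" and V: "\<And>i. i \<in> H \<Longrightarrow> valuation C M (V i)"
  shows "well_formed n p (length (pieces s)) \<Longrightarrow> set (pieces s) \<subseteq> M \<Longrightarrow> \<exists>X. play M n H V s p X"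
proof (induction p arbitrary: s)
  case Done
  then show ?case using play_Done by blast
next
  case (Ask i f c)
  then show ?case
    using play_Ask[of i H "f (view (V i) s)" f V s M n c] by fastforce
next
  case (Cut i k t p)
  interpret algebra C M by fact
  have k: "k < length (pieces s)" "pieces s ! k \<in> M"
    using Cut.prems by auto
  have "\<exists>Q\<in>M. Q \<subseteq> pieces s ! k \<and>
    (i \<in> H \<longrightarrow> V i Q = max 0 (min (V i (pieces s ! k)) (t (view (V i) s))))"
  proof (cases "i \<in> H")
    case True
    then have "0 \<le> V i (pieces s ! k)"
      using V k unfolding valuation_def by blast
    then have "0 \<le> max 0 (min (V i (pieces s ! k)) (t (view (V i) s))) \<and>
      max 0 (min (V i (pieces s ! k)) (t (view (V i) s))) \<le> V i (pieces s ! k)"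
      by auto
    then show ?thesis using V[OF True] k unfolding valuation_def by blast
  qed (use k in blast)
  then obtain Q where Q: "Q \<in> M" "Q \<subseteq> pieces s ! k"
    "i \<in> H \<Longrightarrow> V i Q = max 0 (min (V i (pieces s ! k)) (t (view (V i) s)))" by blast
  have "set (pieces (cut_piece k Q s)) \<subseteq> M"
    using Cut.prems Q k set_update_subset_insert[of "pieces s" k Q] by (auto simp: cut_piece_def)
  moreover have "length (pieces (cut_piece k Q s)) = Suc (length (pieces s))"
    by (simp add: cut_piece_def)
  ultimately obtain X where "play M n H V (cut_piece k Q s) p X"
    using Cut.IH[of "cut_piece k Q s"] Cut.prems by auto
  then show ?case using play_Cut Q by blast
next
  case (Join k l p)
  interpret algebra C M by fact
  have "pieces s ! k \<in> M" "pieces s ! l \<in> M" using Join.prems by auto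
  then have "set (pieces (join_pieces k l s)) \<subseteq> M"
    using Join.prems
    by (auto simp: join_pieces_def dest!: set_update_subset_insert[THEN subsetD])
  then show ?case
    using Join.IH[of "join_pieces k l s"] Join.prems play_Join by (fastforce simp: join_pieces_def)
next
  case (Give i k p)
  interpret algebra C M by fact
  have "set (pieces (give_piece i k s)) \<subseteq> M"
    using Give.prems by (auto simp: give_piece_def dest!: set_update_subset_insert[THEN subsetD])
  then show ?case
    using Give.IH[of "give_piece i k s"] Give.prems play_Give by (fastforce simp: give_piece_def)
next
  case (Round c)
  interpret algebra C M by fact
  have R: "remaining s \<in> M"
    using Round.prems unfolding remaining_def by (intro finite_Union) auto
  have "Lcm {2..n} \<noteq> 0" by (simp add: Lcm_0_iff)
  then obtain m where m: "Lcm {2..n} = Suc m" using not0_implies_Suc by blast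
  have "\<exists>Qs. length Qs = Suc m \<and> set Qs \<subseteq> M \<and> disjoint_family_on ((!) Qs) {..<length Qs} \<and>
         \<Union>(set Qs) = remaining s \<and> (1 \<in> H \<longrightarrow> considers_equal (V 1) Qs)"
  proof (cases "1 \<in> H")
    case True
    have "0 \<le> V 1 (remaining s)"
      using V[OF True] R unfolding valuation_def by blast
    then show ?thesis
      using equal_pieces_exist[OF C V[OF True] R, of m "V 1 (remaining s) / real (Suc m)"]
      unfolding considers_equal_def by force
  next
    case False
    then show ?thesis using some_pieces_exist[OF C R] by blast
  qed
  then obtain Qs where Qs: "length Qs = Suc m" "set Qs \<subseteq> M"
      "disjoint_family_on ((!) Qs) {..<length Qs}" "\<Union>(set Qs) = remaining s"
      "1 \<in> H \<Longrightarrow> considers_equal (V 1) Qs" by blast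
  define D where "D = {i\<in>{2..n}. \<not> considers_equal (V i) Qs}"
  have "D \<subseteq> {2..n}" by (auto simp: D_def)
  then have "\<exists>X. play M n H V (s\<lparr>pieces := Qs\<rparr>) (c D) X"
    using Round.prems Qs m by (intro Round.IH) auto
  then obtain X where X: "play M n H V (s\<lparr>pieces := Qs\<rparr>) (c D) X" by blast
  have "play M n H V s (Round c) X"
    by (rule play_Round[where Qs = Qs and D = D])
       (use Qs m X in \<open>auto simp: D_def\<close>)
  then show ?case by blast
qed


section \<open>Counting cuts by ordinals\<close>

text \<open>
  A wellorder type stands for an initial segment of the ordinals. The observer knows the
  position in the protocol tree (i.e. all answers so far), but no future answers and no valuations.
  Initial value \<open>z\<close> suffices iff the observer can strictly decrease the counter at every cut.
\<close>

definition decreases :: "nat \<Rightarrow> 'o::wellorder \<Rightarrow> 'o \<Rightarrow> bool" where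
  "decreases m z y \<longleftrightarrow> (z, y) \<in> {(a, b). b < a} ^^ m"

primrec takes_cuts :: "nat \<Rightarrow> protocol \<Rightarrow> 'o::wellorder \<Rightarrow> bool" where
  "takes_cuts n Done z \<longleftrightarrow> True"
| "takes_cuts n (Ask i f c) z \<longleftrightarrow> (\<forall>a. takes_cuts n (c a) z)"
| "takes_cuts n (Cut i k t p) z \<longleftrightarrow> (\<exists>y<z. takes_cuts n p y)"
| "takes_cuts n (Join k l p) z \<longleftrightarrow> takes_cuts n p z"
| "takes_cuts n (Give i k p) z \<longleftrightarrow> takes_cuts n p z"
| "takes_cuts n (Round c) z \<longleftrightarrow>
     (\<exists>y. decreases (LCM_upto n - 1) z y \<and> (\<forall>D\<subseteq>{2..n}. takes_cuts n (c D) y))"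

text \<open>
  The same for the plays in which the set of disagreeing players in round \<open>r\<close> is \<open>d r\<close>
  (rounds numbered from 0); all other answers remain arbitrary.
\<close>

primrec takes_cuts_along :: "nat \<Rightarrow> protocol \<Rightarrow> (nat \<Rightarrow> nat set) \<Rightarrow> 'o::wellorder \<Rightarrow> bool" where
  "takes_cuts_along n Done d z \<longleftrightarrow> True"
| "takes_cuts_along n (Ask i f c) d z \<longleftrightarrow> (\<forall>a. takes_cuts_along n (c a) d z)"
| "takes_cuts_along n (Cut i k t p) d z \<longleftrightarrow> (\<exists>y<z. takes_cuts_along n p d y)"
| "takes_cuts_along n (Join k l p) d z \<longleftrightarrow> takes_cuts_along n p d z"
| "takes_cuts_along n (Give i k p) d z \<longleftrightarrow> takes_cuts_along n p d z"
| "takes_cuts_along n (Round c) d z \<longleftrightarrow>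
     (\<exists>y. decreases (LCM_upto n - 1) z y \<and> takes_cuts_along n (c (d 0)) (\<lambda>r. d (Suc r)) y)"

text \<open>The ordinals below \<open>\<omega>\<^sup>2\<close>: \<open>Om k m\<close> is \<open>k\<omega> + m\<close>, i.e. \<open>\<omega>\<close> taken \<open>k\<close> times followed by \<open>m\<close>.\<close>

datatype omega_ord = Om (omega_coeff: nat) (finite_part: nat)

instantiation omega_ord :: wellorder
begin

definition less_omega_ord :: "omega_ord \<Rightarrow> omega_ord \<Rightarrow> bool" where
  "x < y \<longleftrightarrow> omega_coeff x < omega_coeff y \<or>
             omega_coeff x = omega_coeff y \<and> finite_part x < finite_part y"

definition less_eq_omega_ord :: "omega_ord \<Rightarrow> omega_ord \<Rightarrow> bool" where
  "x \<le> y \<longleftrightarrow> x < y \<or> x = (y :: omega_ord)"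

instance
proof
  fix P :: "omega_ord \<Rightarrow> bool" and a
  assume step: "\<And>x. (\<And>y. y < x \<Longrightarrow> P y) \<Longrightarrow> P x"
  have "wf (inv_image (less_than <*lex*> less_than) (\<lambda>x. (omega_coeff x, finite_part x)))"
    by (intro wf_inv_image wf_lex_prod wf_less_than)
  then show "P a"
    by (induction a rule: wf_induct_rule)
       (rule step, auto simp: less_omega_ord_def inv_image_def)
next
  fix x y :: omega_ord
  show "x \<le> y \<or> y \<le> x"
    by (cases x; cases y) (auto simp: less_omega_ord_def less_eq_omega_ord_def)
qed (auto simp: less_omega_ord_def less_eq_omega_ord_def)

end


section \<open>The average case\<close>

text \<open>The sets of disagreeing players: independent over the rounds, uniform among subsets of \<open>{2..n}\<close>.\<close>

definition random_partitions :: "nat \<Rightarrow> (nat \<Rightarrow> nat set) measure" where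
  "random_partitions n = (\<Pi>\<^sub>M r\<in>UNIV. uniform_count_measure (Pow {2..n}))"

text \<open>
  On average \<open>x\<omega> + m\<close> cuts (\<open>x\<close> real): along each sequence \<open>d\<close> of partitions \<open>K d \<sqdot> \<omega> + m\<close> cuts suffice,
  for a random variable \<open>K\<close> of expectation at most \<open>x\<close>.
\<close>

definition takes_cuts_on_average :: "nat \<Rightarrow> protocol \<Rightarrow> real \<Rightarrow> nat \<Rightarrow> bool" where
  "takes_cuts_on_average n p x m \<longleftrightarrow>
     (\<exists>K :: (nat \<Rightarrow> nat set) \<Rightarrow> nat.
        integrable (random_partitions n) (\<lambda>d. real (K d)) \<and>
        (\<forall>d\<in>space (random_partitions n). takes_cuts_along n p d (Om (K d) m)) \<and>
        (\<integral>d. real (K d) \<partial>random_partitions n) \<le> x)"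

end

theory Submission
  imports Defs
begin

text \<open>
  Call \<open>i\<close>'s advantage over \<open>j\<close> irrevocable if \<open>i\<close> would not envy \<open>j\<close> even if \<open>j\<close> got all of the
  remaining cake. A group \<open>G\<close> containing player 1 is kept such that everybody outside \<open>G\<close> has an
  irrevocable advantage over everybody in \<open>G\<close>; then only envy inside \<open>G\<close> matters. If all of \<open>G\<close>
  consider the \<open>L\<close> pieces equal, these are dealt out equally to \<open>G\<close>, since \<open>|G|\<close> divides \<open>L\<close>.

  Otherwise some \<open>d \<in> G\<close> strictly prefers a piece \<open>p\<close> to a piece \<open>q\<close>, and he knows a bound for the
  difference. On the line of relative differences \<open>(v p - v q) / v R\<close> player 1 sits at 0 and \<open>d\<close> at
  a positive place, so there is a gap of known width at some \<open>\<tau>\<close> between them, which separates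
  \<open>G\<close> into players \<open>low\<close> and \<open>high\<close>. Cut the cake into crumbs which are tiny for everybody, and
  round randomly to form \<open>2^n\<close> bundles of type \<open>\<alpha>\<close> (a bit of \<open>q\<close> and \<open>\<tau>\<close> times that bit of
  everything) and \<open>2^n\<close> bundles of type \<open>\<beta>\<close> (a bit of \<open>p\<close>): all low players strictly prefer each
  \<open>\<alpha>\<close> to each \<open>\<beta>\<close>, and all high players conversely. By trimming, low players divide bundles \<open>\<alpha>\<close>
  and high players divide bundles \<open>\<beta>\<close> without envy. Further envy free partial divisions, again by
  trimming, shrink the remaining cake until the advantage of the high over the low players is
  irrevocable. Replace \<open>G\<close> by the low players. This happens at most \<open>n - 1\<close> times, and each time the
  number of cuts is known after a few questions, so that \<open>(n - 1)\<omega> + (L - 1)\<close> suffices always; this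
  is below both required bounds.
\<close>

section \<open>Derandomized rounding\<close>

text \<open>Bundles of prescribed value for all players at once have to be formed publicly, but
  answers are natural numbers and reveal valuations only approximately. The known width of the gap
  makes this harmless: it fixes in advance how fine the crumbs and the announced integers must be,
  and the expectation argument is replaced by an assignment computed from the announcements. Players
  may lie, so every answer must leave a legal continuation that cannot hurt the others: indices are
  reduced modulo \<open>L\<close>, invalid rankings are replaced, implausible announcements are
  ignored in the rounding, and the cells of player 1 and \<open>d\<close> are set by the protocol.
  Each failed round costs one \<omega> because the bound announced by \<open>d\<close> has no a
  priori limit. Once it is known, some natural number covers the rest of the step together with the
  \<open>L - 1\<close> cuts of the next \<open>Round\<close>; so the summand \<open>L - 1\<close> is
  needed for the first \<open>Round\<close> only. The worst case follows from
  \<open>(n - 2)^2 \<ge> 0\<close>. On average the same bound serves as a constant random variable,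
  so the error term can be 0.\<close>

text \<open>
  If each index \<open>k\<close> is put into bundle \<open>g\<close> with probability \<open>\<pi> k g\<close>, independently, then the expected
  squared deviations of the bundle sums are at most \<open>\<Sum>k. (u i k)\<^sup>2\<close>; the induction is the method of
  conditional expectations.
\<close>

lemma rounding:
  fixes u :: "'i \<Rightarrow> 'k \<Rightarrow> real" and \<pi> :: "'k \<Rightarrow> nat \<Rightarrow> real"
  assumes "finite K" and pos: "\<And>k g. g < q \<Longrightarrow> 0 \<le> \<pi> k g" and one: "\<And>k. (\<Sum>g<q. \<pi> k g) = 1"
  shows "\<exists>\<phi>. (\<forall>k. \<phi> k < q) \<and>
    (\<Sum>i\<in>I. \<Sum>g<q. (\<Sum>k\<in>K. u i k * (of_bool (\<phi> k = g) - \<pi> k g))\<^sup>2) \<le> (\<Sum>i\<in>I. \<Sum>k\<in>K. (u i k)\<^sup>2)"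
  using assms(1)
proof (induction K)
  case empty
  have "q \<noteq> 0" using one[of undefined] by (cases q) auto
  then show ?case by (intro exI[of _ "\<lambda>_. 0"]) auto
next
  case (insert x K)
  then obtain \<phi> where \<phi>: "\<forall>k. \<phi> k < q"
    "(\<Sum>i\<in>I. \<Sum>g<q. (\<Sum>k\<in>K. u i k * (of_bool (\<phi> k = g) - \<pi> k g))\<^sup>2) \<le> (\<Sum>i\<in>I. \<Sum>k\<in>K. (u i k)\<^sup>2)"
    by blast
  define E where "E i g = (\<Sum>k\<in>K. u i k * (of_bool (\<phi> k = g) - \<pi> k g))" for i g
  define F where "F h = (\<Sum>i\<in>I. \<Sum>g<q. (E i g + u i x * (of_bool (h = g) - \<pi> x g))\<^sup>2)" for h
  \<comment> \<open>Average over the bundle \<open>h\<close> of \<open>x\<close>: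
    \<open>of_bool (h = g)\<close> has mean \<open>\<pi> x g\<close>, so the cross term cancels and
    only the variance \<open>\<pi> x g - (\<pi> x g)^2\<close> remains. Without its negative part it
    sums over \<open>g\<close> to 1.\<close>
  have avg1: "(\<Sum>h<q. \<pi> x h * (E i g + u i x * (of_bool (h = g) - \<pi> x g))\<^sup>2)
      = (E i g)\<^sup>2 + (u i x)\<^sup>2 * (\<pi> x g - (\<pi> x g)\<^sup>2)" if g: "g < q" for i g
  proof -
    have "\<pi> x h * (E i g + u i x * (of_bool (h = g) - \<pi> x g))\<^sup>2 =
      \<pi> x h * (E i g - u i x * \<pi> x g)\<^sup>2 +
      (if h = g then \<pi> x g * (2 * u i x * (E i g - u i x * \<pi> x g) + (u i x)\<^sup>2) else 0)" for h
      by (auto simp: power2_eq_square algebra_simps)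
    then have "(\<Sum>h<q. \<pi> x h * (E i g + u i x * (of_bool (h = g) - \<pi> x g))\<^sup>2) =
      (\<Sum>h<q. \<pi> x h) * (E i g - u i x * \<pi> x g)\<^sup>2 +
      \<pi> x g * (2 * u i x * (E i g - u i x * \<pi> x g) + (u i x)\<^sup>2)"
      using g by (simp add: sum.distrib sum_distrib_right)
    then show ?thesis using one by (simp add: power2_eq_square algebra_simps)
  qed
  have "(\<Sum>h<q. \<pi> x h * F h) = (\<Sum>i\<in>I. \<Sum>g<q. \<Sum>h<q. \<pi> x h * (E i g + u i x * (of_bool (h = g) - \<pi> x g))\<^sup>2)"
    unfolding F_def sum_distrib_left
    by (subst sum.swap, rule sum.cong[OF refl], subst sum.swap, rule refl)
  also have "\<dots> = (\<Sum>i\<in>I. \<Sum>g<q. (E i g)\<^sup>2 + (u i x)\<^sup>2 * (\<pi> x g - (\<pi> x g)\<^sup>2))"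
    using avg1 by (intro sum.cong) auto
  also have "\<dots> \<le> (\<Sum>i\<in>I. (\<Sum>g<q. (E i g)\<^sup>2) + (u i x)\<^sup>2)"
  proof (rule sum_mono)
    fix i
    have "(\<Sum>g<q. (u i x)\<^sup>2 * (\<pi> x g - (\<pi> x g)\<^sup>2)) \<le> (\<Sum>g<q. (u i x)\<^sup>2 * \<pi> x g)"
      by (intro sum_mono mult_left_mono) auto
    also have "\<dots> = (u i x)\<^sup>2" using one by (simp flip: sum_distrib_left)
    finally show "(\<Sum>g<q. (E i g)\<^sup>2 + (u i x)\<^sup>2 * (\<pi> x g - (\<pi> x g)\<^sup>2)) \<le> (\<Sum>g<q. (E i g)\<^sup>2) + (u i x)\<^sup>2"
      by (simp add: sum.distrib)
  qed
  also have "\<dots> \<le> (\<Sum>i\<in>I. \<Sum>k\<in>K. (u i k)\<^sup>2) + (\<Sum>i\<in>I. (u i x)\<^sup>2)"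
    using \<phi>(2) unfolding E_def by (simp add: sum.distrib)
  finally have avg: "(\<Sum>h<q. \<pi> x h * F h) \<le> (\<Sum>i\<in>I. \<Sum>k\<in>insert x K. (u i k)\<^sup>2)"
    using insert by (simp add: sum.distrib algebra_simps)
  have "\<exists>h<q. F h \<le> (\<Sum>i\<in>I. \<Sum>k\<in>insert x K. (u i k)\<^sup>2)"
  proof (rule ccontr)
    define B where "B = (\<Sum>i\<in>I. \<Sum>k\<in>insert x K. (u i k)\<^sup>2)"
    assume "\<not> (\<exists>h<q. F h \<le> (\<Sum>i\<in>I. \<Sum>k\<in>insert x K. (u i k)\<^sup>2))"
    then have *: "B < F h" if "h < q" for h using that unfolding B_def by (meson not_le)
    have "0 < (\<Sum>h<q. \<pi> x h * (F h - B))"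
    proof -
      have "\<exists>h<q. \<pi> x h \<noteq> 0" using one[of x] by (metis lessThan_iff sum.neutral zero_neq_one)
      then obtain h where "h < q" "\<pi> x h > 0" using pos by (metis less_eq_real_def)
      then show ?thesis
        using * pos by (intro sum_pos2[of _ h]) (auto simp: less_imp_le)
    qed
    then have "B * (\<Sum>h<q. \<pi> x h) < (\<Sum>h<q. \<pi> x h * F h)"
      by (simp add: right_diff_distrib sum_subtractf sum_distrib_left mult.commute)
    then show False using avg one unfolding B_def by simp
  qed
  then obtain h where h: "h < q" "F h \<le> (\<Sum>i\<in>I. \<Sum>k\<in>insert x K. (u i k)\<^sup>2)" by blast
  have "F h = (\<Sum>i\<in>I. \<Sum>g<q. (\<Sum>k\<in>insert x K. u i k * (of_bool ((\<phi>(x := h)) k = g) - \<pi> k g))\<^sup>2)"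
  proof -
    have "(\<Sum>k\<in>insert x K. u i k * (of_bool ((\<phi>(x := h)) k = g) - \<pi> k g)) =
      E i g + u i x * (of_bool (h = g) - \<pi> x g)" for i g
    proof -
      have "(\<Sum>k\<in>K. u i k * (of_bool ((\<phi>(x := h)) k = g) - \<pi> k g)) = E i g"
        unfolding E_def using insert(2) by (intro sum.cong) auto
      then show ?thesis using insert(1,2) by simp
    qed
    then show ?thesis unfolding F_def by simp
  qed
  then show ?case using h \<phi>(1) by (intro exI[of _ "\<phi>(x := h)"]) auto
qed

text \<open>The \<open>u i\<close> are announcements and may be false. The error bound is promised
  only to players whose squares sum to at most \<open>B\<close>; otherwise one absurd announcement
  would spoil it for all. The choice operator makes the assignment a function of public
  data.\<close>

definition assignment ::
  "nat set \<Rightarrow> (nat \<Rightarrow> nat \<Rightarrow> real) \<Rightarrow> (nat \<Rightarrow> nat \<Rightarrow> real) \<Rightarrow> nat \<Rightarrow> nat \<Rightarrow> real \<Rightarrow> nat \<Rightarrow> nat" where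
  "assignment G u \<pi> m q B = (SOME \<phi>. (\<forall>k. \<phi> k < q) \<and>
     (\<forall>i\<in>G. (\<Sum>k<m. (u i k)\<^sup>2) \<le> B \<longrightarrow>
       (\<forall>g<q. (\<Sum>k<m. u i k * (of_bool (\<phi> k = g) - \<pi> k g))\<^sup>2 \<le> real (card G) * B)))"

text \<open>Apply \<open>rounding\<close> to the plausible announcements only. A single squared
  deviation is at most the total over \<open>I\<close>, hence at most
  \<open>card I * B\<close>.\<close>

lemma assignment:
  assumes "finite G" "\<And>k g. g < q \<Longrightarrow> 0 \<le> \<pi> k g" "\<And>k. (\<Sum>g<q. \<pi> k g) = 1" "0 \<le> B"
  shows "assignment G u \<pi> m q B k < q"
    and "i \<in> G \<Longrightarrow> (\<Sum>k<m. (u i k)\<^sup>2) \<le> B \<Longrightarrow> g < q \<Longrightarrow>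
      (\<Sum>k<m. u i k * (of_bool (assignment G u \<pi> m q B k = g) - \<pi> k g))\<^sup>2 \<le> real (card G) * B"
proof -
  define I where "I = {i \<in> G. (\<Sum>k<m. (u i k)\<^sup>2) \<le> B}"
  have I: "finite I" using assms(1) by (simp add: I_def)
  obtain \<phi> where \<phi>: "\<forall>k. \<phi> k < q"
    "(\<Sum>i\<in>I. \<Sum>g<q. (\<Sum>k<m. u i k * (of_bool (\<phi> k = g) - \<pi> k g))\<^sup>2) \<le> (\<Sum>i\<in>I. \<Sum>k<m. (u i k)\<^sup>2)"
    using rounding[of "{..<m}" q \<pi> u I] assms by auto
  have "(\<Sum>i\<in>I. \<Sum>k<m. (u i k)\<^sup>2) \<le> (\<Sum>i\<in>I. B)" by (intro sum_mono) (simp add: I_def)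
  also have "\<dots> \<le> real (card G) * B"
    using card_mono[OF assms(1), of I] assms(4) by (auto simp: I_def intro: mult_right_mono)
  finally have bound: "(\<Sum>i\<in>I. \<Sum>g<q. (\<Sum>k<m. u i k * (of_bool (\<phi> k = g) - \<pi> k g))\<^sup>2) \<le> real (card G) * B"
    using \<phi>(2) by simp
  have each: "(\<Sum>k<m. u i k * (of_bool (\<phi> k = g) - \<pi> k g))\<^sup>2 \<le> real (card G) * B" if "i \<in> I" "g < q" for i g
  proof -
    have "(\<Sum>k<m. u i k * (of_bool (\<phi> k = g) - \<pi> k g))\<^sup>2 \<le> (\<Sum>g<q. (\<Sum>k<m. u i k * (of_bool (\<phi> k = g) - \<pi> k g))\<^sup>2)"
      using that by (intro member_le_sum) auto
    also have "\<dots> \<le> (\<Sum>i\<in>I. \<Sum>g<q. (\<Sum>k<m. u i k * (of_bool (\<phi> k = g) - \<pi> k g))\<^sup>2)"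
      using that I by (intro member_le_sum[of i I "\<lambda>i. \<Sum>g<q. (\<Sum>k<m. u i k * (of_bool (\<phi> k = g) - \<pi> k g))\<^sup>2"]) (auto intro: sum_nonneg)
    finally show ?thesis using bound by simp
  qed
  have "\<exists>\<phi>. (\<forall>k. \<phi> k < q) \<and> (\<forall>i\<in>G. (\<Sum>k<m. (u i k)\<^sup>2) \<le> B \<longrightarrow>
       (\<forall>g<q. (\<Sum>k<m. u i k * (of_bool (\<phi> k = g) - \<pi> k g))\<^sup>2 \<le> real (card G) * B))"
    using \<phi>(1) each by (intro exI[of _ \<phi>]) (auto simp: I_def)
  from someI_ex[OF this, folded assignment_def]
  show "assignment G u \<pi> m q B k < q"
    and "i \<in> G \<Longrightarrow> (\<Sum>k<m. (u i k)\<^sup>2) \<le> B \<Longrightarrow> g < q \<Longrightarrow>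
      (\<Sum>k<m. u i k * (of_bool (assignment G u \<pi> m q B k = g) - \<pi> k g))\<^sup>2 \<le> real (card G) * B"
    by blast+
qed

text \<open>In the scale \<open>w\<close>, where the whole cake is worth
  \<open>K = 2 * m * Z\<close>, two errors of size \<open>K / (2 * Z)\<close> arise. The floors lose
  at most 1 on each of the \<open>m\<close> crumbs. The assignment deviates by at most the root of
  \<open>card G * K^2 / 2^e\<close>, since values below \<open>K / 2^e\<close> with sum
  \<open>K\<close> have squares summing to at most \<open>K^2 / 2^e\<close>.\<close>

lemma bundle_error:
  fixes v :: "nat \<Rightarrow> real" and \<pi> :: "nat \<Rightarrow> nat \<Rightarrow> real" and m :: nat
  defines "R \<equiv> \<Sum>k<m. v k"
  assumes G: "finite G" "i \<in> G"
    and \<pi>: "\<And>k g. g < q \<Longrightarrow> 0 \<le> \<pi> k g" "\<And>k. (\<Sum>g<q. \<pi> k g) = 1"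
    and v: "\<And>k. k < m \<Longrightarrow> 0 \<le> v k" "\<And>k. k < m \<Longrightarrow> v k \<le> R / 2 ^ e"
    and Z: "0 < Z" "real (card G) * (2 * Z)\<^sup>2 \<le> 2 ^ e"
    and K: "K = 2 * real m * Z" "0 < m"
    and u: "\<And>k. k < m \<Longrightarrow> u i k = real (nat \<lfloor>K * v k / R\<rfloor>)"
    and g: "g < q"
  defines "\<phi> \<equiv> assignment G u \<pi> m q (K\<^sup>2 / 2 ^ e)"
  shows "\<bar>(\<Sum>k\<in>{k. k < m \<and> \<phi> k = g}. v k) - (\<Sum>k<m. \<pi> k g * v k)\<bar> \<le> R / Z"
proof (cases "R = 0")
  case True
  then have "v k = 0" if "k < m" for k
    using that v(2)[OF that] v(1)[OF that] by simp
  then show ?thesis using True by simp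
next
  case False
  have R: "0 < R" using False v(1) sum_nonneg[of "{..<m}" v] unfolding R_def by force
  have K0: "0 < K" using K Z by simp
  define w where "w k = K * v k / R" for k
  have w: "0 \<le> w k" "w k \<le> K / 2 ^ e" if "k < m" for k
    using v[OF that] R K0 mult_left_mono[OF v(2)[OF that], of K] unfolding w_def by (auto simp: field_simps)
  have sum_w: "(\<Sum>k<m. w k) = K"
    using R unfolding w_def R_def by (simp flip: sum_divide_distrib sum_distrib_left)
  have uw: "0 \<le> u i k" "u i k \<le> w k" "w k - u i k \<le> 1" if "k < m" for k
    using w(1)[OF that] u[OF that] unfolding w_def[symmetric] by (auto; linarith)+
  have "(\<Sum>k<m. (u i k)\<^sup>2) \<le> (\<Sum>k<m. w k * (K / 2 ^ e))"
    unfolding power2_eq_square using uw order_trans[OF uw(2) w(2)] w(1) by (intro sum_mono mult_mono) auto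
  also have "\<dots> = K\<^sup>2 / 2 ^ e"
    using sum_w by (simp add: power2_eq_square flip: sum_distrib_right sum_divide_distrib)
  finally have sq: "(\<Sum>k<m. (u i k)\<^sup>2) \<le> K\<^sup>2 / 2 ^ e" .
  have "(\<Sum>k<m. u i k * (of_bool (\<phi> k = g) - \<pi> k g))\<^sup>2 \<le> real (card G) * (K\<^sup>2 / 2 ^ e)"
    unfolding \<phi>_def using G sq g \<pi> by (intro assignment) auto
  also have "\<dots> \<le> (K / (2 * Z))\<^sup>2"
    using Z K0 mult_right_mono[OF Z(2), of "K\<^sup>2"] by (simp add: field_simps power_divide)
  finally have e1: "\<bar>\<Sum>k<m. u i k * (of_bool (\<phi> k = g) - \<pi> k g)\<bar> \<le> K / (2 * Z)"
    using K0 Z by (simp add: abs_le_square_iff[symmetric])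
  have \<pi>1: "\<pi> k g \<le> 1" for k
    using \<pi> g member_le_sum[of g "{..<q}" "\<pi> k"] by auto
  have "\<bar>\<Sum>k<m. (w k - u i k) * (of_bool (\<phi> k = g) - \<pi> k g)\<bar> \<le> (\<Sum>k<m. 1)"
  proof (rule order_trans[OF sum_abs sum_mono])
    fix k assume "k \<in> {..<m}"
    then have "\<bar>w k - u i k\<bar> \<le> 1" "\<bar>of_bool (\<phi> k = g) - \<pi> k g\<bar> \<le> 1"
      using uw[of k] \<pi>(1)[OF g, of k] \<pi>1[of k] by (auto simp: of_bool_def)
    then show "\<bar>(w k - u i k) * (of_bool (\<phi> k = g) - \<pi> k g)\<bar> \<le> 1"
      by (simp add: abs_mult mult_le_one)
  qed
  also have "\<dots> = K / (2 * Z)" using K Z by simp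
  finally have e2: "\<bar>\<Sum>k<m. (w k - u i k) * (of_bool (\<phi> k = g) - \<pi> k g)\<bar> \<le> K / (2 * Z)" .
  have "(\<Sum>k<m. w k * (of_bool (\<phi> k = g) - \<pi> k g)) =
    (\<Sum>k<m. u i k * (of_bool (\<phi> k = g) - \<pi> k g)) + (\<Sum>k<m. (w k - u i k) * (of_bool (\<phi> k = g) - \<pi> k g))"
    by (simp add: algebra_simps flip: sum.distrib)
  then have "\<bar>\<Sum>k<m. w k * (of_bool (\<phi> k = g) - \<pi> k g)\<bar> \<le> K / (2 * Z) + K / (2 * Z)"
    using e1 e2 by linarith
  then have bound: "\<bar>\<Sum>k<m. w k * (of_bool (\<phi> k = g) - \<pi> k g)\<bar> \<le> K / Z" using Z by (simp add: field_simps)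
  have "(\<Sum>k\<in>{k. k < m \<and> \<phi> k = g}. v k) = (\<Sum>k<m. v k * of_bool (\<phi> k = g))"
  proof -
    have "{k. k < m \<and> \<phi> k = g} = {k \<in> {..<m}. \<phi> k = g}" by auto
    then show ?thesis by (simp only: sum.inter_filter[OF finite_lessThan]) (intro sum.cong, auto)
  qed
  then have "(\<Sum>k\<in>{k. k < m \<and> \<phi> k = g}. v k) - (\<Sum>k<m. \<pi> k g * v k) =
      (\<Sum>k<m. v k * (of_bool (\<phi> k = g) - \<pi> k g))"
    by (simp add: algebra_simps sum_subtractf)
  also have "\<dots> = R / K * (\<Sum>k<m. w k * (of_bool (\<phi> k = g) - \<pi> k g))"
    using R K0 unfolding w_def sum_distrib_left by (intro sum.cong) auto
  finally have "\<bar>(\<Sum>k\<in>{k. k < m \<and> \<phi> k = g}. v k) - (\<Sum>k<m. \<pi> k g * v k)\<bar> =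
      R / K * \<bar>\<Sum>k<m. w k * (of_bool (\<phi> k = g) - \<pi> k g)\<bar>"
    using R K0 by (simp add: abs_mult)
  also have "\<dots> \<le> R / K * (K / Z)" using bound R K0 by (intro mult_left_mono) auto
  finally show ?thesis using K0 by simp
qed

section \<open>Building blocks of protocols\<close>

primrec ask_all :: "nat list \<Rightarrow> (nat \<Rightarrow> view \<Rightarrow> nat) \<Rightarrow> ((nat \<Rightarrow> nat) \<Rightarrow> protocol) \<Rightarrow> protocol" where
  "ask_all [] f c = c (\<lambda>_. 0)"
| "ask_all (i # us) f c = Ask i (f i) (\<lambda>a. ask_all us f (\<lambda>h. c (h(i := a))))"

primrec cuts :: "nat \<Rightarrow> (nat \<Rightarrow> view \<Rightarrow> real) \<Rightarrow> nat list \<Rightarrow> protocol \<Rightarrow> protocol" where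
  "cuts i t [] p = p"
| "cuts i t (k # ks) p = Cut i k (t k) (cuts i t ks p)"

primrec joins :: "(nat \<Rightarrow> nat) \<Rightarrow> nat list \<Rightarrow> protocol \<Rightarrow> protocol" where
  "joins f [] p = p"
| "joins f (k # ks) p = Join (f k) k (joins f ks p)"

primrec gives :: "(nat \<Rightarrow> nat) \<Rightarrow> nat list \<Rightarrow> protocol \<Rightarrow> protocol" where
  "gives f [] p = p"
| "gives f (k # ks) p = Give (f k) k (gives f ks p)"

text \<open>New halves are appended in order, so the crumb with index \<open>k\<close> always comes
  from the original piece \<open>k mod m\<close>.\<close>

primrec halvings :: "nat list \<Rightarrow> nat \<Rightarrow> protocol \<Rightarrow> protocol" where
  "halvings [] m p = p"
| "halvings (i # us) m p = cuts i (\<lambda>k w. snd w ! k / 2) [0..<m] (halvings us (2 * m) p)"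

text \<open>There is no step that appends an empty piece, but cutting a piece and joining its parts again has this effect.\<close>

primrec slots :: "nat \<Rightarrow> nat \<Rightarrow> protocol \<Rightarrow> protocol" where
  "slots 0 m p = p"
| "slots (Suc q) m p = Cut 1 0 (\<lambda>_. 0) (Join 0 m (slots q (Suc m) p))"

text \<open>Bundles get fresh indices from \<open>m\<close> on, and the packed pieces stay behind as
  empty ones; this keeps all indices computable in advance.\<close>

definition pack :: "nat \<Rightarrow> (nat \<Rightarrow> nat) \<Rightarrow> nat \<Rightarrow> protocol \<Rightarrow> protocol" where
  "pack q \<phi> m p = slots q m (joins (\<lambda>k. m + \<phi> k) [0..<m] p)"

definition rank :: "nat list \<Rightarrow> view \<Rightarrow> nat" where
  "rank bs w = to_nat (sort_key (\<lambda>k. - (snd w ! k)) bs)"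

text \<open>The fallback \<open>bs\<close> ensures that no answer of a deviating player can refer to
  an invalid piece.\<close>

definition ranking :: "nat list \<Rightarrow> nat \<Rightarrow> nat list" where
  "ranking bs a = (let xs = from_nat a in if distinct xs \<and> set xs = set bs then xs else bs)"

text \<open>
  Player \<open>g\<close> trims his \<open>2^m - 1\<close> favourites to the value of the next one, where \<open>m\<close> other players
  follow. These touch or take fewer than \<open>2^m\<close> pieces, so that one of the \<open>2^m\<close> tied pieces is left
  for \<open>g\<close>, who need not be asked which one he wants. The continuation gets the touched pieces.
\<close>

primrec allot :: "nat list \<Rightarrow> nat list \<Rightarrow> (nat set \<Rightarrow> protocol) \<Rightarrow> protocol" where
  "allot bs [] c = c {}"
| "allot bs (g # gs) c = Ask g (rank bs) (\<lambda>a.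
     cuts g (\<lambda>_ w. snd w ! (ranking bs a ! (2 ^ length gs - 1))) (take (2 ^ length gs - 1) (ranking bs a))
       (allot bs gs (\<lambda>U.
          Give g (SOME k. k \<in> set (take (2 ^ length gs) (ranking bs a)) - U)
            (c (U \<union> set (take (2 ^ length gs) (ranking bs a)))))))"

text \<open>Every cut appends one piece, so this number is both the cost of \<open>allot\<close> and
  the growth of the list of pieces.\<close>

primrec allot_cuts :: "nat \<Rightarrow> nat" where
  "allot_cuts 0 = 0"
| "allot_cuts (Suc k) = (2 ^ k - 1) + allot_cuts k"

lemma set_ranking: "distinct bs \<Longrightarrow> set (ranking bs a) = set bs \<and> distinct (ranking bs a)"
  by (auto simp: ranking_def Let_def)

lemma length_ranking: "distinct bs \<Longrightarrow> length (ranking bs a) = length bs"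
  using set_ranking[of bs a] by (metis distinct_card)

lemma ranking_rank:
  "distinct bs \<Longrightarrow> ranking bs (rank bs w) = sort_key (\<lambda>k. - (snd w ! k)) bs"
  by (simp add: ranking_def rank_def)

text \<open>For each entry \<open>i\<close>, the whole remaining cake becomes piece \<open>m\<close>
  and \<open>i\<close> halves it \<open>n\<close> times. Its \<open>2^n\<close> parts, equal for an
  honest \<open>i\<close>, sit at the indices congruent to \<open>m\<close> modulo
  \<open>Suc m\<close>; all other pieces are empty. \<open>allot\<close> then gives \<open>i\<close>
  at least the fraction \<open>1 / 2^n\<close> of the remaining cake in his own measure.\<close>

primrec shrink :: "nat \<Rightarrow> nat list \<Rightarrow> nat list \<Rightarrow> nat \<Rightarrow> protocol \<Rightarrow> protocol" where
  "shrink n gl [] m p = p"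
| "shrink n gl (i # us) m p =
     pack 1 (\<lambda>_. 0) m (halvings (replicate n i) (Suc m)
       (allot (map (\<lambda>t. t * Suc m + m) [0..<2 ^ n]) (i # filter (\<lambda>j. j \<noteq> i) gl)
         (\<lambda>_. shrink n gl us (Suc m * 2 ^ n + allot_cuts (length gl)) p)))"

lemma length_move_front: "distinct gl \<Longrightarrow> i \<in> set gl \<Longrightarrow> length (i # filter (\<lambda>j. j \<noteq> i) gl) = length gl"
  by (induction gl) (auto intro!: arg_cong[where f = length] filter_True)

section \<open>The protocol\<close>

text \<open>
  The probability of putting crumb \<open>k\<close>, which comes from piece \<open>k mod L\<close>, into bundle \<open>g\<close>; bundle
  \<open>2 * 2^n\<close> collects the leftovers.
\<close>

definition weight :: "nat \<Rightarrow> nat \<Rightarrow> real \<Rightarrow> nat \<Rightarrow> nat \<Rightarrow> nat \<Rightarrow> nat \<Rightarrow> real" where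
  "weight n L \<tau> p q k g =
     (if g < 2 ^ n then (of_bool (k mod L = q) + \<tau>) / (4 * 2 ^ n)
      else if g < 2 * 2 ^ n then of_bool (k mod L = p) / (4 * 2 ^ n)
      else 1 - (of_bool (k mod L = q) + \<tau> + of_bool (k mod L = p)) / 4)"

text \<open>
  The gap has relative width \<open>1 / (r * n)\<close>, hence bundles of different type differ by at least
  \<open>1 / (8 * r * n * 2^n)\<close> in expectation; an error of \<open>1 / precision\<close> in each bundle uses up half of this.
\<close>

definition precision :: "nat \<Rightarrow> nat \<Rightarrow> nat" where
  "precision n r = 32 * r * n * 2 ^ n"

text \<open>With \<open>Z = precision n r\<close>, an exponent \<open>e\<close> is large enough once
  \<open>card G * (2 * Z)^2 \<le> 2^e\<close>. Taking the left side itself, with \<open>n\<close>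
  for \<open>card G\<close>, avoids logarithms, as a number is below its own power of two.\<close>

definition crumb_exp :: "nat \<Rightarrow> nat \<Rightarrow> nat" where
  "crumb_exp n r = n * (2 * precision n r) ^ 2"

definition crumb_count :: "nat \<Rightarrow> nat \<Rightarrow> nat \<Rightarrow> nat" where
  "crumb_count n r h = LCM_upto n * 2 ^ (h * crumb_exp n r)"

definition scale :: "nat \<Rightarrow> nat \<Rightarrow> nat \<Rightarrow> real" where
  "scale n r h = 2 * real (crumb_count n r h) * real (precision n r)"

text \<open>The vector of values is published as one number, in units of \<open>1 / K\<close> of the
  remaining cake.\<close>

definition report :: "real \<Rightarrow> view \<Rightarrow> nat" where
  "report K w = to_nat (map (\<lambda>x. nat \<lfloor>K * x / sum_list (snd w)\<rfloor>) (snd w))"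

definition bundling :: "nat \<Rightarrow> nat set \<Rightarrow> nat \<Rightarrow> real \<Rightarrow> nat \<Rightarrow> nat \<Rightarrow> (nat \<Rightarrow> nat) \<Rightarrow> nat \<Rightarrow> nat" where
  "bundling n G r \<tau> p q a =
     assignment G (\<lambda>i k. real ((from_nat (a i) :: nat list) ! k)) (weight n (LCM_upto n) \<tau> p q)
       (crumb_count n r (card G)) (2 * 2 ^ n + 1) ((scale n r (card G))\<^sup>2 / 2 ^ crumb_exp n r)"

text \<open>The two rounds of \<open>allot\<close> give each honest high player a lead of at least
  \<open>1 / x\<close> of the remaining cake over each low player, where
  \<open>x = 16 * r * n * 2^n\<close>. By \<open>shrink_factor\<close>, \<open>2^n * x\<close>
  repetitions per high player reduce the remaining cake to that fraction.\<close>

definition separate :: "nat \<Rightarrow> nat set \<Rightarrow> nat \<Rightarrow> real \<Rightarrow> nat \<Rightarrow> nat \<Rightarrow> nat set \<Rightarrow> nat set \<Rightarrow> protocol \<Rightarrow> protocol" where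
  "separate n G r \<tau> p q low high c =
    (let gl = sorted_list_of_set G; m = crumb_count n r (card G) in
     halvings (concat (map (replicate (crumb_exp n r)) gl)) (LCM_upto n)
       (ask_all gl (\<lambda>_. report (scale n r (card G)))
         (\<lambda>a. pack (2 * 2 ^ n + 1) (bundling n G r \<tau> p q a) m
           (allot [m..<m + 2 ^ n] (sorted_list_of_set low)
             (\<lambda>_. allot [m + 2 ^ n..<m + 2 * 2 ^ n] (sorted_list_of_set high)
               (\<lambda>_. shrink n gl (concat (map (replicate (2 ^ n * (16 * r * n * 2 ^ n))) (sorted_list_of_set high)))
                 (m + (2 * 2 ^ n + 1) + allot_cuts (card low) + allot_cuts (card high)) c))))))"

text \<open>The divisor 4 serves the leftover bundle, from which three terms of at most 1 each are
  subtracted.\<close>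

lemma weight_nonneg: "0 \<le> \<tau> \<Longrightarrow> \<tau> \<le> 1 \<Longrightarrow> 0 \<le> weight n L \<tau> p q k g"
  by (auto simp: weight_def of_bool_def)

lemma weight_sum: "(\<Sum>g<2 * 2 ^ n + 1. weight n L \<tau> p q k g) = 1"
proof -
  let ?N = "2 ^ n :: nat"
  have "(\<Sum>g<2 * ?N. weight n L \<tau> p q k g) = (\<Sum>g<?N. weight n L \<tau> p q k g) + (\<Sum>g=?N..<2 * ?N. weight n L \<tau> p q k g)"
    using sum.atLeastLessThan_concat[of 0 ?N "2 * ?N" "weight n L \<tau> p q k"] by (simp add: atLeast0LessThan)
  also have "(\<Sum>g<?N. weight n L \<tau> p q k g) = (of_bool (k mod L = q) + \<tau>) / 4"
    by (simp add: weight_def)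
  also have "(\<Sum>g=?N..<2 * ?N. weight n L \<tau> p q k g) = of_bool (k mod L = p) / 4"
    by (simp add: weight_def)
  finally show ?thesis by (simp add: weight_def field_simps)
qed

lemma count_list_concat_replicate:
  "distinct gl \<Longrightarrow> count_list (concat (map (replicate e) gl)) i = (if i \<in> set gl then e else 0)"
proof (induction gl)
  case (Cons g gl)
  have "count_list (replicate e g) i = (if i = g then e else 0)" by (induction e) auto
  then show ?case using Cons by (auto simp: count_list_append)
qed simp

lemma length_concat_replicate: "length (concat (map (replicate e) gl)) = length gl * e"
  by (induction gl) auto

lemma set_concat_replicate: "set (concat (map (replicate e) gl)) \<subseteq> set gl"
  by (induction gl) auto

text \<open>By \<open>1 - t \<le> exp (- t)\<close> the power is at most \<open>exp (- x)\<close>,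
  and \<open>x \<le> exp x\<close>.\<close>

lemma shrink_factor:
  assumes "0 < x"
  shows "(1 - 1 / 2 ^ n :: real) ^ (2 ^ n * x) \<le> 1 / real x"
proof -
  have "1 - 1 / 2 ^ n \<le> exp (- (1 / 2 ^ n) :: real)"
    using exp_ge_add_one_self[of "- (1 / 2 ^ n) :: real"] by simp
  then have "(1 - 1 / 2 ^ n :: real) ^ (2 ^ n * x) \<le> exp (- (1 / 2 ^ n)) ^ (2 ^ n * x)"
    by (intro power_mono) auto
  also have "\<dots> = exp (- real x)"
    by (simp flip: exp_of_nat_mult)
  also have "\<dots> = 1 / exp (real x)" by (simp add: exp_minus inverse_eq_divide)
  also have "\<dots> \<le> 1 / real x"
  proof (intro divide_left_mono)
    show "real x \<le> exp (real x)" using exp_ge_add_one_self[of "real x"] by linarith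
  qed (use assms in auto)
  finally show ?thesis .
qed

definition better :: "view \<Rightarrow> nat" where
  "better w = (SOME p. p < length (snd w) \<and> (\<exists>q<length (snd w). snd w ! q < snd w ! p))"

definition worse :: "nat \<Rightarrow> view \<Rightarrow> nat" where
  "worse p w = (SOME q. q < length (snd w) \<and> snd w ! q < snd w ! p)"

text \<open>This answer has no a priori bound and the number of crumbs depends on it, which is what
  costs an \<omega>.\<close>

definition margin :: "nat \<Rightarrow> nat \<Rightarrow> view \<Rightarrow> nat" where
  "margin p q w = (SOME r. sum_list (snd w) \<le> (snd w ! p - snd w ! q) * real (Suc r))"

text \<open>The unit is \<open>1 / (r * n)\<close> because an honest \<open>d\<close> is at
  \<open>1 / r\<close> or beyond, which leaves \<open>n\<close> cells below him. All negative
  differences fall into cell 0.\<close>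

definition cell :: "nat \<Rightarrow> nat \<Rightarrow> nat \<Rightarrow> nat \<Rightarrow> view \<Rightarrow> nat" where
  "cell n p q r w = nat \<lfloor>(snd w ! p - snd w ! q) * (real r * real n) / sum_list (snd w)\<rfloor>"

text \<open>Player 1 is in cell \<open>0\<close> and \<open>d\<close> in cell \<open>n\<close>, so the other \<open>n - 2\<close> players leave one of the \<open>n - 1\<close> cells between them empty.\<close>

definition free_cell :: "nat \<Rightarrow> nat set \<Rightarrow> (nat \<Rightarrow> nat) \<Rightarrow> nat" where
  "free_cell n G \<kappa> = (SOME j. 0 < j \<and> j < n \<and> j \<notin> \<kappa> ` G)"

text \<open>The value for \<tau> is the midpoint of the free cell; honest players on either side of
  that cell are therefore at distance at least \<open>1 / (2 * r * n)\<close> from it.\<close>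

definition split_group :: "nat \<Rightarrow> nat set \<Rightarrow> nat \<Rightarrow> nat \<Rightarrow> nat \<Rightarrow> (nat set \<Rightarrow> protocol) \<Rightarrow> (nat \<Rightarrow> nat) \<Rightarrow> protocol" where
  "split_group n G p q r c \<kappa> =
     separate n G r ((real (free_cell n G \<kappa>) + 1 / 2) / (real r * real n)) p q
       {i \<in> G. \<kappa> i < free_cell n G \<kappa>} {i \<in> G. free_cell n G \<kappa> < \<kappa> i}
       (c {i \<in> G. \<kappa> i < free_cell n G \<kappa>})"

text \<open>Reduction modulo \<open>L\<close> makes every answer a legal index. Overwriting the
  cells of 1 and \<open>d\<close> guarantees, whatever is announced, that 1 stays in the group and
  \<open>d\<close> leaves it; for honest players it agrees with their true side of the gap.\<close>

definition gain :: "nat \<Rightarrow> nat set \<Rightarrow> nat \<Rightarrow> (nat set \<Rightarrow> protocol) \<Rightarrow> protocol" where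
  "gain n G d c =
     Ask d better (\<lambda>p. Ask d (worse (p mod LCM_upto n)) (\<lambda>q.
       Ask d (margin (p mod LCM_upto n) (q mod LCM_upto n)) (\<lambda>r.
         ask_all (sorted_list_of_set G) (\<lambda>_. cell n (p mod LCM_upto n) (q mod LCM_upto n) (Suc r))
           (\<lambda>\<kappa>. split_group n G (p mod LCM_upto n) (q mod LCM_upto n) (Suc r) c (\<kappa>(1 := 0, d := n))))))"

definition deal :: "nat \<Rightarrow> nat set \<Rightarrow> protocol" where
  "deal n G = gives (\<lambda>k. sorted_list_of_set G ! (k mod card G)) [0..<LCM_upto n] Done"

text \<open>The fuel \<open>f\<close> has to be at least the size of \<open>G\<close>.\<close>

primrec proto :: "nat \<Rightarrow> nat \<Rightarrow> nat set \<Rightarrow> protocol" where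
  "proto n 0 G = Done"
| "proto n (Suc f) G =
     Round (\<lambda>D. if D \<inter> G = {} then deal n G else gain n G (Min (D \<inter> G)) (\<lambda>low. proto n f low))"

lemma LCM_upto_pos: "0 < LCM_upto n"
  by (rule Nat.gr0I) (simp add: Lcm_0_iff)

lemma free_cell:
  assumes G: "G \<subseteq> {1..n}" "1 \<in> G" "d \<in> G" "d \<noteq> 1" and \<kappa>: "\<kappa> 1 = 0" "\<kappa> d = n"
  shows "0 < free_cell n G \<kappa>" "free_cell n G \<kappa> < n" "free_cell n G \<kappa> \<notin> \<kappa> ` G"
proof -
  have fin: "finite G" using G(1) finite_subset by blast
  have "card (\<kappa> ` (G - {1, d})) \<le> card (G - {1, d})" using fin by (intro card_image_le) auto
  also have "\<dots> = card G - 2" using G fin by (subst card_Diff_subset) auto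
  also have "\<dots> \<le> n - 2" using card_mono[OF _ G(1)] by auto
  also have "\<dots> < card {1..<n}"
  proof -
    have "1 \<le> d" "d \<le> n" using G by auto
    then show ?thesis using G(4) by simp
  qed
  finally have "\<not> {1..<n} \<subseteq> \<kappa> ` (G - {1, d})"
    using card_mono[of "\<kappa> ` (G - {1, d})" "{1..<n}"] fin by auto
  then obtain j where "j \<in> {1..<n}" "j \<notin> \<kappa> ` (G - {1, d})" by blast
  then have "0 < j \<and> j < n \<and> j \<notin> \<kappa> ` G" using \<kappa> by auto
  then have "0 < free_cell n G \<kappa> \<and> free_cell n G \<kappa> < n \<and> free_cell n G \<kappa> \<notin> \<kappa> ` G"
    unfolding free_cell_def by (rule someI)
  then show "0 < free_cell n G \<kappa>" "free_cell n G \<kappa> < n" "free_cell n G \<kappa> \<notin> \<kappa> ` G" by auto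
qed

text \<open>For \<open>c = card G\<close> this says that the cyclic deal is even.\<close>

lemma card_mod_class:
  assumes "0 < c" "c dvd (L :: nat)" "y < c"
  shows "card {k. k < L \<and> k mod c = y} = L div c"
proof -
  obtain b where b: "L = c * b" using assms(2) by blast
  have "{k. k < L \<and> k mod c = y} = (\<lambda>t. t * c + y) ` {..<b}"
  proof (intro equalityI subsetI)
    fix k assume k: "k \<in> {k. k < L \<and> k mod c = y}"
    then have "k div c < b" using b assms(1) by (simp add: less_mult_imp_div_less mult.commute)
    moreover have "k = (k div c) * c + y" using k by (metis (mono_tags) div_mult_mod_eq mem_Collect_eq)
    ultimately show "k \<in> (\<lambda>t. t * c + y) ` {..<b}" by blast
  next
    fix k assume "k \<in> (\<lambda>t. t * c + y) ` {..<b}"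
    then obtain t where t: "t < b" "k = t * c + y" by blast
    have "t * c + y < Suc t * c" using assms(3) by simp
    also have "\<dots> \<le> b * c" using t by (intro mult_right_mono) auto
    finally show "k \<in> {k. k < L \<and> k mod c = y}" using t b assms(3) by (simp add: mult.commute)
  qed
  moreover have "inj_on (\<lambda>t. t * c + y) {..<b}" using assms(1) by (auto simp: inj_on_def)
  ultimately show ?thesis using b assms(1) by (simp add: card_image)
qed

section \<open>Reasoning about plays\<close>

inductive_cases play_DoneE: "play M n H V s Done X"
inductive_cases play_AskE: "play M n H V s (Ask i f c) X"
inductive_cases play_CutE: "play M n H V s (Cut i k t p) X"
inductive_cases play_JoinE: "play M n H V s (Join k l p) X"
inductive_cases play_GiveE: "play M n H V s (Give i k p) X"
inductive_cases play_RoundE: "play M n H V s (Round c) X"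

locale cake = algebra C M
  for C :: "'a set" and M +
  fixes n :: nat and H :: "nat set" and V :: "nat \<Rightarrow> 'a set \<Rightarrow> real"
  assumes honest_le: "H \<subseteq> {1..n}"
    and val: "\<And>i. i \<in> H \<Longrightarrow> valuation C M (V i)"
begin

lemma val_nonneg: "i \<in> H \<Longrightarrow> X \<in> M \<Longrightarrow> 0 \<le> V i X"
  using val unfolding valuation_def by blast

lemma val_Un: "i \<in> H \<Longrightarrow> X \<in> M \<Longrightarrow> Y \<in> M \<Longrightarrow> X \<inter> Y = {} \<Longrightarrow> V i (X \<union> Y) = V i X + V i Y"
  using val unfolding valuation_def additive_def by blast

lemma val_empty: "i \<in> H \<Longrightarrow> V i {} = 0"
  using val_Un[of i "{}" "{}"] by simp

lemma val_mono: "i \<in> H \<Longrightarrow> X \<in> M \<Longrightarrow> Y \<in> M \<Longrightarrow> X \<subseteq> Y \<Longrightarrow> V i X \<le> V i Y"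
  using valuation_Diff[OF algebra_axioms val, of i Y X] val_nonneg[of i "Y - X"] by auto

lemma val_UN:
  assumes "i \<in> H" "finite K"
  shows "(\<And>k. k \<in> K \<Longrightarrow> F k \<in> M) \<Longrightarrow> (\<And>k l. k \<in> K \<Longrightarrow> l \<in> K \<Longrightarrow> k \<noteq> l \<Longrightarrow> F k \<inter> F l = {})
    \<Longrightarrow> V i (\<Union>k\<in>K. F k) = (\<Sum>k\<in>K. V i (F k))"
  using assms(2)
proof (induction K)
  case empty
  then show ?case using val_empty assms by simp
next
  case (insert x K)
  have "(\<Union>k\<in>K. F k) \<in> M" using insert by (intro finite_UN) auto
  moreover have "F x \<inter> (\<Union>k\<in>K. F k) = {}" using insert by fastforce
  ultimately show ?case using insert val_Un[OF assms(1)] by auto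
qed

section \<open>Correctness predicate and its rules for single steps\<close>

definition fair :: "(nat \<Rightarrow> 'a set) \<Rightarrow> bool" where
  "fair X \<longleftrightarrow> division C M n X \<and> (\<forall>i\<in>H. envies_nobody n (V i) X i)"

text \<open>A weakest precondition. Protocols are written in continuation style, so each building
  block gets a rule that reduces \<open>ok\<close> of the block to \<open>ok\<close> of its
  continuation in every state it can lead to.\<close>

definition ok :: "'a state \<Rightarrow> protocol \<Rightarrow> bool" where
  "ok s p \<longleftrightarrow> (\<forall>X. play M n H V s p X \<longrightarrow> fair X)"

lemma ok_Done: "fair (share s) \<Longrightarrow> ok s Done"
  unfolding ok_def by (blast elim: play_DoneE)

lemma ok_Ask:
  assumes "\<And>a. (i \<in> H \<Longrightarrow> a = f (view (V i) s)) \<Longrightarrow> ok s (c a)"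
  shows "ok s (Ask i f c)"
  unfolding ok_def
proof (intro allI impI)
  fix X assume "play M n H V s (Ask i f c) X"
  then show "fair X"
    by (rule play_AskE) (use assms in \<open>unfold ok_def, blast\<close>)
qed

lemma ok_Cut:
  assumes "\<And>Q. Q \<in> M \<Longrightarrow> Q \<subseteq> pieces s ! k
     \<Longrightarrow> (i \<in> H \<Longrightarrow> V i Q = max 0 (min (V i (pieces s ! k)) (t (view (V i) s))))
     \<Longrightarrow> ok (cut_piece k Q s) p"
  shows "ok s (Cut i k t p)"
  unfolding ok_def
proof (intro allI impI)
  fix X assume "play M n H V s (Cut i k t p) X"
  then show "fair X"
    by (rule play_CutE) (use assms in \<open>unfold ok_def, blast\<close>)
qed

lemma ok_Join: "ok (join_pieces k l s) p \<Longrightarrow> ok s (Join k l p)"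
  unfolding ok_def by (blast elim: play_JoinE)

lemma ok_Give: "ok (give_piece i k s) p \<Longrightarrow> ok s (Give i k p)"
  unfolding ok_def by (blast elim: play_GiveE)

lemma ok_Round:
  assumes "\<And>Qs D. length Qs = LCM_upto n \<Longrightarrow> set Qs \<subseteq> M
     \<Longrightarrow> disjoint_family_on ((!) Qs) {..<length Qs} \<Longrightarrow> \<Union>(set Qs) = remaining s
     \<Longrightarrow> (1 \<in> H \<Longrightarrow> considers_equal (V 1) Qs)
     \<Longrightarrow> D \<subseteq> {2..n}
     \<Longrightarrow> (\<And>i. i \<in> {2..n} \<Longrightarrow> i \<in> H \<Longrightarrow> i \<in> D \<longleftrightarrow> \<not> considers_equal (V i) Qs)
     \<Longrightarrow> ok (s\<lparr>pieces := Qs\<rparr>) (c D)"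
  shows "ok s (Round c)"
  unfolding ok_def
proof (intro allI impI)
  fix X assume "play M n H V s (Round c) X"
  then show "fair X"
  proof (rule play_RoundE, goal_cases)
    case (1 Qs D)
    have "ok (s\<lparr>pieces := Qs\<rparr>) (c D)"
      using 1 by (intro assms) auto
    then show ?case
      using 1 unfolding ok_def by blast
  qed
qed

section \<open>Shares and pieces partition the cake\<close>

definition good :: "'a state \<Rightarrow> bool" where
  "good s \<longleftrightarrow> (\<forall>i\<in>{1..n}. share s i \<in> M) \<and> set (pieces s) \<subseteq> M \<and>
     disjoint_family_on (share s) {1..n} \<and>
     disjoint_family_on ((!) (pieces s)) {..<length (pieces s)} \<and>
     (\<forall>i\<in>{1..n}. share s i \<inter> remaining s = {}) \<and>
     (\<Union>i\<in>{1..n}. share s i) \<union> remaining s = C"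

lemma remaining_nth: "remaining s = (\<Union>k<length (pieces s). pieces s ! k)"
  unfolding remaining_def by (auto simp: in_set_conv_nth) (metis nth_mem)

lemma good_piece: "good s \<Longrightarrow> k < length (pieces s) \<Longrightarrow> pieces s ! k \<in> M"
  unfolding good_def using nth_mem by blast

lemma good_disjoint:
  "good s \<Longrightarrow> k < length (pieces s) \<Longrightarrow> l < length (pieces s) \<Longrightarrow> k \<noteq> l \<Longrightarrow> pieces s ! k \<inter> pieces s ! l = {}"
  unfolding good_def disjoint_family_on_def by blast

lemma good_remaining: "good s \<Longrightarrow> remaining s \<in> M"
  unfolding good_def remaining_def by (intro finite_Union) auto

lemma good_share: "good s \<Longrightarrow> i \<in> {1..n} \<Longrightarrow> share s i \<in> M"
  unfolding good_def by blast

lemma piece_le_remaining: "k < length (pieces s) \<Longrightarrow> pieces s ! k \<subseteq> remaining s"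
  unfolding remaining_nth by blast

lemma val_remaining:
  assumes "good s" "i \<in> H"
  shows "V i (remaining s) = (\<Sum>k<length (pieces s). V i (pieces s ! k))"
  unfolding remaining_nth using assms good_piece good_disjoint by (intro val_UN) auto

lemma cut_piece_simps [simp]:
  "share (cut_piece k Q s) = share s"
  "length (pieces (cut_piece k Q s)) = Suc (length (pieces s))"
  by (auto simp: cut_piece_def)

lemma cut_piece_nth:
  "l \<le> length (pieces s) \<Longrightarrow> k < length (pieces s) \<Longrightarrow> pieces (cut_piece k Q s) ! l =
    (if l = k then Q else if l = length (pieces s) then pieces s ! k - Q else pieces s ! l)"
  by (auto simp: cut_piece_def nth_append nth_list_update)

lemma remaining_cut [simp]:
  assumes "k < length (pieces s)" "Q \<subseteq> pieces s ! k"
  shows "remaining (cut_piece k Q s) = remaining s"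
proof -
  have "x \<in> remaining (cut_piece k Q s) \<longleftrightarrow> x \<in> remaining s" for x
  proof
    assume "x \<in> remaining (cut_piece k Q s)"
    then show "x \<in> remaining s"
      using assms unfolding remaining_nth
      by (auto simp: cut_piece_nth less_Suc_eq_le split: if_splits)
  next
    assume "x \<in> remaining s"
    then obtain l where l: "l < length (pieces s)" "x \<in> pieces s ! l"
      unfolding remaining_nth by blast
    have "\<exists>l'\<le>length (pieces s). x \<in> pieces (cut_piece k Q s) ! l'"
    proof (cases "l = k \<and> x \<notin> Q")
      case True
      then show ?thesis using l assms
        by (intro exI[of _ "length (pieces s)"]) (auto simp: cut_piece_nth)
    next
      case False
      then show ?thesis using l assms by (intro exI[of _ l]) (auto simp: cut_piece_nth)
    qed
    then show "x \<in> remaining (cut_piece k Q s)"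
      unfolding remaining_nth by (auto simp: less_Suc_eq_le)
  qed
  then show ?thesis by blast
qed

lemma good_cut:
  assumes "good s" "k < length (pieces s)" "Q \<in> M" "Q \<subseteq> pieces s ! k"
  shows "good (cut_piece k Q s)"
proof -
  have "pieces (cut_piece k Q s) ! l \<in> M" if "l \<le> length (pieces s)" for l
    using that assms good_piece[OF assms(1)] by (auto simp: cut_piece_nth)
  then have "set (pieces (cut_piece k Q s)) \<subseteq> M"
    by (metis cut_piece_simps(2) in_set_conv_nth less_Suc_eq_le subsetI)
  moreover have "pieces (cut_piece k Q s) ! l \<inter> pieces (cut_piece k Q s) ! l' = {}"
    if "l < l'" "l' \<le> length (pieces s)" for l l'
  proof -
    have "pieces (cut_piece k Q s) ! l \<subseteq> pieces s ! l"
      using that assms by (auto simp: cut_piece_nth)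
    moreover have "pieces s ! l \<inter> pieces s ! l' = {}" if "l' < length (pieces s)"
      using that \<open>l < l'\<close> assms good_disjoint[OF assms(1), of l l'] by auto
    moreover have "pieces s ! l \<inter> pieces s ! k = {}" if "l \<noteq> k"
      using that \<open>l < l'\<close> \<open>l' \<le> _\<close> assms good_disjoint[OF assms(1), of l k] by auto
    moreover have "pieces (cut_piece k Q s) ! l' \<subseteq> pieces s ! l'" if "l' < length (pieces s)"
      using that assms by (auto simp: cut_piece_nth)
    ultimately show ?thesis
      using that assms by (cases "l' < length (pieces s)"; cases "l = k"; auto simp: cut_piece_nth)
  qed
  then have "disjoint_family_on ((!) (pieces (cut_piece k Q s))) {..<Suc (length (pieces s))}"
    unfolding disjoint_family_on_def by (metis Int_commute lessThan_iff less_Suc_eq_le linorder_neqE_nat)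
  ultimately show ?thesis
    using assms unfolding good_def by simp
qed

lemma join_pieces_simps [simp]:
  "share (join_pieces k l s) = share s"
  "length (pieces (join_pieces k l s)) = length (pieces s)"
  by (auto simp: join_pieces_def)

lemma join_pieces_nth:
  "j < length (pieces s) \<Longrightarrow> k \<noteq> l \<Longrightarrow> pieces (join_pieces k l s) ! j =
    (if j = l then {} else if j = k then pieces s ! k \<union> pieces s ! l else pieces s ! j)"
  by (auto simp: join_pieces_def nth_list_update)

lemma remaining_join [simp]:
  assumes "k < length (pieces s)" "l < length (pieces s)" "k \<noteq> l"
  shows "remaining (join_pieces k l s) = remaining s"
  unfolding remaining_nth
proof (intro set_eqI iffI)
  fix x assume "x \<in> (\<Union>j<length (pieces (join_pieces k l s)). pieces (join_pieces k l s) ! j)"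
  then show "x \<in> (\<Union>j<length (pieces s). pieces s ! j)"
    using assms by (auto simp: join_pieces_nth split: if_splits)
next
  fix x assume "x \<in> (\<Union>j<length (pieces s). pieces s ! j)"
  then obtain j where "j < length (pieces s)" "x \<in> pieces s ! j" by blast
  then show "x \<in> (\<Union>j<length (pieces (join_pieces k l s)). pieces (join_pieces k l s) ! j)"
    using assms by (intro UN_I[of "if j = l then k else j"]) (auto simp: join_pieces_nth)
qed

lemma good_join:
  assumes "good s" "k < length (pieces s)" "l < length (pieces s)" "k \<noteq> l"
  shows "good (join_pieces k l s)"
proof -
  have "pieces (join_pieces k l s) ! j \<in> M" if "j < length (pieces s)" for j
    using that assms good_piece[OF assms(1)] by (auto simp: join_pieces_nth)
  then have "set (pieces (join_pieces k l s)) \<subseteq> M"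
    by (metis join_pieces_simps(2) in_set_conv_nth subsetI)
  moreover have "disjoint_family_on ((!) (pieces (join_pieces k l s))) {..<length (pieces s)}"
    unfolding disjoint_family_on_def
    using assms good_disjoint[OF assms(1)]
    by (simp add: join_pieces_nth Int_Un_distrib Int_Un_distrib2)
  ultimately show ?thesis
    using assms unfolding good_def by simp
qed

lemma give_piece_simps [simp]:
  "length (pieces (give_piece i k s)) = length (pieces s)"
  "share (give_piece i k s) = (share s)(i := share s i \<union> pieces s ! k)"
  by (auto simp: give_piece_def)

lemma give_piece_nth:
  "j < length (pieces s) \<Longrightarrow> pieces (give_piece i k s) ! j = (if j = k then {} else pieces s ! j)"
  by (auto simp: give_piece_def nth_list_update)

lemma remaining_give:
  assumes "good s" "k < length (pieces s)"
  shows "remaining (give_piece i k s) = remaining s - pieces s ! k"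
proof -
  have "x \<in> remaining (give_piece i k s) \<longleftrightarrow> (\<exists>j<length (pieces s). j \<noteq> k \<and> x \<in> pieces s ! j)" for x
    unfolding remaining_nth by (auto simp: give_piece_nth split: if_splits)
  moreover have "x \<in> remaining s - pieces s ! k \<longleftrightarrow> (\<exists>j<length (pieces s). j \<noteq> k \<and> x \<in> pieces s ! j)" for x
    unfolding remaining_nth using good_disjoint[OF assms(1)] assms(2) by blast
  ultimately show ?thesis by blast
qed

lemma good_give:
  assumes "good s" "k < length (pieces s)" "i \<in> {1..n}"
  shows "good (give_piece i k s)"
proof -
  have P: "pieces s ! k \<subseteq> remaining s" using piece_le_remaining assms by blast
  have S: "share s j \<inter> remaining s = {}" if "j \<in> {1..n}" for j
    using assms(1) that unfolding good_def by blast
  have D: "share s j \<inter> share s l = {}" if "j \<in> {1..n}" "l \<in> {1..n}" "j \<noteq> l" for j l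
    using assms(1) that unfolding good_def disjoint_family_on_def by blast
  have "pieces (give_piece i k s) ! j \<in> M" if "j < length (pieces s)" for j
    using that assms good_piece[OF assms(1)] by (auto simp: give_piece_nth)
  then have "set (pieces (give_piece i k s)) \<subseteq> M"
    by (metis give_piece_simps(1) in_set_conv_nth subsetI)
  moreover have "disjoint_family_on ((!) (pieces (give_piece i k s))) {..<length (pieces s)}"
    unfolding disjoint_family_on_def
    using assms good_disjoint[OF assms(1)] by (simp add: give_piece_nth)
  moreover have "\<forall>j\<in>{1..n}. share (give_piece i k s) j \<in> M"
    using assms good_share good_piece by auto
  moreover have "disjoint_family_on (share (give_piece i k s)) {1..n}"
    unfolding disjoint_family_on_def
  proof (intro ballI impI)
    fix j l assume jl: "j \<in> {1..n}" "l \<in> {1..n}" "j \<noteq> l"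
    have "share s j \<inter> pieces s ! k = {}" "share s l \<inter> pieces s ! k = {}" "share s j \<inter> share s l = {}"
      using S[of j] S[of l] D jl P by auto
    then show "share (give_piece i k s) j \<inter> share (give_piece i k s) l = {}"
      using jl by (auto simp: Int_Un_distrib Int_Un_distrib2 Int_commute)
  qed
  moreover have "\<forall>j\<in>{1..n}. share (give_piece i k s) j \<inter> remaining (give_piece i k s) = {}"
  proof
    fix j assume "j \<in> {1..n}"
    then show "share (give_piece i k s) j \<inter> remaining (give_piece i k s) = {}"
      using S[of j] unfolding remaining_give[OF assms(1,2)] by auto
  qed
  moreover have "(\<Union>j\<in>{1..n}. share (give_piece i k s) j) \<union> remaining (give_piece i k s) = C"
  proof -
    have "(\<Union>j\<in>{1..n}. share (give_piece i k s) j) = (\<Union>j\<in>{1..n}. share s j) \<union> pieces s ! k"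
      using assms(3) by (auto split: if_splits)
    moreover have "(\<Union>j\<in>{1..n}. share s j) \<union> remaining s = C" using assms(1) unfolding good_def by blast
    ultimately show ?thesis
      unfolding remaining_give[OF assms(1,2)] using P by blast
  qed
  ultimately show ?thesis
    using assms(1) unfolding good_def by simp
qed

section \<open>Rules for the compound building blocks\<close>

lemma ok_ask_all:
  "(\<And>h. (\<And>i. i \<in> set us \<Longrightarrow> i \<in> H \<Longrightarrow> h i = f i (view (V i) s)) \<Longrightarrow> ok s (c h)) \<Longrightarrow> ok s (ask_all us f c)"
proof (induction us arbitrary: c)
  case (Cons i us)
  show ?case
    unfolding ask_all.simps
    by (rule ok_Ask, rule Cons.IH, rule Cons.prems) auto
qed simp

lemma view_nth: "k < length (pieces s) \<Longrightarrow> snd (view v s) ! k = v (pieces s ! k)"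
  by (simp add: view_def)

text \<open>The target of a cut is computed from the view at that moment, after earlier cuts. The
  premise on \<open>T\<close> demands that it depends only on the piece itself and on pieces outside
  \<open>ks\<close>: \<open>halvings\<close> uses the former, \<open>allot\<close> the
  latter.\<close>

lemma ok_cuts:
  assumes "good s" "distinct ks" "set ks \<subseteq> {..<length (pieces s)}"
    and target: "\<And>k s'. i \<in> H \<Longrightarrow> k \<in> set ks \<Longrightarrow> length (pieces s) \<le> length (pieces s')
      \<Longrightarrow> pieces s' ! k = pieces s ! k
      \<Longrightarrow> (\<And>l. l < length (pieces s) \<Longrightarrow> l \<notin> set ks \<Longrightarrow> pieces s' ! l = pieces s ! l)
      \<Longrightarrow> t k (view (V i) s') = T k"
    and cont: "\<And>s'. good s' \<Longrightarrow> share s' = share s \<Longrightarrow> remaining s' = remaining s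
      \<Longrightarrow> length (pieces s') = length (pieces s) + length ks
      \<Longrightarrow> (\<And>l. l < length (pieces s) \<Longrightarrow> l \<notin> set ks \<Longrightarrow> pieces s' ! l = pieces s ! l)
      \<Longrightarrow> (\<And>j. j < length ks \<Longrightarrow>
            pieces s' ! (ks ! j) \<union> pieces s' ! (length (pieces s) + j) = pieces s ! (ks ! j))
      \<Longrightarrow> (\<And>k. i \<in> H \<Longrightarrow> k \<in> set ks \<Longrightarrow>
            V i (pieces s' ! k) = max 0 (min (V i (pieces s ! k)) (T k)))
      \<Longrightarrow> ok s' p"
  shows "ok s (cuts i t ks p)"
  using assms
proof (induction ks arbitrary: s)
  case Nil
  show ?case unfolding cuts.simps by (rule Nil.prems(5)) (use Nil.prems in auto)
next
  case (Cons k ks)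
  have k: "k < length (pieces s)" "k \<notin> set ks" using Cons.prems(2,3) by auto
  show ?case
    unfolding cuts.simps
  proof (rule ok_Cut)
    fix Q assume Q: "Q \<in> M" "Q \<subseteq> pieces s ! k"
      "i \<in> H \<Longrightarrow> V i Q = max 0 (min (V i (pieces s ! k)) (t k (view (V i) s)))"
    define s1 where "s1 = cut_piece k Q s"
    have s1: "good s1" "share s1 = share s" "remaining s1 = remaining s"
      "length (pieces s1) = Suc (length (pieces s))"
      using good_cut Cons.prems(1) k Q by (auto simp: s1_def)
    have nth1: "pieces s1 ! l = (if l = k then Q else if l = length (pieces s) then pieces s ! k - Q else pieces s ! l)"
      if "l \<le> length (pieces s)" for l
      using that k by (simp add: s1_def cut_piece_nth)
    have tk: "t k (view (V i) s) = T k" if "i \<in> H"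
      by (rule Cons.prems(4)) (use that in auto)
    have "ok s1 (cuts i t ks p)"
    proof (rule Cons.IH)
      show "set ks \<subseteq> {..<length (pieces s1)}" using Cons.prems(3) s1 by auto
      show "t k' (view (V i) s') = T k'"
        if "i \<in> H" "k' \<in> set ks" "length (pieces s1) \<le> length (pieces s')" "pieces s' ! k' = pieces s1 ! k'"
          "\<And>l. l < length (pieces s1) \<Longrightarrow> l \<notin> set ks \<Longrightarrow> pieces s' ! l = pieces s1 ! l" for k' s'
      proof (rule Cons.prems(4))
        show "pieces s' ! k' = pieces s ! k'"
        proof -
          have "k' < length (pieces s)" using that Cons.prems(3) by auto
          then show ?thesis using nth1[of k'] that k by auto
        qed
        show "pieces s' ! l = pieces s ! l" if "l < length (pieces s)" "l \<notin> set (k # ks)" for l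
          using that \<open>\<And>l. l < length (pieces s1) \<Longrightarrow> l \<notin> set ks \<Longrightarrow> pieces s' ! l = pieces s1 ! l\<close>[of l]
            nth1[of l] s1(4) by auto
      qed (use that s1 in auto)
      show "ok s' p" if *: "good s'" "share s' = share s1" "remaining s' = remaining s1"
        "length (pieces s') = length (pieces s1) + length ks"
        "\<And>l. l < length (pieces s1) \<Longrightarrow> l \<notin> set ks \<Longrightarrow> pieces s' ! l = pieces s1 ! l"
        "\<And>j. j < length ks \<Longrightarrow>
            pieces s' ! (ks ! j) \<union> pieces s' ! (length (pieces s1) + j) = pieces s1 ! (ks ! j)"
        "\<And>k. i \<in> H \<Longrightarrow> k \<in> set ks \<Longrightarrow>
            V i (pieces s' ! k) = max 0 (min (V i (pieces s1 ! k)) (T k))" for s'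
      proof (rule Cons.prems(5))
        have notin: "length (pieces s) \<notin> set ks" using Cons.prems(3) by auto
        show "pieces s' ! l = pieces s ! l" if "l < length (pieces s)" "l \<notin> set (k # ks)" for l
          using that *(5)[of l] nth1[of l] s1(4) by auto
        show "pieces s' ! ((k # ks) ! j) \<union> pieces s' ! (length (pieces s) + j) = pieces s ! ((k # ks) ! j)"
          if j: "j < length (k # ks)" for j
        proof (cases j)
          case 0
          then show ?thesis
            using *(5)[of k] *(5)[of "length (pieces s)"] nth1[of k] nth1[of "length (pieces s)"] s1(4) k notin Q(2)
            by auto
        next
          case (Suc j')
          then have "ks ! j' \<in> set ks" using j by auto
          then have "ks ! j' < length (pieces s)" "ks ! j' \<noteq> k" using Cons.prems(3) k(2) by auto
          then show ?thesis
            using *(6)[of j'] nth1[of "ks ! j'"] j Suc s1(4) by auto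
        qed
        show "V i (pieces s' ! k') = max 0 (min (V i (pieces s ! k')) (T k'))"
          if "i \<in> H" "k' \<in> set (k # ks)" for k'
        proof (cases "k' = k")
          case True
          then show ?thesis using *(5)[of k] nth1[of k] Q(3) tk that s1(4) k by auto
        next
          case False
          then have "k' \<in> set ks" "k' < length (pieces s)" using that Cons.prems(3) by auto
          then show ?thesis using *(7)[of k'] nth1[of k'] that False by auto
        qed
      qed (use * s1 in auto)
    qed (use Cons.prems s1 in auto)
    then show "ok (cut_piece k Q s) (cuts i t ks p)" unfolding s1_def .
  qed
qed

text \<open>A pass of an honest \<open>i\<close> halves his values exactly, and other passes cannot
  increase them. The inequality makes crumbs small for everybody; the equation, for a single halving
  player, yields the equal parts needed by \<open>shrink\<close>.\<close>

lemma ok_halvings: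
  assumes "good s" "m = length (pieces s)" "0 < m"
    and "\<And>s'. good s' \<Longrightarrow> share s' = share s \<Longrightarrow> remaining s' = remaining s
      \<Longrightarrow> length (pieces s') = m * 2 ^ length us
      \<Longrightarrow> (\<And>k. k < m * 2 ^ length us \<Longrightarrow> pieces s' ! k \<subseteq> pieces s ! (k mod m))
      \<Longrightarrow> (\<And>k i. k < m * 2 ^ length us \<Longrightarrow> i \<in> H \<Longrightarrow>
            V i (pieces s' ! k) \<le> V i (pieces s ! (k mod m)) / 2 ^ count_list us i)
      \<Longrightarrow> (\<And>k i. k < m * 2 ^ length us \<Longrightarrow> i \<in> H \<Longrightarrow> set us \<subseteq> {i} \<Longrightarrow>
            V i (pieces s' ! k) = V i (pieces s ! (k mod m)) / 2 ^ length us)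
      \<Longrightarrow> ok s' p"
  shows "ok s (halvings us m p)"
  using assms
proof (induction us arbitrary: s m)
  case Nil
  show ?case unfolding halvings.simps by (rule Nil.prems(4)) (use Nil.prems in auto)
next
  case (Cons i us)
  note m = Cons.prems(2)
  show ?case
    unfolding halvings.simps
  proof (rule ok_cuts[where T = "\<lambda>k. V i (pieces s ! k) / 2"])
    show "snd (view (V i) s') ! k / 2 = V i (pieces s ! k) / 2"
      if "length (pieces s) \<le> length (pieces s')" "k \<in> set [0..<m]" "pieces s' ! k = pieces s ! k" for k s'
      using that m by (simp add: view_nth)
    fix s1
    assume s1: "good s1" "share s1 = share s" "remaining s1 = remaining s"
      "length (pieces s1) = length (pieces s) + length [0..<m]"
      "\<And>j. j < length [0..<m] \<Longrightarrow>
         pieces s1 ! ([0..<m] ! j) \<union> pieces s1 ! (length (pieces s) + j) = pieces s ! ([0..<m] ! j)"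
      "\<And>k. i \<in> H \<Longrightarrow> k \<in> set [0..<m] \<Longrightarrow>
         V i (pieces s1 ! k) = max 0 (min (V i (pieces s ! k)) (V i (pieces s ! k) / 2))"
    have len1: "length (pieces s1) = 2 * m" using s1(4) m by simp
    have union1: "pieces s1 ! k \<union> pieces s1 ! (m + k) = pieces s ! k" if "k < m" for k
      using s1(5)[of k] that m by simp
    have sub1: "pieces s1 ! k \<subseteq> pieces s ! (k mod m)" if "k < 2 * m" for k
    proof (cases "k < m")
      case False
      then have "k - m < m" "k mod m = k - m" "m + (k - m) = k" using that by (auto simp: le_mod_geq)
      then show ?thesis using union1[of "k - m"] by auto
    qed (use union1[of k] in auto)
    have val1: "V i (pieces s1 ! k) = V i (pieces s ! (k mod m)) / 2" if "k < 2 * m" "i \<in> H" for k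
    proof -
      have low: "V i (pieces s1 ! j) = V i (pieces s ! j) / 2" if "j < m" for j
        using s1(6)[of j] that \<open>i \<in> H\<close> val_nonneg good_piece[OF Cons.prems(1)] m by auto
      show ?thesis
      proof (cases "k < m")
        case False
        define j where "j = k - m"
        have j: "j < m" "k = m + j" using False that by (auto simp: j_def)
        have "V i (pieces s ! j) = V i (pieces s1 ! j) + V i (pieces s1 ! k)"
          unfolding union1[OF j(1), symmetric] j(2)
          using j that good_piece[OF s1(1)] good_disjoint[OF s1(1)] len1 by (intro val_Un) auto
        then show ?thesis using low[OF j(1)] j by simp
      qed (use low in simp)
    qed
    show "ok s1 (halvings us (2 * m) p)"
    proof (rule Cons.IH)
      fix s'
      assume s': "good s'" "share s' = share s1" "remaining s' = remaining s1"
        "length (pieces s') = 2 * m * 2 ^ length us"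
        "\<And>k. k < 2 * m * 2 ^ length us \<Longrightarrow> pieces s' ! k \<subseteq> pieces s1 ! (k mod (2 * m))"
        "\<And>k j. k < 2 * m * 2 ^ length us \<Longrightarrow> j \<in> H \<Longrightarrow>
            V j (pieces s' ! k) \<le> V j (pieces s1 ! (k mod (2 * m))) / 2 ^ count_list us j"
        "\<And>k j. k < 2 * m * 2 ^ length us \<Longrightarrow> j \<in> H \<Longrightarrow> set us \<subseteq> {j} \<Longrightarrow>
            V j (pieces s' ! k) = V j (pieces s1 ! (k mod (2 * m))) / 2 ^ length us"
      have mm: "k mod (2 * m) < 2 * m" "k mod (2 * m) mod m = k mod m" for k
        using Cons.prems(3) by (auto simp: mod_mod_cancel)
      show "ok s' p"
      proof (rule Cons.prems(4))
        show "pieces s' ! k \<subseteq> pieces s ! (k mod m)" if "k < m * 2 ^ length (i # us)" for k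
          using s'(5)[of k] sub1[OF mm(1), of k] that mm(2)[of k] by (auto simp: mult_ac)
        show "V j (pieces s' ! k) \<le> V j (pieces s ! (k mod m)) / 2 ^ count_list (i # us) j"
          if "k < m * 2 ^ length (i # us)" "j \<in> H" for k j
        proof -
          have "V j (pieces s' ! k) \<le> V j (pieces s1 ! (k mod (2 * m))) / 2 ^ count_list us j"
            using that s'(6) by (auto simp: mult_ac)
          also have "V j (pieces s1 ! (k mod (2 * m))) \<le> V j (pieces s ! (k mod m)) / (if i = j then 2 else 1)"
            using val1[OF mm(1), of k] sub1[OF mm(1), of k] that(2) mm good_piece[OF Cons.prems(1)] good_piece[OF s1(1)] len1 m
              Cons.prems(3)
            by (auto intro!: val_mono simp: mod_mod_cancel)
          finally show ?thesis by (auto simp: divide_right_mono field_simps)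
        qed
        show "V j (pieces s' ! k) = V j (pieces s ! (k mod m)) / 2 ^ length (i # us)"
          if "k < m * 2 ^ length (i # us)" "j \<in> H" "set (i # us) \<subseteq> {j}" for k j
          using that s'(7)[of k j] val1[OF mm(1), of k] mm by (auto simp: mult_ac field_simps)
      qed (use s' s1 in \<open>auto simp: mult_ac\<close>)
    qed (use s1 len1 Cons.prems in auto)
  qed (use Cons.prems in auto)
qed

text \<open>Joining restores piece 0 whatever \<open>Q\<close> was cut off, so it does not matter
  whether player 1 is honest.\<close>

lemma add_slot:
  assumes "Q \<subseteq> pieces s ! 0" "pieces s \<noteq> []"
  shows "join_pieces 0 (length (pieces s)) (cut_piece 0 Q s) = s\<lparr>pieces := pieces s @ [{}]\<rparr>"
proof -
  have "pieces (join_pieces 0 (length (pieces s)) (cut_piece 0 Q s)) = pieces s @ [{}]"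
    using assms
    by (intro nth_equalityI) (auto simp: join_pieces_nth cut_piece_nth nth_append less_Suc_eq_le)
  then show ?thesis by (simp add: join_pieces_def cut_piece_def)
qed

lemma ok_slots:
  "pieces s \<noteq> [] \<Longrightarrow> m = length (pieces s) \<Longrightarrow> ok (s\<lparr>pieces := pieces s @ replicate q {}\<rparr>) p \<Longrightarrow> ok s (slots q m p)"
proof (induction q arbitrary: s m)
  case (Suc q)
  show ?case
    unfolding slots.simps
  proof (rule ok_Cut, rule ok_Join)
    fix Q assume "Q \<subseteq> pieces s ! 0"
    then have "join_pieces 0 m (cut_piece 0 Q s) = s\<lparr>pieces := pieces s @ [{}]\<rparr>"
      unfolding Suc.prems(2) using Suc.prems(1) by (rule add_slot)
    then show "ok (join_pieces 0 m (cut_piece 0 Q s)) (slots q (Suc m) p)"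
      using Suc.prems by (intro Suc.IH) auto
  qed
qed simp

lemma good_slots:
  assumes "good s"
  shows "good (s\<lparr>pieces := pieces s @ replicate q {}\<rparr>)"
proof -
  have "remaining (s\<lparr>pieces := pieces s @ replicate q {}\<rparr>) = remaining s"
    by (auto simp: remaining_def)
  moreover have "disjoint_family_on ((!) (pieces s @ replicate q {})) {..<length (pieces s) + q}"
    using good_disjoint[OF assms] unfolding disjoint_family_on_def by (auto simp: nth_append)
  ultimately show ?thesis using assms unfolding good_def by auto
qed

lemma ok_joins:
  assumes "good s" "distinct ks" "set ks \<subseteq> {..<length (pieces s)}"
    "f ` set ks \<subseteq> {..<length (pieces s)} - set ks"
    and "\<And>s'. good s' \<Longrightarrow> share s' = share s \<Longrightarrow> remaining s' = remaining s
      \<Longrightarrow> length (pieces s') = length (pieces s)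
      \<Longrightarrow> (\<And>k. k \<in> set ks \<Longrightarrow> pieces s' ! k = {})
      \<Longrightarrow> (\<And>l. l < length (pieces s) \<Longrightarrow> l \<notin> set ks \<Longrightarrow>
            pieces s' ! l = pieces s ! l \<union> (\<Union>k\<in>{k \<in> set ks. f k = l}. pieces s ! k))
      \<Longrightarrow> ok s' p"
  shows "ok s (joins f ks p)"
  using assms
proof (induction ks arbitrary: s)
  case Nil
  show ?case unfolding joins.simps by (rule Nil.prems(5)) (use Nil.prems in auto)
next
  case (Cons k ks)
  have k: "k < length (pieces s)" "k \<notin> set ks" "f k < length (pieces s)" "f k \<noteq> k" "f k \<notin> set ks"
    using Cons.prems(2,3,4) by auto
  define s1 where "s1 = join_pieces (f k) k s"
  have s1: "good s1" "share s1 = share s" "remaining s1 = remaining s"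
      "length (pieces s1) = length (pieces s)"
    using good_join Cons.prems(1) k by (auto simp: s1_def)
  have nth1: "pieces s1 ! l = (if l = k then {} else if l = f k then pieces s ! f k \<union> pieces s ! k else pieces s ! l)"
      if "l < length (pieces s)" for l
    using that k by (simp add: s1_def join_pieces_nth)
  show ?case
    unfolding joins.simps
  proof (rule ok_Join, fold s1_def, rule Cons.IH)
    fix s' assume s': "good s'" "share s' = share s1" "remaining s' = remaining s1"
      "length (pieces s') = length (pieces s1)" "\<And>k. k \<in> set ks \<Longrightarrow> pieces s' ! k = {}"
      "\<And>l. l < length (pieces s1) \<Longrightarrow> l \<notin> set ks \<Longrightarrow>
            pieces s' ! l = pieces s1 ! l \<union> (\<Union>k\<in>{k \<in> set ks. f k = l}. pieces s1 ! k)"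
    have same: "pieces s1 ! k' = pieces s ! k'" if "k' \<in> set ks" for k'
    proof -
      have "k' < length (pieces s)" using that Cons.prems(3) by auto
      then show ?thesis using nth1[of k'] that k by auto
    qed
    show "ok s' p"
    proof (rule Cons.prems(5))
      show "pieces s' ! k' = {}" if "k' \<in> set (k # ks)" for k'
        using that s'(5)[of k'] s'(6)[of k] nth1[of k] k s1(4) Cons.prems(4) same
        by (cases "k' = k") auto
      show "pieces s' ! l = pieces s ! l \<union> (\<Union>k\<in>{k' \<in> set (k # ks). f k' = l}. pieces s ! k)"
        if "l < length (pieces s)" "l \<notin> set (k # ks)" for l
        using that s'(6)[of l] nth1[of l] s1(4) same by (auto split: if_splits)
    qed (use s' s1 in auto)
  qed (use Cons.prems s1 in auto)
qed

lemma ok_pack: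
  assumes "good s" "m = length (pieces s)" "0 < m" "\<And>k. k < m \<Longrightarrow> \<phi> k < q"
    and "\<And>s'. good s' \<Longrightarrow> share s' = share s \<Longrightarrow> remaining s' = remaining s
      \<Longrightarrow> length (pieces s') = m + q
      \<Longrightarrow> (\<And>k. k < m \<Longrightarrow> pieces s' ! k = {})
      \<Longrightarrow> (\<And>g. g < q \<Longrightarrow> pieces s' ! (m + g) = (\<Union>k\<in>{k. k < m \<and> \<phi> k = g}. pieces s ! k))
      \<Longrightarrow> ok s' p"
  shows "ok s (pack q \<phi> m p)"
  unfolding pack_def
proof (rule ok_slots, goal_cases)
  case 3
  define s1 where "s1 = s\<lparr>pieces := pieces s @ replicate q {}\<rparr>"
  have s1: "good s1" "share s1 = share s" "remaining s1 = remaining s" "length (pieces s1) = m + q"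
    using good_slots[OF assms(1)] assms(2) by (auto simp: s1_def remaining_def)
  have nth1: "pieces s1 ! l = (if l < m then pieces s ! l else {})" if "l < m + q" for l
    using that assms(2) by (auto simp: s1_def nth_append)
  show ?case
    unfolding s1_def[symmetric]
  proof (rule ok_joins)
    fix s' assume s': "good s'" "share s' = share s1" "remaining s' = remaining s1"
      "length (pieces s') = length (pieces s1)" "\<And>k. k \<in> set [0..<m] \<Longrightarrow> pieces s' ! k = {}"
      "\<And>l. l < length (pieces s1) \<Longrightarrow> l \<notin> set [0..<m] \<Longrightarrow>
            pieces s' ! l = pieces s1 ! l \<union> (\<Union>k\<in>{k \<in> set [0..<m]. m + \<phi> k = l}. pieces s1 ! k)"
    show "ok s' p"
    proof (rule assms(5))
      show "pieces s' ! (m + g) = (\<Union>k\<in>{k. k < m \<and> \<phi> k = g}. pieces s ! k)" if "g < q" for g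
        using s'(6)[of "m + g"] that s1(4) by (auto simp: nth1)
    qed (use s' s1 in auto)
  qed (use s1 assms in auto)
qed (use assms in auto)

lemma ok_gives:
  assumes "good s" "distinct ks" "set ks \<subseteq> {..<length (pieces s)}" "f ` set ks \<subseteq> {1..n}"
    and "\<And>s'. good s'
      \<Longrightarrow> (\<And>i. share s' i = share s i \<union> (\<Union>k\<in>{k \<in> set ks. f k = i}. pieces s ! k))
      \<Longrightarrow> length (pieces s') = length (pieces s)
      \<Longrightarrow> (\<And>l. l < length (pieces s) \<Longrightarrow> pieces s' ! l = (if l \<in> set ks then {} else pieces s ! l))
      \<Longrightarrow> ok s' p"
  shows "ok s (gives f ks p)"
  using assms
proof (induction ks arbitrary: s)
  case Nil
  show ?case unfolding gives.simps by (rule Nil.prems(5)) (use Nil.prems in auto)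
next
  case (Cons k ks)
  define s1 where "s1 = give_piece (f k) k s"
  have k: "k < length (pieces s)" "k \<notin> set ks" using Cons.prems(2,3) by auto
  have s1: "good s1" "length (pieces s1) = length (pieces s)"
    "share s1 = (share s)(f k := share s (f k) \<union> pieces s ! k)"
    using good_give Cons.prems(1,4) k by (auto simp: s1_def)
  have nth1: "pieces s1 ! l = (if l = k then {} else pieces s ! l)" if "l < length (pieces s)" for l
    using that by (simp add: s1_def give_piece_nth)
  have same: "pieces s1 ! k' = pieces s ! k'" if "k' \<in> set ks" for k'
  proof -
    have "k' < length (pieces s)" using that Cons.prems(3) by auto
    then show ?thesis using nth1[of k'] that k by auto
  qed
  show ?case
    unfolding gives.simps
  proof (rule ok_Give, fold s1_def, rule Cons.IH)
    fix s' assume s': "good s'" 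
      "\<And>i. share s' i = share s1 i \<union> (\<Union>k\<in>{k \<in> set ks. f k = i}. pieces s1 ! k)"
      "length (pieces s') = length (pieces s1)"
      "\<And>l. l < length (pieces s1) \<Longrightarrow> pieces s' ! l = (if l \<in> set ks then {} else pieces s1 ! l)"
    show "ok s' p"
    proof (rule Cons.prems(5))
      show "share s' i = share s i \<union> (\<Union>k\<in>{k' \<in> set (k # ks). f k' = i}. pieces s ! k)" for i
        unfolding s'(2) s1(3) using same by auto
    qed (use s' s1 nth1 in auto)
  qed (use Cons.prems s1 in auto)
qed

subsection \<open>Envy free partial divisions\<close>

text \<open>\<open>Y i\<close> is what \<open>i\<close> receives and \<open>U\<close> the set of
  touched pieces. That leftovers are not worth more than \<open>Y i\<close> is needed in the
  induction: an earlier player takes his piece from them afterwards. The clause on \<open>lo\<close>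
  bounds \<open>Y i\<close> from below by the value of any \<open>2^length gs\<close>
  pieces.\<close>

definition allotted ::
  "'a state \<Rightarrow> nat list \<Rightarrow> nat list \<Rightarrow> 'a state \<Rightarrow> (nat \<Rightarrow> 'a set) \<Rightarrow> nat set \<Rightarrow> bool" where
  "allotted s bs gs s' Y U \<longleftrightarrow>
     good s' \<and> length (pieces s') = length (pieces s) + allot_cuts (length gs) \<and>
     (\<forall>l<length (pieces s). l \<notin> set bs \<longrightarrow> pieces s' ! l = pieces s ! l) \<and>
     (\<forall>k\<in>set bs. pieces s' ! k \<subseteq> pieces s ! k) \<and>
     (\<forall>k\<in>set bs - U. pieces s' ! k = pieces s ! k) \<and>
     U \<subseteq> set bs \<and> card U < 2 ^ length gs \<and>
     (\<forall>i. share s' i = (if i \<in> set gs then share s i \<union> Y i else share s i)) \<and>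
     remaining s' \<subseteq> remaining s \<and>
     (\<forall>i\<in>set gs. Y i \<in> M \<and> (\<exists>k\<in>set bs. Y i \<subseteq> pieces s ! k)) \<and>
     (\<forall>i\<in>set gs \<inter> H.
        (\<forall>j\<in>set gs. V i (Y j) \<le> V i (Y i)) \<and>
        (\<forall>k\<in>set bs. V i (pieces s' ! k) \<le> V i (Y i)) \<and>
        (\<forall>lo. 2 ^ length gs \<le> card {k \<in> set bs. lo \<le> V i (pieces s ! k)} \<longrightarrow> lo \<le> V i (Y i)))"

lemma sort_key_antimono:
  assumes "j \<le> l" "l < length xs"
  shows "f (sort_key (\<lambda>k. - f k) xs ! l) \<le> (f (sort_key (\<lambda>k. - f k) xs ! j) :: real)"
proof -
  have "sorted (map (\<lambda>k. - f k) (sort_key (\<lambda>k. - f k) xs))" by simp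
  then show ?thesis using sorted_nth_mono[of "map (\<lambda>k. - f k) (sort_key (\<lambda>k. - f k) xs)" j l] assms
    by simp
qed

text \<open>Otherwise all indices of value at least \<open>lo\<close> would be among the first
  \<open>S\<close> positions.\<close>

lemma ranked_bound:
  assumes "distinct xs" "S < card {k \<in> set xs. lo \<le> f k}"
    and anti: "\<And>l. S \<le> l \<Longrightarrow> l < length xs \<Longrightarrow> f (xs ! l) \<le> (f (xs ! S) :: real)"
  shows "lo \<le> f (xs ! S)"
proof (rule ccontr)
  assume neg: "\<not> lo \<le> f (xs ! S)"
  have "{k \<in> set xs. lo \<le> f k} \<subseteq> (!) xs ` {..<S}"
  proof
    fix k assume "k \<in> {k \<in> set xs. lo \<le> f k}"
    then obtain l where "l < length xs" "k = xs ! l" "lo \<le> f (xs ! l)" by (auto simp: in_set_conv_nth)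
    then show "k \<in> (!) xs ` {..<S}" using anti[of l] neg by (cases "l < S") auto
  qed
  then have "card {k \<in> set xs. lo \<le> f k} \<le> card ((!) xs ` {..<S})" by (intro card_mono) auto
  also have "\<dots> \<le> S" using card_image_le[of "{..<S}" "(!) xs"] by simp
  finally show False using assms(2) by simp
qed

text \<open>Trimming makes \<open>2^length gs\<close> pieces tie for the top value of
  \<open>g\<close>, and the later players touch fewer than that, so \<open>g\<close> gets an
  untouched one and envies nobody. The later players do not envy \<open>g\<close>, since his piece
  is a leftover of their own allotment.\<close>

lemma ok_allot:
  assumes "good s" "distinct bs" "set bs \<subseteq> {..<length (pieces s)}" "2 ^ length gs \<le> length bs"
    "distinct gs" "set gs \<subseteq> {1..n}"
    and "\<And>s' Y U. allotted s bs gs s' Y U \<Longrightarrow> ok s' (c U)"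
  shows "ok s (allot bs gs c)"
  using assms
proof (induction gs arbitrary: s c)
  case Nil
  have "allotted s bs [] s (\<lambda>_. {}) {}"
    using Nil.prems(1) by (simp add: allotted_def)
  then show ?case using Nil.prems(7) by simp
next
  case (Cons g gs)
  define S :: nat where "S = 2 ^ length gs - 1"
  have S: "Suc S = 2 ^ length gs" by (simp add: S_def)
  have lenbs: "2 * Suc S \<le> length bs" using Cons.prems(4) S by simp
  show ?case
    unfolding allot.simps
  proof (rule ok_Ask)
    fix a assume a: "g \<in> H \<Longrightarrow> a = rank bs (view (V g) s)"
    define xs where "xs = ranking bs a"
    have xs: "distinct xs" "set xs = set bs" "length xs = length bs"
      using set_ranking[OF Cons.prems(2)] length_ranking[OF Cons.prems(2)] by (auto simp: xs_def)
    define ks where "ks = take S xs"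
    define x where "x = xs ! S"
    define T where "T = set (take (2 ^ length gs) xs)"
    have Sx: "S < length xs" using lenbs xs by simp
    have T: "T = insert x (set ks)"
      unfolding T_def S[symmetric] ks_def x_def using Sx by (simp add: take_Suc_conv_app_nth)
    have x_ks: "x \<notin> set ks"
      using xs(1) Sx unfolding ks_def x_def
      by (auto simp: in_set_conv_nth nth_eq_iff_index_eq)
    have ks: "distinct ks" "length ks = S" "set ks \<subseteq> set bs" "x \<in> set bs"
      using xs Sx set_take_subset[of S xs] nth_mem[OF Sx] by (auto simp: ks_def x_def)
    have cardT: "card T = Suc S" using ks x_ks T by (simp add: distinct_card)
    have bs_len: "k < length (pieces s)" if "k \<in> set bs" for k using that Cons.prems(3) by auto
    have anti: "V g (pieces s ! (xs ! l)) \<le> V g (pieces s ! (xs ! j))"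
      if "g \<in> H" "j \<le> l" "l < length xs" for j l
    proof -
      have "xs = sort_key (\<lambda>k. - (snd (view (V g) s) ! k)) bs"
        unfolding xs_def using a that(1) ranking_rank[OF Cons.prems(2)] by simp
      then have "snd (view (V g) s) ! (xs ! l) \<le> snd (view (V g) s) ! (xs ! j)"
        using sort_key_antimono[of j l bs "\<lambda>k. snd (view (V g) s) ! k"] that xs(3) by simp
      moreover have "xs ! l < length (pieces s)" "xs ! j < length (pieces s)"
        using that xs bs_len nth_mem[of l xs] nth_mem[of j xs] by auto
      ultimately show ?thesis by (simp add: view_nth)
    qed
    have "ok s (cuts g (\<lambda>_ w. snd w ! x) ks (allot bs gs (\<lambda>U. Give g (SOME k. k \<in> T - U) (c (U \<union> T)))))"
    proof (rule ok_cuts[where T = "\<lambda>_. V g (pieces s ! x)"])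
      fix s1
      assume s1: "good s1" "share s1 = share s" "remaining s1 = remaining s"
        "length (pieces s1) = length (pieces s) + length ks"
        "\<And>l. l < length (pieces s) \<Longrightarrow> l \<notin> set ks \<Longrightarrow> pieces s1 ! l = pieces s ! l"
        "\<And>j. j < length ks \<Longrightarrow> pieces s1 ! (ks ! j) \<union> pieces s1 ! (length (pieces s) + j) = pieces s ! (ks ! j)"
        "\<And>k. g \<in> H \<Longrightarrow> k \<in> set ks \<Longrightarrow>
           V g (pieces s1 ! k) = max 0 (min (V g (pieces s ! k)) (V g (pieces s ! x)))"
      have sub1: "pieces s1 ! k \<subseteq> pieces s ! k" if "k < length (pieces s)" for k
        using s1(5)[OF that] s1(6) that by (cases "k \<in> set ks") (auto simp: in_set_conv_nth)
      have val_ks: "V g (pieces s ! x) \<le> V g (pieces s ! k)" if gH: "g \<in> H" and kks: "k \<in> set ks" for k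
      proof -
        obtain j where j: "j < S" "k = xs ! j" using kks unfolding ks_def by (auto simp: in_set_conv_nth)
        then show ?thesis using anti[OF gH, of j S] Sx unfolding x_def by simp
      qed
      \<comment> \<open>Truncation to the range of the piece is harmless: the trimmed pieces were
        worth at least as much to \<open>g\<close> as \<open>x\<close>.\<close>
      have tied: "V g (pieces s1 ! k) = V g (pieces s ! x)" if "g \<in> H" "k \<in> T" for k
        using s1(7)[of k] s1(5)[of x] val_ks[of k] that T x_ks val_nonneg[of g "pieces s ! x"]
          good_piece[OF Cons.prems(1)] bs_len ks by auto
      have top: "V g (pieces s1 ! k) \<le> V g (pieces s ! x)" if "g \<in> H" "k \<in> set bs" for k
      proof (cases "k \<in> T")
        case False
        have "k \<in> set xs" using that xs(2) by simp
        then obtain l where l: "l < length xs" "k = xs ! l" by (auto simp: in_set_conv_nth)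
        have "xs ! j \<in> set ks" if "j < S" for j
          using that Sx nth_mem[of j "take S xs"] unfolding ks_def by simp
        then have "\<not> l < S" using False l unfolding T by auto
        then have "V g (pieces s ! k) \<le> V g (pieces s ! x)"
          using anti[OF that(1), of S l] l unfolding x_def by simp
        moreover have "pieces s1 ! k = pieces s ! k"
          using s1(5)[of k] False bs_len[OF that(2)] unfolding T by simp
        ultimately show ?thesis by simp
      qed (use tied that in auto)
      show "ok s1 (allot bs gs (\<lambda>U. Give g (SOME k. k \<in> T - U) (c (U \<union> T))))"
      proof (rule Cons.IH)
        fix s2 Y U assume al: "allotted s1 bs gs s2 Y U"
        have al1: "good s2" "length (pieces s2) = length (pieces s1) + allot_cuts (length gs)"
          "\<And>l. l < length (pieces s1) \<Longrightarrow> l \<notin> set bs \<Longrightarrow> pieces s2 ! l = pieces s1 ! l"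
          and sub2: "\<And>l. l \<in> set bs \<Longrightarrow> pieces s2 ! l \<subseteq> pieces s1 ! l"
          and same2: "\<And>l. l \<in> set bs \<Longrightarrow> l \<notin> U \<Longrightarrow> pieces s2 ! l = pieces s1 ! l"
          and U: "U \<subseteq> set bs" "card U < 2 ^ length gs"
          and share2: "\<And>i. share s2 i = (if i \<in> set gs then share s1 i \<union> Y i else share s1 i)"
          and rem2: "remaining s2 \<subseteq> remaining s1"
          and Ysub: "\<And>j. j \<in> set gs \<Longrightarrow> \<exists>l\<in>set bs. Y j \<subseteq> pieces s1 ! l \<and> Y j \<in> M"
          using al unfolding allotted_def by simp_all
        define k where "k = (SOME k. k \<in> T - U)"
        \<comment> \<open>Counting alone provides an untouched tied piece, chosen from public data;
          all of them are equally good for an honest \<open>g\<close>.\<close>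
        have "card U < card T" using U(2) cardT S by simp
        then have "T - U \<noteq> {}"
          using card_mono[of U T] finite_subset[OF U(1)] by auto
        then have k: "k \<in> T" "k \<notin> U" unfolding k_def using some_in_eq[of "T - U"] by auto
        have kbs: "k \<in> set bs" using k T ks by auto
        have len2: "length (pieces s2) = length (pieces s) + S + allot_cuts (length gs)"
          using al1(2) s1(4) ks by simp
        have k_len: "k < length (pieces s2)" using bs_len[OF kbs] len2 by simp
        have gn: "g \<in> {1..n}" "g \<notin> set gs" using Cons.prems(5,6) by auto
        define s3 where "s3 = give_piece g k s2"
        define Y' where "Y' = Y(g := pieces s2 ! k)"
        have nth3: "pieces s3 ! l = (if l = k then {} else pieces s2 ! l)" if "l < length (pieces s2)" for l
          using that by (simp add: s3_def give_piece_nth)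
        have bs_len2: "l < length (pieces s2)" if "l \<in> set bs" for l
          using bs_len[OF that] len2 by simp
        have k12: "pieces s2 ! k = pieces s1 ! k" using same2 k kbs by blast
        have val_le: "V i (pieces s3 ! l) \<le> V i (pieces s2 ! l)" if "i \<in> H" "l \<in> set bs" for i l
          using nth3[OF bs_len2[OF that(2)]] val_empty[OF that(1)]
            val_nonneg[OF that(1) good_piece[OF al1(1) bs_len2[OF that(2)]]] by auto
        have gval: "V g (Y' g) = V g (pieces s ! x)" if "g \<in> H"
          using tied[OF that k(1)] k12 by (simp add: Y'_def)
        have piece1: "pieces s1 ! l \<in> M" if "l \<in> set bs" for l
          using bs_len[OF that] s1(1,4) by (intro good_piece) auto
        have "allotted s bs (g # gs) s3 Y' (U \<union> T)"
          unfolding allotted_def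
        proof (intro conjI)
          show "good s3" unfolding s3_def using al1(1) k_len gn by (intro good_give) auto
          show "length (pieces s3) = length (pieces s) + allot_cuts (length (g # gs))"
            using len2 S by (simp add: s3_def flip: S_def)
          show "\<forall>l<length (pieces s). l \<notin> set bs \<longrightarrow> pieces s3 ! l = pieces s ! l"
          proof (intro allI impI)
            fix l assume l: "l < length (pieces s)" "l \<notin> set bs"
            then have "pieces s3 ! l = pieces s2 ! l" using nth3[of l] len2 kbs by auto
            also have "\<dots> = pieces s1 ! l" using al1(3) l s1(4) by auto
            finally show "pieces s3 ! l = pieces s ! l" using s1(5)[of l] l ks by auto
          qed
          show "\<forall>l\<in>set bs. pieces s3 ! l \<subseteq> pieces s ! l"
          proof
            fix l assume l: "l \<in> set bs"
            then show "pieces s3 ! l \<subseteq> pieces s ! l"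
              using nth3[OF bs_len2[OF l]] sub2[OF l] sub1[OF bs_len[OF l]] by (auto split: if_splits)
          qed
          show "\<forall>l\<in>set bs - (U \<union> T). pieces s3 ! l = pieces s ! l"
          proof
            fix l assume l: "l \<in> set bs - (U \<union> T)"
            then have "pieces s3 ! l = pieces s2 ! l" using nth3[of l] bs_len2[of l] k by auto
            also have "\<dots> = pieces s1 ! l" using same2 l by auto
            finally show "pieces s3 ! l = pieces s ! l" using s1(5)[of l] l T bs_len[of l] by auto
          qed
          show "U \<union> T \<subseteq> set bs" using U(1) T ks by auto
          have "card (U \<union> T) \<le> card U + card T" by (rule card_Un_le)
          then show "card (U \<union> T) < 2 ^ length (g # gs)" using U(2) cardT S by simp
          show "\<forall>i. share s3 i = (if i \<in> set (g # gs) then share s i \<union> Y' i else share s i)"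
            using share2 gn s1(2) by (auto simp: s3_def Y'_def)
          show "remaining s3 \<subseteq> remaining s"
            using remaining_give[OF al1(1) k_len, of g] rem2 s1(3) by (auto simp: s3_def)
          show "\<forall>i\<in>set (g # gs). Y' i \<in> M \<and> (\<exists>k\<in>set bs. Y' i \<subseteq> pieces s ! k)"
          proof
            fix i assume i: "i \<in> set (g # gs)"
            show "Y' i \<in> M \<and> (\<exists>k\<in>set bs. Y' i \<subseteq> pieces s ! k)"
            proof (cases "i = g")
              case True
              then show ?thesis
                using good_piece[OF al1(1) k_len] k12 sub1[OF bs_len[OF kbs]] kbs by (auto simp: Y'_def)
            next
              case False
              then obtain l where "l \<in> set bs" "Y i \<subseteq> pieces s1 ! l" "Y i \<in> M" using Ysub[of i] i by auto
              then show ?thesis using sub1[OF bs_len] False by (auto simp: Y'_def intro!: bexI[of _ l])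
            qed
          qed
          show "\<forall>i\<in>set (g # gs) \<inter> H.
            (\<forall>j\<in>set (g # gs). V i (Y' j) \<le> V i (Y' i)) \<and>
            (\<forall>k\<in>set bs. V i (pieces s3 ! k) \<le> V i (Y' i)) \<and>
            (\<forall>lo. 2 ^ length (g # gs) \<le> card {k \<in> set bs. lo \<le> V i (pieces s ! k)} \<longrightarrow> lo \<le> V i (Y' i))"
          proof
            fix i assume i: "i \<in> set (g # gs) \<inter> H"
            show "(\<forall>j\<in>set (g # gs). V i (Y' j) \<le> V i (Y' i)) \<and>
              (\<forall>k\<in>set bs. V i (pieces s3 ! k) \<le> V i (Y' i)) \<and>
              (\<forall>lo. 2 ^ length (g # gs) \<le> card {k \<in> set bs. lo \<le> V i (pieces s ! k)} \<longrightarrow> lo \<le> V i (Y' i))"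
            proof (cases "i = g")
              case True
              then have gH: "g \<in> H" using i by simp
              have "V g (Y' j) \<le> V g (Y' g)" if j: "j \<in> set (g # gs)" for j
              proof (cases "j = g")
                case False
                then obtain l where l: "l \<in> set bs" "Y j \<subseteq> pieces s1 ! l" "Y j \<in> M"
                  using Ysub[of j] j by auto
                have "V g (Y j) \<le> V g (pieces s1 ! l)" using l gH piece1 by (intro val_mono) auto
                then show ?thesis using top[OF gH l(1)] gval[OF gH] False by (simp add: Y'_def)
              qed simp
              moreover have "V g (pieces s3 ! l) \<le> V g (Y' g)" if l: "l \<in> set bs" for l
              proof -
                have "V g (pieces s2 ! l) \<le> V g (pieces s1 ! l)"
                  using gH piece1[OF l] sub2[OF l] good_piece[OF al1(1) bs_len2[OF l]] by (intro val_mono) auto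
                then show ?thesis using val_le[OF gH l] top[OF gH l] gval[OF gH] by simp
              qed
              moreover have "lo \<le> V g (Y' g)"
                if "2 ^ length (g # gs) \<le> card {k \<in> set bs. lo \<le> V g (pieces s ! k)}" for lo
              proof -
                have "S < card {k \<in> set xs. lo \<le> V g (pieces s ! k)}" using that S xs(2) by simp
                then have "lo \<le> V g (pieces s ! (xs ! S))"
                  by (rule ranked_bound[OF xs(1), where f = "\<lambda>k. V g (pieces s ! k)"])
                    (use anti[OF gH] in auto)
                then show ?thesis using gval[OF gH] by (simp add: x_def)
              qed
              ultimately show ?thesis unfolding True by blast
            next
              case False
              then have i': "i \<in> set gs" "i \<in> H" using i by auto
              then have Y'i: "Y' i = Y i" using gn by (auto simp: Y'_def)
              have ali: "\<forall>j\<in>set gs. V i (Y j) \<le> V i (Y i)" "\<forall>k\<in>set bs. V i (pieces s2 ! k) \<le> V i (Y i)"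
                "\<And>lo. 2 ^ length gs \<le> card {k \<in> set bs. lo \<le> V i (pieces s1 ! k)} \<Longrightarrow> lo \<le> V i (Y i)"
                using al i' unfolding allotted_def by simp_all
              have "V i (Y' j) \<le> V i (Y' i)" if j: "j \<in> set (g # gs)" for j
                using ali(1,2) kbs j gn Y'i by (cases "j = g") (auto simp: Y'_def)
              moreover have "V i (pieces s3 ! l) \<le> V i (Y' i)" if l: "l \<in> set bs" for l
                using ali(2) val_le[OF i'(2) l] l Y'i by fastforce
              moreover have "lo \<le> V i (Y' i)"
                if "2 ^ length (g # gs) \<le> card {k \<in> set bs. lo \<le> V i (pieces s ! k)}" for lo
              proof -
                \<comment> \<open>Trimming by \<open>g\<close> spoils at most
                  \<open>S = 2^length gs - 1\<close> of the \<open>2 * 2^length gs\<close> pieces of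
                  value at least \<open>lo\<close>, so enough of them survive for the induction
                  hypothesis.\<close>
                have "{k \<in> set bs. lo \<le> V i (pieces s ! k)} \<subseteq> {k \<in> set bs. lo \<le> V i (pieces s1 ! k)} \<union> set ks"
                  using s1(5) bs_len by auto
                then have "card {k \<in> set bs. lo \<le> V i (pieces s ! k)} \<le>
                  card ({k \<in> set bs. lo \<le> V i (pieces s1 ! k)} \<union> set ks)" by (intro card_mono) auto
                also have "\<dots> \<le> card {k \<in> set bs. lo \<le> V i (pieces s1 ! k)} + card (set ks)"
                  by (rule card_Un_le)
                finally have "2 ^ length gs \<le> card {k \<in> set bs. lo \<le> V i (pieces s1 ! k)}"
                  using that ks S by (simp add: distinct_card)
                then show ?thesis using ali(3) Y'i by simp
              qed
              ultimately show ?thesis by blast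
            qed
          qed
        qed
        then have "ok s3 (c (U \<union> T))" by (rule Cons.prems(7))
        then show "ok s2 (Give g (SOME k. k \<in> T - U) (c (U \<union> T)))"
          unfolding s3_def k_def by (rule ok_Give)
      qed (use Cons.prems s1 in auto)
    next
      show "snd (view (V g) s') ! x = V g (pieces s ! x)"
        if "length (pieces s) \<le> length (pieces s')"
          "\<And>l. l < length (pieces s) \<Longrightarrow> l \<notin> set ks \<Longrightarrow> pieces s' ! l = pieces s ! l" for s'
        using that bs_len[OF ks(4)] x_ks by (simp add: view_nth)
    qed (use Cons.prems(1) ks bs_len in auto)
    then show "ok s (cuts g (\<lambda>_ w. snd w ! (ranking bs a ! (2 ^ length gs - 1)))
        (take (2 ^ length gs - 1) (ranking bs a))
        (allot bs gs (\<lambda>U. Give g (SOME k. k \<in> set (take (2 ^ length gs) (ranking bs a)) - U)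
           (c (U \<union> set (take (2 ^ length gs) (ranking bs a)))))))"
      unfolding T_def x_def ks_def xs_def S_def .
  qed
qed

text \<open>The last clause lets leads of honest members over anybody only grow. The inclusion in
  \<open>share s j\<close> and \<open>remaining s\<close> limits what members can gain in the eyes
  of outsiders, whose irrevocable advantages thus persist.\<close>

definition progress :: "nat set \<Rightarrow> 'a state \<Rightarrow> 'a state \<Rightarrow> bool" where
  "progress G s s' \<longleftrightarrow>
     good s' \<and> remaining s' \<subseteq> remaining s \<and>
     (\<forall>j. share s j \<subseteq> share s' j \<and> share s' j \<subseteq> share s j \<union> remaining s) \<and>
     (\<forall>j. j \<notin> G \<longrightarrow> share s' j = share s j) \<and>
     (\<forall>i\<in>H \<inter> G. \<forall>j\<in>{1..n}. V i (share s i) - V i (share s j) \<le> V i (share s' i) - V i (share s' j))"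

lemma progress_refl: "good s \<Longrightarrow> progress G s s"
  by (auto simp: progress_def)

lemma progress_trans: "progress G s s' \<Longrightarrow> progress G s' s'' \<Longrightarrow> progress G s s''"
  unfolding progress_def by (safe; (blast | smt (verit) subset_iff Un_iff order_trans IntI))

lemma allotted_subset:
  assumes "allotted s bs gs s' Y U" "set bs \<subseteq> {..<length (pieces s)}" "i \<in> set gs"
  shows "Y i \<in> M" "Y i \<subseteq> remaining s"
  using assms piece_le_remaining[of _ s] unfolding allotted_def by blast+

lemma allotted_share:
  assumes "allotted s bs gs s' Y U"
  shows "share s' j = (if j \<in> set gs then share s j \<union> Y j else share s j)"
  using assms unfolding allotted_def by blast

lemma allotted_val:
  assumes "good s" "allotted s bs gs s' Y U" "set bs \<subseteq> {..<length (pieces s)}" "j \<in> set gs" "j \<in> {1..n}" "i \<in> H"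
  shows "V i (share s' j) = V i (share s j) + V i (Y j)"
proof -
  have "share s j \<inter> remaining s = {}" using assms(1,5) unfolding good_def by blast
  then have "share s j \<inter> Y j = {}" using allotted_subset(2)[OF assms(2-4)] by blast
  then show ?thesis
    using allotted_share[OF assms(2), of j] assms(4) allotted_subset(1)[OF assms(2-4)] good_share[OF assms(1,5)]
    by (auto intro!: val_Un assms(6))
qed

text \<open>An honest recipient values his own new piece at least as much as any other new piece, so
  no lead of his decreases.\<close>

lemma allotted_progress:
  assumes "good s" "allotted s bs gs s' Y U" "set bs \<subseteq> {..<length (pieces s)}" "set gs \<subseteq> {1..n}"
  shows "progress (set gs) s s'"
  unfolding progress_def
proof (intro conjI ballI allI impI)
  show "good s'" "remaining s' \<subseteq> remaining s" using assms(2) unfolding allotted_def by blast+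
  fix j
  show "share s j \<subseteq> share s' j" "share s' j \<subseteq> share s j \<union> remaining s"
    using allotted_share[OF assms(2), of j] allotted_subset(2)[OF assms(2,3), of j] by auto
  show "share s' j = share s j" if "j \<notin> set gs"
    using allotted_share[OF assms(2), of j] that by simp
next
  fix i j assume i: "i \<in> H \<inter> set gs" and j: "j \<in> {1..n}"
  have vi: "V i (share s' i) = V i (share s i) + V i (Y i)"
    using i assms by (intro allotted_val) auto
  have "V i (share s' j) \<le> V i (share s j) + V i (Y i)"
  proof (cases "j \<in> set gs")
    case True
    moreover have "V i (Y j) \<le> V i (Y i)" using assms(2) True i unfolding allotted_def by blast
    ultimately show ?thesis
      using allotted_val[OF assms(1-3) True j] i by simp
  next
    case False
    then show ?thesis
      using allotted_share[OF assms(2), of j] i val_nonneg[of i "Y i"] allotted_subset(1)[OF assms(2,3), of i] by auto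
  qed
  then show "V i (share s i) - V i (share s j) \<le> V i (share s' i) - V i (share s' j)"
    using vi by simp
qed

text \<open>What \<open>i\<close> receives and what remains are disjoint parts of the old remaining
  cake.\<close>

lemma allotted_remaining:
  assumes "good s" "allotted s bs gs s' Y U" "set bs \<subseteq> {..<length (pieces s)}" "i \<in> set gs" "i \<in> H"
  shows "V i (remaining s') \<le> V i (remaining s) - V i (Y i)"
proof -
  have g': "good s'" "remaining s' \<subseteq> remaining s" using assms(2) unfolding allotted_def by blast+
  have i: "i \<in> {1..n}" using assms(5) honest_le by blast
  have "share s' i \<inter> remaining s' = {}" using g'(1) i unfolding good_def by blast
  then have "Y i \<inter> remaining s' = {}"
    using allotted_share[OF assms(2), of i] assms(4) by auto
  then have "V i (Y i) + V i (remaining s') = V i (Y i \<union> remaining s')"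
    using allotted_subset(1)[OF assms(2-4)] good_remaining[OF g'(1)] val_Un[OF assms(5)] by simp
  also have "\<dots> \<le> V i (remaining s)"
    using allotted_subset[OF assms(2-4)] good_remaining g' assms(1,5) by (intro val_mono) auto
  finally show ?thesis by simp
qed

lemma ok_shrink:
  assumes "good s" "m = length (pieces s)" "0 < m" "distinct gl" "set gl \<subseteq> {1..n}" "set us \<subseteq> set gl"
    and "\<And>s'. progress (set gl) s s'
      \<Longrightarrow> (\<And>i. i \<in> H \<Longrightarrow> V i (remaining s') \<le> (1 - 1 / 2 ^ n) ^ count_list us i * V i (remaining s))
      \<Longrightarrow> ok s' p"
  shows "ok s (shrink n gl us m p)"
  using assms
proof (induction us arbitrary: s m)
  case Nil
  show ?case
    unfolding shrink.simps by (rule Nil.prems(7)) (use Nil.prems(1) progress_refl in auto)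
next
  case (Cons i us)
  define gs where "gs = i # filter (\<lambda>j. j \<noteq> i) gl"
  have gs: "length gs = length gl" "set gs = set gl" "distinct gs"
    using length_move_front Cons.prems(4,6) by (auto simp: gs_def)
  have "card (set gl) \<le> card {1..n}" using Cons.prems(5) by (intro card_mono) auto
  then have len_n: "length gl \<le> n" using distinct_card[OF Cons.prems(4)] by simp
  define bs where "bs = map (\<lambda>t. t * Suc m + m) [0..<2 ^ n]"
  have bs: "distinct bs" "length bs = 2 ^ n"
    by (auto simp: bs_def distinct_map inj_on_def simp del: mult_Suc_right)
  have bs_set: "k mod Suc m = m" "k < Suc m * 2 ^ n" if k: "k \<in> set bs" for k
  proof -
    obtain t where t: "t < 2 ^ n" "k = t * Suc m + m" using k unfolding bs_def by auto
    show "k mod Suc m = m" using t by (metis lessI mod_less mod_mult_self3)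
    have "k < Suc t * Suc m" using t by simp
    also have "\<dots> \<le> 2 ^ n * Suc m" using t by (intro mult_right_mono) auto
    finally show "k < Suc m * 2 ^ n" by (simp add: mult.commute)
  qed
  show ?case
    unfolding shrink.simps gs_def[symmetric] bs_def[symmetric]
  proof (rule ok_pack)
    fix s1 assume s1: "good s1" "share s1 = share s" "remaining s1 = remaining s"
      "length (pieces s1) = m + 1"
      "\<And>g. g < 1 \<Longrightarrow> pieces s1 ! (m + g) = (\<Union>k\<in>{k. k < m \<and> 0 = g}. pieces s ! k)"
    have main1: "pieces s1 ! m = remaining s"
      using s1(5)[of 0] Cons.prems(2) unfolding remaining_nth by auto
    show "ok s1 (halvings (replicate n i) (Suc m) (allot bs gs (\<lambda>_. shrink n gl us (Suc m * 2 ^ n + allot_cuts (length gl)) p)))"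
    proof (rule ok_halvings)
      fix s2 assume s2: "good s2" "share s2 = share s1" "remaining s2 = remaining s1"
        "length (pieces s2) = Suc m * 2 ^ length (replicate n i)"
        "\<And>k j. k < Suc m * 2 ^ length (replicate n i) \<Longrightarrow> j \<in> H \<Longrightarrow> set (replicate n i) \<subseteq> {j} \<Longrightarrow>
            V j (pieces s2 ! k) = V j (pieces s1 ! (k mod Suc m)) / 2 ^ length (replicate n i)"
      have len2: "length (pieces s2) = Suc m * 2 ^ n" using s2(4) by simp
      have bs_len: "set bs \<subseteq> {..<length (pieces s2)}" using bs_set(2) len2 by auto
      have val2: "V i (pieces s2 ! k) = V i (remaining s) / 2 ^ n" if "i \<in> H" "k \<in> set bs" for k
      proof -
        have "set (replicate n i) \<subseteq> {i}" by auto
        then show ?thesis using s2(5)[of k i] bs_set[OF that(2)] that(1) main1 by simp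
      qed
      show "ok s2 (allot bs gs (\<lambda>_. shrink n gl us (Suc m * 2 ^ n + allot_cuts (length gl)) p))"
      proof (rule ok_allot)
        fix s3 Y U assume al: "allotted s2 bs gs s3 Y U"
        have pr: "progress (set gl) s s3"
          using allotted_progress[OF s2(1) al bs_len] gs Cons.prems(5) s1(2,3) s2(2,3)
          unfolding progress_def by simp
        have s3: "good s3" "length (pieces s3) = Suc m * 2 ^ n + allot_cuts (length gl)"
          using al len2 gs(1) unfolding allotted_def by simp_all
        have rem3: "V i (remaining s3) \<le> (1 - 1 / 2 ^ n) * V i (remaining s)" if "i \<in> H"
        proof -
          \<comment> \<open>All \<open>2^n\<close> parts are worth the same to \<open>i\<close>;
            this common value is used as \<open>lo\<close> in the last clause of
            \<open>allotted\<close>.\<close>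
          have "{k \<in> set bs. V i (remaining s) / 2 ^ n \<le> V i (pieces s2 ! k)} = set bs"
            using val2[OF that] by auto
          then have "2 ^ length gs \<le> card {k \<in> set bs. V i (remaining s) / 2 ^ n \<le> V i (pieces s2 ! k)}"
            using bs gs len_n by (simp add: distinct_card)
          then have "V i (remaining s) / 2 ^ n \<le> V i (Y i)"
            using al that unfolding allotted_def gs_def by auto
          moreover have "V i (remaining s3) \<le> V i (remaining s2) - V i (Y i)"
            using allotted_remaining[OF s2(1) al bs_len _ that] by (simp add: gs_def)
          ultimately show ?thesis using s1(3) s2(3) by (simp add: algebra_simps)
        qed
        have rem3': "V j (remaining s3) \<le> (if j = i then 1 - 1 / 2 ^ n else 1) * V j (remaining s)"
          if "j \<in> H" for j
        proof (cases "j = i")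
          case False
          have "remaining s3 \<subseteq> remaining s" using pr unfolding progress_def by blast
          then show ?thesis
            using False that val_mono[of j "remaining s3" "remaining s"] good_remaining s3(1) Cons.prems(1) by simp
        qed (use rem3 that in auto)
        show "ok s3 (shrink n gl us (Suc m * 2 ^ n + allot_cuts (length gl)) p)"
        proof (rule Cons.IH)
          fix s4 assume s4: "progress (set gl) s3 s4"
            "\<And>j. j \<in> H \<Longrightarrow> V j (remaining s4) \<le> (1 - 1 / 2 ^ n) ^ count_list us j * V j (remaining s3)"
          show "ok s4 p"
          proof (rule Cons.prems(7))
            show "progress (set gl) s s4" using pr s4(1) by (rule progress_trans)
            fix j assume j: "j \<in> H"
            have "(1 - 1 / 2 ^ n) ^ count_list us j * V j (remaining s3) \<le>
              (1 - 1 / 2 ^ n) ^ count_list us j * ((if j = i then 1 - 1 / 2 ^ n else 1) * V j (remaining s))"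
              using rem3'[OF j] by (intro mult_left_mono zero_le_power) auto
            then show "V j (remaining s4) \<le> (1 - 1 / 2 ^ n) ^ count_list (i # us) j * V j (remaining s)"
              using s4(2)[OF j] by (auto simp: mult_ac)
          qed
        qed (use Cons.prems s3 in auto)
      qed (use s2(1) bs bs_len gs len_n Cons.prems in auto)
    qed (use s1 Cons.prems in auto)
  qed (use Cons.prems in auto)
qed

subsection \<open>Gaining irrevocable advantages\<close>

text \<open>Crumbs with index congruent to \<open>x\<close> lie inside piece \<open>x\<close>, the
  others lie in pieces disjoint from it, and no cake is lost; so the former partition piece
  \<open>x\<close>.\<close>

lemma val_sum_mod:
  assumes "good s" "good s1" "remaining s1 = remaining s" "i \<in> H" "x < length (pieces s)"
    and sub: "\<And>k. k < length (pieces s1) \<Longrightarrow> pieces s1 ! k \<subseteq> pieces s ! (k mod length (pieces s))"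
  shows "(\<Sum>k<length (pieces s1). of_bool (k mod length (pieces s) = x) * V i (pieces s1 ! k)) = V i (pieces s ! x)"
proof -
  define K where "K = {k. k < length (pieces s1) \<and> k mod length (pieces s) = x}"
  have "pieces s ! x = (\<Union>k\<in>K. pieces s1 ! k)"
  proof (intro equalityI subsetI)
    fix y assume y: "y \<in> pieces s ! x"
    then have "y \<in> remaining s1" using piece_le_remaining assms(3,5) by blast
    then obtain k where k: "k < length (pieces s1)" "y \<in> pieces s1 ! k" unfolding remaining_nth by blast
    then have "y \<in> pieces s ! (k mod length (pieces s))" using sub by blast
    moreover have "k mod length (pieces s) < length (pieces s)"
      using assms(5) by (intro mod_less_divisor) auto
    ultimately have "k mod length (pieces s) = x"
      using good_disjoint[OF assms(1) _ assms(5)] y by blast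
    then show "y \<in> (\<Union>k\<in>K. pieces s1 ! k)" using k by (auto simp: K_def)
  qed (use sub in \<open>auto simp: K_def\<close>)
  then have "V i (pieces s ! x) = (\<Sum>k\<in>K. V i (pieces s1 ! k))"
    by (simp only:) (intro val_UN assms(4); simp add: K_def good_piece[OF assms(2)] good_disjoint[OF assms(2)])
  also have "\<dots> = (\<Sum>k<length (pieces s1). of_bool (k mod length (pieces s) = x) * V i (pieces s1 ! k))"
  proof -
    have "K = {k \<in> {..<length (pieces s1)}. k mod length (pieces s) = x}" by (auto simp: K_def)
    then show ?thesis by (simp only: sum.inter_filter[OF finite_lessThan]) (intro sum.cong, auto)
  qed
  finally show ?thesis by simp
qed

lemma sum_list_view: "good s \<Longrightarrow> i \<in> H \<Longrightarrow> sum_list (snd (view (V i) s)) = V i (remaining s)"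
  by (simp add: view_def val_remaining sum_list_sum_nth atLeast0LessThan)

text \<open>Every bundle is within \<open>R / Z\<close> of its expectation for every honest member
  of \<open>G\<close>, whether low or high. The two allotments prevent envy inside
  \<open>low\<close> and inside \<open>high\<close>; across the two groups, the expectations differ
  by more than all errors together.\<close>

lemma ok_separate:
  assumes s: "good s" "length (pieces s) = LCM_upto n" and G: "G \<subseteq> {1..n}"
    and lh: "low \<union> high = G" "low \<inter> high = {}"
    and r: "0 < r" and n: "0 < n" and pq: "p < LCM_upto n" "q < LCM_upto n"
    and \<tau>: "0 \<le> \<tau>" "\<tau> \<le> 1"
    and low: "\<And>i. i \<in> H \<Longrightarrow> i \<in> low \<Longrightarrow>
      V i (pieces s ! p) - V i (pieces s ! q) \<le> (\<tau> - 1 / (2 * real r * real n)) * V i (remaining s)"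
    and high: "\<And>i. i \<in> H \<Longrightarrow> i \<in> high \<Longrightarrow>
      (\<tau> + 1 / (2 * real r * real n)) * V i (remaining s) \<le> V i (pieces s ! p) - V i (pieces s ! q)"
    and cont: "\<And>s'. progress G s s' \<Longrightarrow>
      (\<And>i j. i \<in> H \<Longrightarrow> i \<in> high \<Longrightarrow> j \<in> low \<Longrightarrow>
        V i (share s i) - V i (share s j) + V i (remaining s') \<le> V i (share s' i) - V i (share s' j))
      \<Longrightarrow> ok s' c"
  shows "ok s (separate n G r \<tau> p q low high c)"
proof -
  define L where "L = LCM_upto n"
  define gl where "gl = sorted_list_of_set G"
  define e where "e = crumb_exp n r"
  define Z where "Z = real (precision n r)"
  define m where "m = crumb_count n r (card G)"
  define N :: nat where "N = 2 ^ n"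
  define K where "K = scale n r (card G)"
  define ll where "ll = sorted_list_of_set low"
  define hl where "hl = sorted_list_of_set high"
  define x where "x = 16 * r * n * 2 ^ n"
  have fin: "finite G" "finite low" "finite high"
    using G lh finite_subset[OF G] by auto
  have gl: "set gl = G" "distinct gl" "length gl = card G" using fin by (auto simp: gl_def)
  have ll: "set ll = low" "distinct ll" "length ll = card low" using fin by (auto simp: ll_def)
  have hl: "set hl = high" "distinct hl" "length hl = card high" using fin by (auto simp: hl_def)
  have L0: "0 < L" using pq by (auto simp: L_def)
  have cardG: "card G \<le> n" using card_mono[OF _ G] by simp
  have "card low \<le> n" "card high \<le> n"
    using card_mono[OF fin(1), of low] card_mono[OF fin(1), of high] lh(1) cardG by auto
  then have pow_N: "2 ^ card low \<le> N" "2 ^ card high \<le> N"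
    by (auto simp: N_def intro: power_increasing)
  have Z0: "0 < Z" using r n by (simp add: Z_def precision_def)
  have Ze: "real (card G) * (2 * Z)\<^sup>2 \<le> 2 ^ e"
  proof -
    have "real (card G) * (2 * Z)\<^sup>2 \<le> real e"
      using cardG by (auto simp: e_def crumb_exp_def Z_def intro!: mult_right_mono)
    also have "\<dots> \<le> 2 ^ e" using less_imp_le[OF of_nat_less_two_power[of e]] by simp
    finally show ?thesis .
  qed
  have m0: "0 < m" "m = L * 2 ^ (card G * e)" using L0 by (auto simp: m_def crumb_count_def L_def e_def)
  have K: "K = 2 * real m * Z" by (simp add: K_def scale_def m_def Z_def)
  \<comment> \<open>Since \<open>Z = 32 * r * n * N\<close>, this is
    \<open>1 / (8 * r * n * N) - 1 / (16 * r * n * N)\<close>: the difference of expectations minus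
    one error in each of the two bundles compared.\<close>
  have margin: "1 / (2 * real r * real n) / (4 * real N) - 2 / Z = 1 / real x" 
    using r n by (simp add: Z_def precision_def x_def N_def field_simps)
  show ?thesis
    unfolding separate_def Let_def gl_def[symmetric] m_def[symmetric] L_def[symmetric] e_def[symmetric]
      ll_def[symmetric] hl_def[symmetric] K_def[symmetric] N_def[symmetric] 
  proof (rule ok_halvings)
    fix s1 assume s1: "good s1" "share s1 = share s" "remaining s1 = remaining s"
      "length (pieces s1) = L * 2 ^ length (concat (map (replicate e) gl))"
      "\<And>k. k < L * 2 ^ length (concat (map (replicate e) gl)) \<Longrightarrow> pieces s1 ! k \<subseteq> pieces s ! (k mod L)"
      "\<And>k i. k < L * 2 ^ length (concat (map (replicate e) gl)) \<Longrightarrow> i \<in> H \<Longrightarrow>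
         V i (pieces s1 ! k) \<le> V i (pieces s ! (k mod L)) / 2 ^ count_list (concat (map (replicate e) gl)) i"
    have len1: "L * 2 ^ length (concat (map (replicate e) gl)) = m" "length (pieces s1) = m"
      using s1(4) m0(2) gl(3) by (auto simp: length_concat_replicate)
    have small: "V i (pieces s1 ! k) \<le> V i (remaining s) / 2 ^ e" if "i \<in> H" "i \<in> G" "k < m" for i k
    proof -
      have k: "k mod L < length (pieces s)" using L0 s(2) by (simp add: L_def)
      have "V i (pieces s1 ! k) \<le> V i (pieces s ! (k mod L)) / 2 ^ e"
        using s1(6)[of k i] that len1 count_list_concat_replicate[OF gl(2)] gl(1) by simp
      also have "\<dots> \<le> V i (remaining s) / 2 ^ e"
        using that k piece_le_remaining good_piece[OF s(1) k] good_remaining[OF s(1)]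
        by (intro divide_right_mono val_mono) auto
      finally show ?thesis .
    qed
    show "ok s1 (ask_all gl (\<lambda>_. report K)
         (\<lambda>a. pack (2 * N + 1) (bundling n G r \<tau> p q a) m
           (allot [m..<m + N] ll
             (\<lambda>_. allot [m + N..<m + 2 * N] hl
               (\<lambda>_. shrink n gl (concat (map (replicate (N * (16 * r * n * N))) hl))
                 (m + (2 * N + 1) + allot_cuts (card low) + allot_cuts (card high)) c)))))"
    proof (rule ok_ask_all)
      fix a assume a: "\<And>i. i \<in> set gl \<Longrightarrow> i \<in> H \<Longrightarrow> a i = report K (view (V i) s1)"
      define \<phi> where "\<phi> = bundling n G r \<tau> p q a"
      define u where "u i k = real ((from_nat (a i) :: nat list) ! k)" for i k
      have \<phi>: "\<phi> = assignment G u (weight n L \<tau> p q) m (2 * N + 1) (K\<^sup>2 / 2 ^ e)"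
        unfolding \<phi>_def bundling_def u_def N_def K_def m_def L_def e_def ..
      have \<phi>_less: "\<phi> k < 2 * N + 1" for k
        unfolding \<phi> using fin(1) \<tau> weight_nonneg weight_sum by (intro assignment) (auto simp: N_def)
      have sum_m: "(\<Sum>k<m. V i (pieces s1 ! k)) = V i (remaining s)" if "i \<in> H" for i
        using val_remaining[OF s1(1) that] s1(3) len1(2) by simp
      have err: "\<bar>(\<Sum>k\<in>{k. k < m \<and> \<phi> k = g}. V i (pieces s1 ! k)) - (\<Sum>k<m. weight n L \<tau> p q k g * V i (pieces s1 ! k))\<bar>
          \<le> V i (remaining s) / Z" if i: "i \<in> H" "i \<in> G" and g: "g < 2 * N + 1" for i g
      proof -
        have "u i k = real (nat \<lfloor>K * V i (pieces s1 ! k) / V i (remaining s)\<rfloor>)" if "k < m" for k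
          using that a[of i] i gl(1) len1(2) sum_list_view[OF s1(1) i(1)] s1(3)
          by (simp add: u_def report_def view_def)
        then show ?thesis
          unfolding \<phi> sum_m[OF i(1), symmetric]
          using fin(1) i(2) \<tau> Z0 Ze K m0(1) g small[OF i] sum_m[OF i(1)]
            val_nonneg[OF i(1) good_piece[OF s1(1)]] len1(2)
            weight_nonneg weight_sum
          by (intro bundle_error) (auto simp: N_def)
      qed
      have sum_x: "(\<Sum>k<m. of_bool (k mod L = y) * V i (pieces s1 ! k)) = V i (pieces s ! y)" if "i \<in> H" "y < L" for i y
        using val_sum_mod[OF s(1) s1(1) s1(3) that(1), of y] that(2) s1(5) s(2) len1 unfolding L_def[symmetric] by simp
      have exp_low: "(\<Sum>k<m. weight n L \<tau> p q k g * V i (pieces s1 ! k)) =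
          (V i (pieces s ! q) + \<tau> * V i (remaining s)) / (4 * real N)" if "i \<in> H" "g < N" for i g
      proof -
        have "(\<Sum>k<m. weight n L \<tau> p q k g * V i (pieces s1 ! k)) =
          (\<Sum>k<m. of_bool (k mod L = q) * V i (pieces s1 ! k) / (4 * real N) + \<tau> * V i (pieces s1 ! k) / (4 * real N))"
          using that by (intro sum.cong) (auto simp: weight_def N_def field_simps)
        also have "\<dots> = (V i (pieces s ! q) + \<tau> * V i (remaining s)) / (4 * real N)"
          using sum_x[OF that(1), of q] sum_m[OF that(1)] pq
          by (simp add: sum.distrib L_def add_divide_distrib flip: sum_divide_distrib sum_distrib_left)
        finally show ?thesis .
      qed
      have exp_high: "(\<Sum>k<m. weight n L \<tau> p q k g * V i (pieces s1 ! k)) =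
          V i (pieces s ! p) / (4 * real N)" if "i \<in> H" "N \<le> g" "g < 2 * N" for i g
      proof -
        have "(\<Sum>k<m. weight n L \<tau> p q k g * V i (pieces s1 ! k)) =
          (\<Sum>k<m. of_bool (k mod L = p) * V i (pieces s1 ! k) / (4 * real N))"
          using that by (intro sum.cong) (auto simp: weight_def N_def field_simps)
        also have "\<dots> = V i (pieces s ! p) / (4 * real N)"
          using sum_x[OF that(1), of p] pq by (simp add: L_def flip: sum_divide_distrib)
        finally show ?thesis .
      qed
      show "ok s1 (pack (2 * N + 1) (bundling n G r \<tau> p q a) m
           (allot [m..<m + N] ll
             (\<lambda>_. allot [m + N..<m + 2 * N] hl
               (\<lambda>_. shrink n gl (concat (map (replicate (N * (16 * r * n * N))) hl))
                 (m + (2 * N + 1) + allot_cuts (card low) + allot_cuts (card high)) c))))"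
        unfolding \<phi>_def[symmetric]
      proof (rule ok_pack)
        fix s2 assume s2: "good s2" "share s2 = share s1" "remaining s2 = remaining s1"
          "length (pieces s2) = m + (2 * N + 1)"
          "\<And>g. g < 2 * N + 1 \<Longrightarrow> pieces s2 ! (m + g) = (\<Union>k\<in>{k. k < m \<and> \<phi> k = g}. pieces s1 ! k)"
        have val2: "V i (pieces s2 ! (m + g)) = (\<Sum>k\<in>{k. k < m \<and> \<phi> k = g}. V i (pieces s1 ! k))"
          if "i \<in> H" "g < 2 * N + 1" for i g
          unfolding s2(5)[OF that(2)] using good_piece[OF s1(1)] good_disjoint[OF s1(1)] len1
          by (intro val_UN that(1)) auto
        define R where "R i = V i (remaining s)" for i
        define \<alpha> where "\<alpha> i = (V i (pieces s ! q) + \<tau> * R i) / (4 * real N)" for i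
        define \<beta> where "\<beta> i = V i (pieces s ! p) / (4 * real N)" for i
        have val_\<alpha>: "\<bar>V i (pieces s2 ! k) - \<alpha> i\<bar> \<le> R i / Z" if "i \<in> H" "i \<in> G" "k \<in> set [m..<m + N]" for i k
        proof -
          have k: "k = m + (k - m)" "k - m < N" using that(3) by auto
          show ?thesis
            using err[OF that(1,2), of "k - m"] val2[OF that(1), of "k - m"] exp_low[OF that(1) k(2)] k
            unfolding \<alpha>_def R_def by simp
        qed
        have val_\<beta>: "\<bar>V i (pieces s2 ! k) - \<beta> i\<bar> \<le> R i / Z" if "i \<in> H" "i \<in> G" "k \<in> set [m + N..<m + 2 * N]" for i k
        proof -
          have k: "k = m + (k - m)" "N \<le> k - m" "k - m < 2 * N" using that(3) by auto
          show ?thesis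
            using err[OF that(1,2), of "k - m"] val2[OF that(1), of "k - m"] exp_high[OF that(1) k(2,3)] k
            unfolding \<beta>_def R_def by simp
        qed
        have bs_low: "set [m..<m + N] \<subseteq> {..<length (pieces s2)}" using s2(4) by auto
        have lowG: "low \<subseteq> {1..n}" "high \<subseteq> {1..n}" using lh(1) G by auto
        show "ok s2 (allot [m..<m + N] ll
             (\<lambda>_. allot [m + N..<m + 2 * N] hl
               (\<lambda>_. shrink n gl (concat (map (replicate (N * (16 * r * n * N))) hl))
                 (m + (2 * N + 1) + allot_cuts (card low) + allot_cuts (card high)) c)))"
        proof (rule ok_allot)
          fix s3 Y U assume al3: "allotted s2 [m..<m + N] ll s3 Y U"
          have s3: "good s3" "length (pieces s3) = m + (2 * N + 1) + allot_cuts (card low)"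
            "\<And>l. l < m + (2 * N + 1) \<Longrightarrow> l \<notin> set [m..<m + N] \<Longrightarrow> pieces s3 ! l = pieces s2 ! l"
            "remaining s3 \<subseteq> remaining s2"
            using al3 s2(4) ll(3) unfolding allotted_def by simp_all
          have bs_high: "set [m + N..<m + 2 * N] \<subseteq> {..<length (pieces s3)}" using s3(2) by auto
          \<comment> \<open>The first allotment touches only bundles of the other type, so the
            estimates still hold.\<close>
          have val_\<beta>3: "\<bar>V i (pieces s3 ! k) - \<beta> i\<bar> \<le> R i / Z" if "i \<in> H" "i \<in> G" "k \<in> set [m + N..<m + 2 * N]" for i k
            using val_\<beta>[OF that] s3(3)[of k] that(3) by auto
          have Yle: "V i (Y j) \<le> \<alpha> i + R i / Z" if "i \<in> H" "i \<in> G" and j: "j \<in> low" for i j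
          proof -
            obtain k where k: "k \<in> set [m..<m + N]" "Y j \<subseteq> pieces s2 ! k" "Y j \<in> M"
              using al3 j ll(1) unfolding allotted_def by blast
            have "V i (Y j) \<le> V i (pieces s2 ! k)"
              using k bs_low \<open>i \<in> H\<close> good_piece[OF s2(1)] by (intro val_mono) auto
            then show ?thesis using val_\<alpha>[OF that(1,2) k(1)] by linarith
          qed
          have Yge: "\<alpha> i - R i / Z \<le> V i (Y i)" if i: "i \<in> H" "i \<in> low" for i
          proof -
            have "i \<in> G" using i(2) lh(1) by blast
            then have "\<alpha> i - R i / Z \<le> V i (pieces s2 ! k)" if "k \<in> set [m..<m + N]" for k
              using val_\<alpha>[OF \<open>i \<in> H\<close> _ that] by (simp add: abs_le_iff)
            then have "{k \<in> set [m..<m + N]. \<alpha> i - R i / Z \<le> V i (pieces s2 ! k)} = set [m..<m + N]" by blast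
            then have "2 ^ length ll \<le> card {k \<in> set [m..<m + N]. \<alpha> i - R i / Z \<le> V i (pieces s2 ! k)}"
              using pow_N(1) ll(3) by simp
            moreover have "i \<in> set ll \<inter> H" using i ll(1) by blast
            ultimately show ?thesis using al3 unfolding allotted_def by blast
          qed
          show "ok s3 (allot [m + N..<m + 2 * N] hl
               (\<lambda>_. shrink n gl (concat (map (replicate (N * (16 * r * n * N))) hl))
                 (m + (2 * N + 1) + allot_cuts (card low) + allot_cuts (card high)) c))"
          proof (rule ok_allot)
            fix s4 Y2 U2 assume al4: "allotted s3 [m + N..<m + 2 * N] hl s4 Y2 U2"
            have s4: "good s4" "length (pieces s4) = m + (2 * N + 1) + allot_cuts (card low) + allot_cuts (card high)"
              using al4 s3(2) hl(3) unfolding allotted_def by simp_all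
            have Y2le: "V i (Y2 j) \<le> \<beta> i + R i / Z" if "i \<in> H" "i \<in> G" and j: "j \<in> high" for i j
            proof -
              obtain k where k: "k \<in> set [m + N..<m + 2 * N]" "Y2 j \<subseteq> pieces s3 ! k" "Y2 j \<in> M"
                using al4 j hl(1) unfolding allotted_def by blast
              have "V i (Y2 j) \<le> V i (pieces s3 ! k)"
                using k bs_high \<open>i \<in> H\<close> good_piece[OF s3(1)] by (intro val_mono) auto
              then show ?thesis using val_\<beta>3[OF that(1,2) k(1)] by linarith
            qed
            have Y2ge: "\<beta> i - R i / Z \<le> V i (Y2 i)" if i: "i \<in> H" "i \<in> high" for i
            proof -
              have "i \<in> G" using i(2) lh(1) by blast
              then have "\<beta> i - R i / Z \<le> V i (pieces s3 ! k)" if "k \<in> set [m + N..<m + 2 * N]" for k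
                using val_\<beta>3[OF \<open>i \<in> H\<close> _ that] by (simp add: abs_le_iff)
              then have "{k \<in> set [m + N..<m + 2 * N]. \<beta> i - R i / Z \<le> V i (pieces s3 ! k)} = set [m + N..<m + 2 * N]"
                by blast
              then have "2 ^ length hl \<le> card {k \<in> set [m + N..<m + 2 * N]. \<beta> i - R i / Z \<le> V i (pieces s3 ! k)}"
                using pow_N(2) hl(3) by simp
              moreover have "i \<in> set hl \<inter> H" using i hl(1) by blast
              ultimately show ?thesis using al4 unfolding allotted_def by blast
            qed
            have R0: "0 \<le> R i" if "i \<in> H" for i
              using val_nonneg[OF that good_remaining[OF s(1)]] by (simp add: R_def)
            have gap: "R i / real x = R i / (2 * real r * real n) / (4 * real N) - 2 * R i / Z" for i
              using arg_cong[OF margin, of "\<lambda>t. R i * t"] by (simp add: right_diff_distrib)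
            have low_gap: "\<beta> i + R i / Z \<le> \<alpha> i - R i / Z" if i: "i \<in> H" "i \<in> low" for i
            proof -
              have "R i / (2 * real r * real n) \<le> V i (pieces s ! q) + \<tau> * R i - V i (pieces s ! p)"
                using low[OF i] unfolding R_def[symmetric] by (simp add: algebra_simps)
              then have "R i / (2 * real r * real n) / (4 * real N) \<le>
                (V i (pieces s ! q) + \<tau> * R i - V i (pieces s ! p)) / (4 * real N)"
                by (intro divide_right_mono) auto
              also have "\<dots> = \<alpha> i - \<beta> i" unfolding \<alpha>_def \<beta>_def by (simp add: diff_divide_distrib)
              finally show ?thesis using gap[of i] R0[OF i(1)] divide_nonneg_nonneg[of "R i" "real x"] by simp
            qed
            have high_gap: "\<alpha> i + R i / Z + R i / real x \<le> \<beta> i - R i / Z" if i: "i \<in> H" "i \<in> high" for i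
            proof -
              have "R i / (2 * real r * real n) \<le> V i (pieces s ! p) - (V i (pieces s ! q) + \<tau> * R i)"
                using high[OF i] unfolding R_def[symmetric] by (simp add: algebra_simps)
              then have "R i / (2 * real r * real n) / (4 * real N) \<le>
                (V i (pieces s ! p) - (V i (pieces s ! q) + \<tau> * R i)) / (4 * real N)"
                by (intro divide_right_mono) auto
              also have "\<dots> = \<beta> i - \<alpha> i" unfolding \<alpha>_def \<beta>_def by (simp add: diff_divide_distrib)
              finally show ?thesis using gap[of i] by simp
            qed
            have pr3: "progress low s2 s3"
              using allotted_progress[OF s2(1) al3 bs_low] ll(1) lowG by simp
            have pr4: "progress high s3 s4"
              using allotted_progress[OF s3(1) al4 bs_high] hl(1) lowG by simp
            have sh3: "share s3 j = share s j" if "j \<notin> low" for j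
              using allotted_share[OF al3, of j] ll(1) that s2(2) s1(2) by simp
            have sh4: "share s4 j = share s3 j" if "j \<notin> high" for j
              using allotted_share[OF al4, of j] hl(1) that by simp
            have v3: "V i (share s3 j) = V i (share s j) + V i (Y j)" if "i \<in> H" "j \<in> low" for i j
              using allotted_val[OF s2(1) al3 bs_low _ _ that(1), of j] that(2) ll(1) lowG(1) s2(2) s1(2) by auto
            have v4: "V i (share s4 j) = V i (share s3 j) + V i (Y2 j)" if "i \<in> H" "j \<in> high" for i j
              using allotted_val[OF s3(1) al4 bs_high _ _ that(1), of j] that(2) hl(1) lowG(2) by auto
            \<comment> \<open>The surplus \<open>R i / real x\<close> in \<open>high_gap\<close>
              becomes the lead that the remaining cake must not exceed later.\<close>
            have cross: "V i (share s i) - V i (share s j) + R i / real x \<le> V i (share s4 i) - V i (share s4 j)"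
              if i: "i \<in> H" "i \<in> high" and j: "j \<in> low" for i j
            proof -
              have not: "i \<notin> low" "j \<notin> high" "i \<in> G" using i j lh by auto
              show ?thesis
                using v4[OF i] sh3[OF not(1)] sh4[OF not(2)] v3[OF i(1) j] Yle[OF i(1) not(3) j]
                  Y2ge[OF i] high_gap[OF i] by simp
            qed
            have pr: "progress G s s4"
              unfolding progress_def
            proof (intro conjI ballI allI impI)
              show "good s4" by (rule s4(1))
              show "remaining s4 \<subseteq> remaining s"
                using pr4 s3(4) s2(3) s1(3) unfolding progress_def by blast
              show "share s j \<subseteq> share s4 j" for j
                using pr3 pr4 s2(2) s1(2) unfolding progress_def by (metis order_trans)
              show "share s4 j \<subseteq> share s j \<union> remaining s" for j
                using pr3 pr4 s2(2,3) s1(2,3) unfolding progress_def by (smt (verit) Un_iff subset_iff)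
              show "share s4 j = share s j" if "j \<notin> G" for j
                using sh3[of j] sh4[of j] that lh(1) by auto
            next
              fix i j assume i: "i \<in> H \<inter> G" and j: "j \<in> {1..n}"
              show "V i (share s i) - V i (share s j) \<le> V i (share s4 i) - V i (share s4 j)"
              proof (cases "i \<in> low")
                case True
                then have nh: "i \<notin> high" using lh(2) by blast
                show ?thesis
                proof (cases "j \<in> high")
                  case jh: True
                  then have "j \<notin> low" using lh(2) by blast
                  then show ?thesis
                    using v3[of i i] v4[of i j] sh4[OF nh] sh3[of j] Yge[of i] Y2le[of i j] low_gap[of i] i True jh by simp
                next
                  case False
                  have "V i (share s2 i) - V i (share s2 j) \<le> V i (share s3 i) - V i (share s3 j)"
                    using pr3 i j True unfolding progress_def by blast
                  then show ?thesis using sh4[OF nh] sh4[OF False] s2(2) s1(2) by simp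
                qed
              next
                case False
                then have ih: "i \<in> high" using i lh(1) by blast
                show ?thesis
                proof (cases "j \<in> low")
                  case True
                  have "0 \<le> R i / real x" using R0 i by simp
                  then show ?thesis using cross[of i j] i ih True by simp
                next
                  case jl: False
                  have "V i (share s3 i) - V i (share s3 j) \<le> V i (share s4 i) - V i (share s4 j)"
                    using pr4 i j ih unfolding progress_def by blast
                  then show ?thesis using sh3[OF False] sh3[OF jl] by simp
                qed
              qed
            qed
            show "ok s4 (shrink n gl (concat (map (replicate (N * (16 * r * n * N))) hl))
                 (m + (2 * N + 1) + allot_cuts (card low) + allot_cuts (card high)) c)"
            proof (rule ok_shrink)
              show "set (concat (map (replicate (N * (16 * r * n * N))) hl)) \<subseteq> set gl"
                using set_concat_replicate[of "N * (16 * r * n * N)" hl] hl(1) gl(1) lh(1) by blast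
              fix s5 assume s5: "progress (set gl) s4 s5"
                "\<And>i. i \<in> H \<Longrightarrow> V i (remaining s5) \<le>
                  (1 - 1 / 2 ^ n) ^ count_list (concat (map (replicate (N * (16 * r * n * N))) hl)) i * V i (remaining s4)"
              show "ok s5 c"
              proof (rule cont)
                show "progress G s s5" using progress_trans[OF pr] s5(1) gl(1) by simp
                fix i j assume i: "i \<in> H" "i \<in> high" and j: "j \<in> low"
                have iG: "i \<in> G" "j \<in> {1..n}" using i j lh(1) lowG by auto
                have "V i (remaining s5) \<le> (1 - 1 / 2 ^ n) ^ (2 ^ n * x) * V i (remaining s4)"
                  using s5(2)[OF i(1)] i(2) count_list_concat_replicate[OF hl(2)] hl(1)
                  unfolding N_def x_def by simp
                also have "\<dots> \<le> (1 / real x) * R i"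
                proof (rule mult_mono)
                  have "0 < x" using r n by (simp add: x_def)
                  then show "(1 - 1 / 2 ^ n :: real) ^ (2 ^ n * x) \<le> 1 / real x" by (rule shrink_factor)
                  have "remaining s4 \<subseteq> remaining s" using pr unfolding progress_def by blast
                  then show "V i (remaining s4) \<le> R i"
                    unfolding R_def using good_remaining s4(1) s(1) i(1) by (intro val_mono) auto
                  show "0 \<le> V i (remaining s4)" using val_nonneg[OF i(1) good_remaining[OF s4(1)]] .
                qed simp
                finally have "V i (remaining s5) \<le> R i / real x" by simp
                moreover have "V i (share s4 i) - V i (share s4 j) \<le> V i (share s5 i) - V i (share s5 j)"
                  using s5(1) i(1) iG gl(1) unfolding progress_def by blast
                ultimately show "V i (share s i) - V i (share s j) + V i (remaining s5) \<le> V i (share s5 i) - V i (share s5 j)"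
                  using cross[OF i j] by simp
              qed
            qed (use s4 gl G in auto)
          qed (use s3(1) bs_high pow_N hl lowG in auto)
        qed (use s2(1) bs_low pow_N ll lowG in auto)
      qed (use s1(1) len1 m0 \<phi>_less in auto)
    qed
  qed (use s L0 in \<open>auto simp: L_def\<close>)
qed

section \<open>The invariant of the whole protocol and its preservation\<close>

definition safe :: "nat set \<Rightarrow> 'a state \<Rightarrow> bool" where
  "safe G s \<longleftrightarrow> good s \<and>
     (\<forall>i\<in>H. (\<forall>j\<in>{1..n}. V i (share s j) \<le> V i (share s i)) \<and>
       (i \<notin> G \<longrightarrow> (\<forall>j\<in>G. V i (share s j) + V i (remaining s) \<le> V i (share s i))))"

lemma val_share_remaining:
  assumes "good s" "i \<in> H" "j \<in> {1..n}"
  shows "V i (share s j \<union> remaining s) = V i (share s j) + V i (remaining s)"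
  using assms good_share good_remaining unfolding good_def by (intro val_Un) auto

text \<open>Members of \<open>G\<close> keep their leads. Outsiders compare themselves with members
  through the irrevocable advantage and with other outsiders through frozen shares. Players leaving
  \<open>G\<close> acquire the advantage by \<open>adv\<close>.\<close>

lemma safe_progress:
  assumes "safe G s" "progress G s s'" "low \<subseteq> G" "G \<subseteq> {1..n}"
    and adv: "\<And>i j. i \<in> H \<Longrightarrow> i \<in> G - low \<Longrightarrow> j \<in> low \<Longrightarrow>
        V i (share s i) - V i (share s j) + V i (remaining s') \<le> V i (share s' i) - V i (share s' j)"
  shows "safe low s'"
proof -
  have g: "good s" "good s'" using assms(1,2) unfolding safe_def progress_def by auto
  \<comment> \<open>The most that \<open>j\<close> could still end up with, his share plus all
    remaining cake, never grows.\<close>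
  have out: "V i (share s' j) + V i (remaining s') \<le> V i (share s j) + V i (remaining s)"
    if "i \<in> H" "j \<in> {1..n}" for i j
  proof -
    have "share s' j \<union> remaining s' \<subseteq> share s j \<union> remaining s"
      using assms(2) unfolding progress_def by blast
    then have "V i (share s' j \<union> remaining s') \<le> V i (share s j \<union> remaining s)"
      using that g good_share good_remaining by (intro val_mono) auto
    then show ?thesis using val_share_remaining g that by simp
  qed
  have same: "share s' i = share s i" if "i \<notin> G" for i
    using assms(2) that unfolding progress_def by blast
  have old: "V i (share s j) \<le> V i (share s i)" if "i \<in> H" "j \<in> {1..n}" for i j
    using assms(1) that unfolding safe_def by blast
  have old': "V i (share s j) + V i (remaining s) \<le> V i (share s i)" if "i \<in> H" "i \<notin> G" "j \<in> G" for i j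
    using assms(1) that unfolding safe_def by blast
  have nonneg: "0 \<le> V i (remaining s')" if "i \<in> H" for i
    using val_nonneg[OF that good_remaining[OF g(2)]] .
  show ?thesis
    unfolding safe_def
  proof (intro conjI ballI impI)
    show "good s'" by (rule g)
    fix i j assume i: "i \<in> H" and j: "j \<in> {1..n}"
    show "V i (share s' j) \<le> V i (share s' i)"
    proof (cases "i \<in> G")
      case True
      then have "V i (share s i) - V i (share s j) \<le> V i (share s' i) - V i (share s' j)"
        using assms(2) i j unfolding progress_def by blast
      then show ?thesis using old[OF i j] by simp
    next
      case False
      then show ?thesis
        using same[of i] same[of j] old[OF i j] old'[OF i False, of j] out[OF i j] nonneg[OF i]
        by (cases "j \<in> G") auto
    qed
  next
    fix i j assume i: "i \<in> H" "i \<notin> low" and j: "j \<in> low"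
    then have j': "j \<in> G" "j \<in> {1..n}" using assms(3,4) by auto
    show "V i (share s' j) + V i (remaining s') \<le> V i (share s' i)"
    proof (cases "i \<in> G")
      case True
      then show ?thesis using adv[of i j] i j old[OF i(1) j'(2)] by simp
    next
      case False
      then show ?thesis using same[OF False] old'[OF i(1) False j'(1)] out[OF i(1) j'(2)] by simp
    qed
  qed
qed

text \<open>As \<open>card G\<close> divides \<open>L\<close>, each member receives equally many
  pieces, which honest members value equally. Afterwards no cake remains, so the invariant gives a
  fair division.\<close>

lemma ok_deal:
  assumes safe: "safe G s" and len: "length (pieces s) = LCM_upto n" and G: "G \<subseteq> {1..n}" "G \<noteq> {}"
    and eq: "\<And>i. i \<in> H \<Longrightarrow> i \<in> G \<Longrightarrow> considers_equal (V i) (pieces s)"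
  shows "ok s (deal n G)"
  unfolding deal_def
proof (rule ok_gives)
  define gl where "gl = sorted_list_of_set G"
  have fin: "finite G" using G(1) finite_subset by blast
  have gl: "set gl = G" "distinct gl" "length gl = card G" using fin by (auto simp: gl_def)
  have c0: "0 < card G" using fin G(2) by (simp add: card_gt_0_iff)
  \<comment> \<open>The least common multiple starts at 2, so size 1 is treated apart.\<close>
  have cdvd: "card G dvd LCM_upto n"
  proof (cases "card G = 1")
    case False
    have "card G \<le> n" using card_mono[OF _ G(1)] by simp
    then show ?thesis using False c0 by (intro dvd_Lcm) auto
  qed simp
  have nth_gl: "gl ! (k mod card G) \<in> G" for k using gl c0 nth_mem[of "k mod card G" gl] by simp
  then show "(\<lambda>k. sorted_list_of_set G ! (k mod card G)) ` set [0..<LCM_upto n] \<subseteq> {1..n}"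
    using G(1) by (auto simp: gl_def)
  have g: "good s" using safe unfolding safe_def by blast
  then show "good s" .
  fix s' assume s': "good s'"
    "\<And>i. share s' i = share s i \<union> (\<Union>k\<in>{k \<in> set [0..<LCM_upto n]. sorted_list_of_set G ! (k mod card G) = i}. pieces s ! k)"
    "length (pieces s') = length (pieces s)"
    "\<And>l. l < length (pieces s) \<Longrightarrow> pieces s' ! l = (if l \<in> set [0..<LCM_upto n] then {} else pieces s ! l)"
  define K where "K j = {k \<in> set [0..<LCM_upto n]. gl ! (k mod card G) = j}" for j
  have K: "K j \<subseteq> {..<length (pieces s)}" for j using len by (auto simp: K_def)
  have sh: "share s' j = share s j \<union> (\<Union>k\<in>K j. pieces s ! k)" for j
    using s'(2) unfolding K_def gl_def .
  have K_sub: "(\<Union>k\<in>K j. pieces s ! k) \<subseteq> remaining s" for j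
    using K[of j] piece_le_remaining by blast
  have K_M: "(\<Union>k\<in>K j. pieces s ! k) \<in> M" for j
    using K[of j] good_piece[OF g] finite_subset[OF K] by (intro finite_UN) auto
  have K_out: "K j = {}" if "j \<notin> G" for j using nth_gl that by (auto simp: K_def)
  have K_card: "card (K j) = LCM_upto n div card G" if j: "j \<in> G" for j
  proof -
    obtain y where y: "y < card G" "gl ! y = j" using j gl by (metis in_set_conv_nth)
    have "K j = {k. k < LCM_upto n \<and> k mod card G = y}"
      using y gl c0 by (auto simp: K_def nth_eq_iff_index_eq)
    then show ?thesis using card_mod_class[OF c0 cdvd y(1)] by simp
  qed
  have rem: "remaining s' = {}" unfolding remaining_nth using s'(3,4) len by auto
  have prog: "progress G s s'"
    unfolding progress_def
  proof (intro conjI ballI allI impI)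
    show "good s'" by (rule s')
    show "remaining s' \<subseteq> remaining s" using rem by simp
    show "share s j \<subseteq> share s' j" "share s' j \<subseteq> share s j \<union> remaining s" for j
      using sh[of j] K_sub[of j] by auto
    show "share s' j = share s j" if "j \<notin> G" for j using sh[of j] K_out[OF that] by simp
  next
    fix i j assume i: "i \<in> H \<inter> G" and j: "j \<in> {1..n}"
    have i': "i \<in> H" "i \<in> {1..n}" using i honest_le by auto
    have pos: "0 < LCM_upto n" by (rule LCM_upto_pos)
    define t where "t = V i (pieces s ! 0)"
    have t: "V i (pieces s ! k) = t" if "k < length (pieces s)" for k
      using eq[of i] i that len pos unfolding considers_equal_def t_def by simp
    have t0: "0 \<le> t" unfolding t_def using val_nonneg good_piece[OF g] i' len pos by simp
    have val: "V i (share s' l) = V i (share s l) + real (card (K l)) * t" if l: "l \<in> {1..n}" for l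
    proof -
      have "V i (share s' l) = V i (share s l) + V i (\<Union>k\<in>K l. pieces s ! k)"
        unfolding sh using g K_sub[of l] K_M[of l] good_share[OF g l] l i' unfolding good_def
        by (intro val_Un) blast+
      also have "V i (\<Union>k\<in>K l. pieces s ! k) = (\<Sum>k\<in>K l. V i (pieces s ! k))"
        using K[of l] by (intro val_UN i' good_piece[OF g] good_disjoint[OF g] finite_subset[OF K]) auto
      also have "\<dots> = (\<Sum>k\<in>K l. t)" using K[of l] t by (intro sum.cong) auto
      finally show ?thesis by simp
    qed
    have "card (K j) \<le> card (K i)" using K_card[of i] K_card[of j] K_out[of j] i by (cases "j \<in> G") auto
    then have "real (card (K j)) * t \<le> real (card (K i)) * t" using t0 by (intro mult_right_mono) auto
    then show "V i (share s i) - V i (share s j) \<le> V i (share s' i) - V i (share s' j)"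
      using val[OF i'(2)] val[OF j] by simp
  qed
  \<comment> \<open>The group stays the same here, so the condition on players leaving it is
    vacuous.\<close>
  have safe': "safe G s'" using prog G(1) by (intro safe_progress[OF safe]) auto
  have "division C M n (share s')"
    using s'(1) rem unfolding good_def division_def by simp
  moreover have "envies_nobody n (V i) (share s') i" if "i \<in> H" for i
    using safe' that unfolding safe_def envies_nobody_def by blast
  ultimately show "ok s' Done" by (intro ok_Done) (simp add: fair_def)
qed (use len in auto)

text \<open>The floor is below \<open>j\<close>, hence so is the scaled difference, negative values
  included. If the remaining cake is worthless, the quotient says nothing and both pieces are
  worthless too.\<close>

lemma cell_low:
  assumes "i \<in> H" "good s" "p < length (pieces s)" "q < length (pieces s)" "0 < r" "0 < n"
    and "cell n p q r (view (V i) s) < j"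
  shows "V i (pieces s ! p) - V i (pieces s ! q) \<le> real j / (real r * real n) * V i (remaining s)"
proof (cases "V i (remaining s) = 0")
  case True
  have "V i (pieces s ! p) \<le> V i (remaining s)"
    using assms(1-3) piece_le_remaining good_piece good_remaining by (intro val_mono) auto
  moreover have "0 \<le> V i (pieces s ! q)" using assms(1,2,4) val_nonneg good_piece by blast
  ultimately show ?thesis using True by simp
next
  case False
  then have R: "0 < V i (remaining s)"
    using val_nonneg[OF assms(1) good_remaining[OF assms(2)]] by simp
  have "(V i (pieces s ! p) - V i (pieces s ! q)) * (real r * real n) / V i (remaining s) < real j"
    using assms(7) unfolding cell_def sum_list_view[OF assms(2,1)] view_nth[OF assms(3)] view_nth[OF assms(4)]
    by linarith
  then show ?thesis using R assms(5,6) by (simp add: field_simps)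
qed

text \<open>A positive cell excludes a worthless remaining cake, as division by 0 would have
  produced cell 0.\<close>

lemma cell_high:
  assumes "i \<in> H" "good s" "p < length (pieces s)" "q < length (pieces s)" "0 < r" "0 < n"
    and "j < cell n p q r (view (V i) s)"
  shows "real (Suc j) / (real r * real n) * V i (remaining s) \<le> V i (pieces s ! p) - V i (pieces s ! q)"
proof -
  have *: "real (Suc j) \<le> (V i (pieces s ! p) - V i (pieces s ! q)) * (real r * real n) / V i (remaining s)"
    using assms(7) unfolding cell_def sum_list_view[OF assms(2,1)] view_nth[OF assms(3)] view_nth[OF assms(4)]
    by linarith
  have "V i (remaining s) \<noteq> 0" using * by auto
  then have R: "0 < V i (remaining s)"
    using val_nonneg[OF assms(1) good_remaining[OF assms(2)]] by simp
  then show ?thesis using * assms(5,6) by (simp add: field_simps)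
qed

text \<open>The hypotheses of \<open>ok_separate\<close> follow from the announced cells for all
  honest members except 1 and \<open>d\<close>, whose sides of the gap follow from their statements
  in the round.\<close>

lemma ok_gain:
  assumes s: "safe G s" "length (pieces s) = LCM_upto n"
    and G: "G \<subseteq> {1..n}" "1 \<in> G" "d \<in> G" "d \<noteq> 1"
    and one: "1 \<in> H \<Longrightarrow> considers_equal (V 1) (pieces s)"
    and d: "d \<in> H \<Longrightarrow> \<not> considers_equal (V d) (pieces s)"
    and cont: "\<And>low s'. safe low s' \<Longrightarrow> low \<subset> G \<Longrightarrow> 1 \<in> low \<Longrightarrow> ok s' (c low)"
  shows "ok s (gain n G d c)"
  unfolding gain_def
proof (intro ok_Ask ok_ask_all)
  define L where "L = LCM_upto n"
  have L: "length (pieces s) = L" "0 < L" using s(2) LCM_upto_pos by (auto simp: L_def)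
  have g: "good s" using s(1) unfolding safe_def by blast
  have n0: "0 < n" using G by auto
  fix p' q' r' \<kappa>
  assume ans: "d \<in> H \<Longrightarrow> p' = better (view (V d) s)"
    "d \<in> H \<Longrightarrow> q' = worse (p' mod LCM_upto n) (view (V d) s)"
    "d \<in> H \<Longrightarrow> r' = margin (p' mod LCM_upto n) (q' mod LCM_upto n) (view (V d) s)"
    and \<kappa>: "\<And>i. i \<in> set (sorted_list_of_set G) \<Longrightarrow> i \<in> H \<Longrightarrow>
      \<kappa> i = cell n (p' mod LCM_upto n) (q' mod LCM_upto n) (Suc r') (view (V i) s)"
  define p where "p = p' mod L"
  define q where "q = q' mod L"
  define \<kappa>' where "\<kappa>' = \<kappa>(1 := 0, d := n)"
  define j where "j = free_cell n G \<kappa>'"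
  define r where "r = Suc r'"
  have pq: "p < length (pieces s)" "q < length (pieces s)" using L by (auto simp: p_def q_def)
  have j: "0 < j" "j < n" "j \<notin> \<kappa>' ` G"
    unfolding j_def by (rule free_cell[OF G]; use G(4) in \<open>simp add: \<kappa>'_def\<close>)+
  define low where "low = {i \<in> G. \<kappa>' i < j}"
  define high where "high = {i \<in> G. j < \<kappa>' i}"
  have lh: "low \<union> high = G" "low \<inter> high = {}" "1 \<in> low" "d \<in> high"
    using j G by (auto simp: low_def high_def \<kappa>'_def)
  have \<kappa>i: "\<kappa>' i = cell n p q r (view (V i) s)" if "i \<in> H" "i \<in> G" "i \<noteq> 1" "i \<noteq> d" for i
    using \<kappa>[of i] that finite_subset[OF G(1)] by (simp add: \<kappa>'_def p_def q_def r_def L_def)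
  \<comment> \<open>An honest \<open>d\<close> sees two unequal pieces, so the choices in
    \<open>better\<close> and \<open>worse\<close> are genuine, and \<open>margin\<close> exists by
    the Archimedean property.\<close>
  have d_gap: "V d (remaining s) \<le> (V d (pieces s ! p) - V d (pieces s ! q)) * real r" if dH: "d \<in> H"
  proof -
    define w where "w = snd (view (V d) s)"
    have w: "length w = L" "\<And>k. k < L \<Longrightarrow> w ! k = V d (pieces s ! k)"
      using L by (auto simp: w_def view_def)
    obtain a b where "a < L" "b < L" "V d (pieces s ! a) \<noteq> V d (pieces s ! b)"
      using d[OF dH] L(1) unfolding considers_equal_def by (metis in_set_conv_nth)
    then have "\<exists>p. p < length w \<and> (\<exists>q<length w. w ! q < w ! p)"
      using w by (metis linorder_neqE_linordered_idom)
    then have p: "p' < length w \<and> (\<exists>q<length w. w ! q < w ! p')"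
      unfolding ans(1)[OF dH] better_def w_def[symmetric] by (rule someI_ex)
    then have pp: "p = p'" using w(1) by (simp add: p_def)
    have "\<exists>q. q < length w \<and> w ! q < w ! p" using p pp by blast
    then have q: "q' < length w \<and> w ! q' < w ! p"
      unfolding ans(2)[OF dH] worse_def w_def[symmetric] L_def[symmetric] p_def[symmetric] by (rule someI_ex)
    then have qq: "q = q'" using w(1) by (simp add: q_def)
    have pos: "0 < w ! p - w ! q" using q qq by simp
    obtain k where "sum_list w / (w ! p - w ! q) < real k" using reals_Archimedean2 by blast
    then have "sum_list w \<le> (w ! p - w ! q) * real (Suc k)"
      using pos by (simp add: field_simps)
    then have "\<exists>r. sum_list w \<le> (w ! p - w ! q) * real (Suc r)" by blast
    then have "sum_list w \<le> (w ! p - w ! q) * real (Suc r')"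
      unfolding ans(3)[OF dH] margin_def w_def[symmetric] L_def[symmetric] p_def[symmetric] q_def[symmetric]
      by (rule someI_ex)
    then show ?thesis
      using sum_list_view[OF g dH] pq L w(2) by (simp add: w_def[symmetric] r_def)
  qed
  define \<tau> where "\<tau> = (real j + 1 / 2) / (real r * real n)"
  have rn0: "0 < real r" "0 < real n" using n0 by (auto simp: r_def)
  then have rn: "0 < real r * real n" by simp
  have \<tau>_low: "\<tau> - 1 / (2 * real r * real n) = real j / (real r * real n)"
    using rn0 by (simp add: \<tau>_def field_simps)
  have \<tau>_high: "\<tau> + 1 / (2 * real r * real n) = real (Suc j) / (real r * real n)"
    using rn0 by (simp add: \<tau>_def field_simps)
  have "ok s (separate n G r \<tau> p q low high (c low))"
  proof (rule ok_separate)
    show "0 \<le> \<tau>" using rn by (simp add: \<tau>_def)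
    show "\<tau> \<le> 1"
    proof -
      have "real j + 1 / 2 \<le> real n" using j(2) by linarith
      also have "\<dots> \<le> real r * real n" using mult_right_mono[of 1 "real r" "real n"] by (simp add: r_def)
      finally show ?thesis using rn by (simp add: \<tau>_def)
    qed
    fix i assume i: "i \<in> H" "i \<in> low"
    have "V i (pieces s ! p) - V i (pieces s ! q) \<le> real j / (real r * real n) * V i (remaining s)"
    proof (cases "i = 1")
      case True
      \<comment> \<open>An honest player 1 has just cut equal pieces, so her true difference is
        0.\<close>
      have "V i (pieces s ! p) = V i (pieces s ! q)"
        using one i True pq unfolding considers_equal_def by simp
      then show ?thesis using rn val_nonneg[OF i(1) good_remaining[OF g]] by simp
    next
      case False
      moreover have "i \<noteq> d" "i \<in> G" using i lh by auto
      ultimately have "cell n p q r (view (V i) s) < j" using \<kappa>i[OF i(1)] i(2) by (simp add: low_def)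
      then show ?thesis by (intro cell_low i g pq n0) (auto simp: r_def)
    qed
    then show "V i (pieces s ! p) - V i (pieces s ! q) \<le> (\<tau> - 1 / (2 * real r * real n)) * V i (remaining s)"
      unfolding \<tau>_low .
  next
    fix i assume i: "i \<in> H" "i \<in> high"
    have "real (Suc j) / (real r * real n) * V i (remaining s) \<le> V i (pieces s ! p) - V i (pieces s ! q)"
    proof (cases "i = d")
      case True
      \<comment> \<open>By his margin \<open>d\<close> is at \<open>1 / r = n / (r * n)\<close> or
        beyond, and \<open>Suc j \<le> n\<close>.\<close>
      have "real (Suc j) / (real r * real n) * V d (remaining s) \<le> 1 / real r * V d (remaining s)"
      proof (rule mult_right_mono)
        have "real (Suc j) / (real r * real n) \<le> real n / (real r * real n)"
          using j(2) rn by (intro divide_right_mono) auto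
        then show "real (Suc j) / (real r * real n) \<le> 1 / real r" using rn0 by simp
        show "0 \<le> V d (remaining s)" using val_nonneg good_remaining[OF g] i True by blast
      qed
      also have "\<dots> \<le> V d (pieces s ! p) - V d (pieces s ! q)"
        using d_gap i True by (simp add: field_simps r_def)
      finally show ?thesis using True by simp
    next
      case False
      moreover have "i \<noteq> 1" "i \<in> G" using i lh by auto
      ultimately have "j < cell n p q r (view (V i) s)" using \<kappa>i[OF i(1)] i(2) by (simp add: high_def)
      then show ?thesis by (intro cell_high i g pq n0) (auto simp: r_def)
    qed
    then show "(\<tau> + 1 / (2 * real r * real n)) * V i (remaining s) \<le> V i (pieces s ! p) - V i (pieces s ! q)"
      unfolding \<tau>_high .
  next
    fix s' assume s': "progress G s s'"
      "\<And>i j. i \<in> H \<Longrightarrow> i \<in> high \<Longrightarrow> j \<in> low \<Longrightarrow>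
        V i (share s i) - V i (share s j) + V i (remaining s') \<le> V i (share s' i) - V i (share s' j)"
    have "safe low s'"
      by (rule safe_progress[OF s(1) s'(1)]) (use s'(2) lh G(1) in auto)
    then show "ok s' (c low)" using lh by (intro cont) auto
  qed (use g s(2) G lh n0 pq L in \<open>auto simp: r_def\<close>)
  then show "ok s (split_group n G (p' mod LCM_upto n) (q' mod LCM_upto n) (Suc r') c (\<kappa>(1 := 0, d := n)))"
    unfolding split_group_def \<tau>_def low_def high_def j_def r_def p_def q_def L_def \<kappa>'_def .
qed

text \<open>Fuel 0 cannot occur because 1 is in \<open>G\<close>. Each failed round removes at least
  one player from the group, so fuel \<open>card G\<close> lasts until some round is followed by the
  deal.\<close>

lemma ok_proto:
  "safe G s \<Longrightarrow> G \<subseteq> {1..n} \<Longrightarrow> 1 \<in> G \<Longrightarrow> card G \<le> f \<Longrightarrow> ok s (proto n f G)"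
proof (induction f arbitrary: G s)
  case 0
  then show ?case using finite_subset[OF 0(2)] by (auto simp: card_eq_0_iff)
next
  case (Suc f)
  have fin: "finite G" using finite_subset[OF Suc.prems(2)] by simp
  show ?case
    unfolding proto.simps
  proof (rule ok_Round)
    fix Qs D
    assume Q: "length Qs = LCM_upto n" "set Qs \<subseteq> M" "disjoint_family_on ((!) Qs) {..<length Qs}"
      "\<Union> (set Qs) = remaining s" "1 \<in> H \<Longrightarrow> considers_equal (V 1) Qs" "D \<subseteq> {2..n}"
      "\<And>i. i \<in> {2..n} \<Longrightarrow> i \<in> H \<Longrightarrow> (i \<in> D) = (\<not> considers_equal (V i) Qs)"
    define s1 where "s1 = s\<lparr>pieces := Qs\<rparr>"
    have s1: "share s1 = share s" "pieces s1 = Qs" "remaining s1 = remaining s"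
      using Q(4) by (auto simp: s1_def remaining_def)
    have safe1: "safe G s1" using Suc.prems(1) Q(2,3) s1 unfolding safe_def good_def by simp
    have "ok s1 (if D \<inter> G = {} then deal n G else gain n G (Min (D \<inter> G)) (\<lambda>low. proto n f low))"
    proof (cases "D \<inter> G = {}")
      case True
      have "considers_equal (V i) Qs" if "i \<in> H" "i \<in> G" for i
      proof (cases "i = 1")
        case False
        moreover have "1 \<le> i" "i \<le> n" using that Suc.prems(2) by auto
        ultimately have "i \<in> {2..n}" by simp
        then show ?thesis using Q(7)[of i] that True by blast
      qed (use Q(5) that in simp)
      then show ?thesis using True Suc.prems safe1 s1 Q(1) by (auto intro!: ok_deal)
    next
      case False
      define d where "d = Min (D \<inter> G)"
      have d: "d \<in> D" "d \<in> G" using Min_in[of "D \<inter> G"] fin False by (auto simp: d_def)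
      have "ok s1 (gain n G d (\<lambda>low. proto n f low))"
      proof (rule ok_gain)
        fix low s' assume low: "safe low s'" "low \<subset> G" "1 \<in> low"
        have "card low < card G" using psubset_card_mono[OF fin low(2)] .
        then show "ok s' (proto n f low)"
          using Suc.prems low by (intro Suc.IH) auto
      qed (use d Q s1 safe1 Suc.prems in auto)
      then show ?thesis using False by (simp add: d_def)
    qed
    then show "ok (s\<lparr>pieces := Qs\<rparr>) (if D \<inter> G = {} then deal n G else gain n G (Min (D \<inter> G)) (\<lambda>low. proto n f low))"
      unfolding s1_def .
  qed
qed

lemma safe_initial: "safe {1..n} (initial C)"
  unfolding safe_def good_def initial_def remaining_def disjoint_family_on_def
  using honest_le val_empty by auto

end

section \<open>Well-formedness\<close>

lemma wf_ask_all:
  "set us \<subseteq> {1..n} \<Longrightarrow> (\<And>h. well_formed n (c h) m) \<Longrightarrow> well_formed n (ask_all us f c) m"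
  by (induction us arbitrary: c) auto

lemma wf_cuts:
  "i \<in> {1..n} \<Longrightarrow> set ks \<subseteq> {..<m} \<Longrightarrow> well_formed n p (m + length ks) \<Longrightarrow> well_formed n (cuts i t ks p) m"
proof (induction ks arbitrary: m)
  case (Cons k ks)
  have "well_formed n (cuts i t ks p) (Suc m)"
    using Cons.prems by (intro Cons.IH) auto
  then show ?case using Cons.prems by simp
qed simp

lemma wf_joins:
  "set ks \<subseteq> {..<m} \<Longrightarrow> f ` set ks \<subseteq> {..<m} \<Longrightarrow> (\<And>k. k \<in> set ks \<Longrightarrow> f k \<noteq> k) \<Longrightarrow> well_formed n p m
    \<Longrightarrow> well_formed n (joins f ks p) m"
  by (induction ks) auto

lemma wf_gives:
  "set ks \<subseteq> {..<m} \<Longrightarrow> f ` set ks \<subseteq> {1..n} \<Longrightarrow> well_formed n p m \<Longrightarrow> well_formed n (gives f ks p) m"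
  by (induction ks) auto

lemma wf_halvings:
  "set us \<subseteq> {1..n} \<Longrightarrow> well_formed n p (m * 2 ^ length us) \<Longrightarrow> well_formed n (halvings us m p) m"
proof (induction us arbitrary: m)
  case (Cons i us)
  have "well_formed n (halvings us (2 * m) p) (2 * m)"
    using Cons.prems by (intro Cons.IH) (auto simp: mult_ac)
  then show ?case
    using Cons.prems unfolding halvings.simps by (intro wf_cuts) (auto simp: mult_2)
qed simp

lemma wf_slots:
  "1 \<le> n \<Longrightarrow> 0 < m \<Longrightarrow> well_formed n p (m + q) \<Longrightarrow> well_formed n (slots q m p) m"
proof (induction q arbitrary: m)
  case (Suc q)
  have "well_formed n (slots q (Suc m) p) (Suc m)" using Suc.prems by (intro Suc.IH) auto
  then show ?case using Suc.prems by simp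
qed simp

lemma wf_pack:
  "1 \<le> n \<Longrightarrow> 0 < m \<Longrightarrow> (\<And>k. \<phi> k < q) \<Longrightarrow> well_formed n p (m + q) \<Longrightarrow> well_formed n (pack q \<phi> m p) m"
  unfolding pack_def by (intro wf_slots wf_joins) auto

text \<open>The bound on \<open>card U\<close> is part of the premise because the piece given to
  \<open>g\<close> is a legal index only if \<open>T - U\<close> is nonempty.\<close>

lemma wf_allot:
  assumes "distinct bs" "set bs \<subseteq> {..<m}" "2 ^ length gs \<le> length bs" "set gs \<subseteq> {1..n}"
    and "\<And>U. finite U \<Longrightarrow> card U < 2 ^ length gs \<Longrightarrow> well_formed n (c U) (m + allot_cuts (length gs))"
  shows "well_formed n (allot bs gs c) m"
  using assms
proof (induction gs arbitrary: m c)
  case (Cons g gs)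
  define S :: nat where "S = 2 ^ length gs"
  have S: "0 < S" "2 * S \<le> length bs" using Cons.prems(3) by (auto simp: S_def)
  have "well_formed n (cuts g (\<lambda>_ w. snd w ! (ranking bs a ! (S - 1))) (take (S - 1) (ranking bs a))
       (allot bs gs (\<lambda>U. Give g (SOME k. k \<in> set (take S (ranking bs a)) - U)
            (c (U \<union> set (take S (ranking bs a))))))) m" for a
  proof (rule wf_cuts)
    define xs where "xs = ranking bs a"
    have xs: "set xs = set bs" "distinct xs" "length xs = length bs"
      using set_ranking[OF Cons.prems(1)] length_ranking[OF Cons.prems(1)] by (auto simp: xs_def)
    define T where "T = set (take S xs)"
    have T: "T \<subseteq> set bs" "card T = S" "finite T"
      using xs S set_take_subset[of S xs] by (auto simp: T_def distinct_card)
    have len: "length (take (S - 1) xs) = S - 1" using xs S by simp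
    show "set (take (S - 1) (ranking bs a)) \<subseteq> {..<m}"
      using xs Cons.prems(2) set_take_subset[of "S - 1" xs] by (auto simp: xs_def)
    have "well_formed n (allot bs gs (\<lambda>U. Give g (SOME k. k \<in> T - U) (c (U \<union> T)))) (m + (S - 1))"
    proof (rule Cons.IH)
      fix U :: "nat set" assume U: "finite U" "card U < 2 ^ length gs"
      then have "T - U \<noteq> {}" using T card_mono[of U T] by (auto simp: S_def)
      then have "(SOME k. k \<in> T - U) \<in> T" using some_in_eq[of "T - U"] by blast
      then have "(SOME k. k \<in> T - U) < m" using T(1) Cons.prems(2) by auto
      moreover have "well_formed n (c (U \<union> T)) (m + (S - 1) + allot_cuts (length gs))"
      proof -
        have "allot_cuts (length (g # gs)) = (S - 1) + allot_cuts (length gs)" by (simp add: S_def)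
        moreover have "well_formed n (c (U \<union> T)) (m + allot_cuts (length (g # gs)))"
          using U T card_Un_le[of U T] by (intro Cons.prems(5)) (auto simp: S_def)
        ultimately show ?thesis by (simp only: add.assoc)
      qed
      ultimately show "well_formed n (Give g (SOME k. k \<in> T - U) (c (U \<union> T))) (m + (S - 1) + allot_cuts (length gs))"
        using Cons.prems(4) unfolding well_formed.simps by auto
    qed (use Cons.prems S in auto)
    then show "well_formed n (allot bs gs (\<lambda>U. Give g (SOME k. k \<in> set (take S (ranking bs a)) - U)
            (c (U \<union> set (take S (ranking bs a)))))) (m + length (take (S - 1) (ranking bs a)))"
      using len unfolding T_def xs_def by simp
  qed (use Cons.prems in auto)
  then show ?case using Cons.prems(4) unfolding S_def by simp
qed simp

lemma wf_shrink:
  assumes "1 \<le> n" "distinct gl" "set gl \<subseteq> {1..n}" "set us \<subseteq> set gl" "0 < m" "\<And>m. well_formed n p m"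
  shows "well_formed n (shrink n gl us m p) m"
  using assms(4,5)
proof (induction us arbitrary: m)
  case (Cons i us)
  define gs where "gs = i # filter (\<lambda>j. j \<noteq> i) gl"
  have gs: "length gs = length gl" "set gs = set gl"
    using length_move_front assms(2) Cons.prems(1) by (auto simp: gs_def)
  have "length gl \<le> n"
    using distinct_card[OF assms(2)] card_mono[OF _ assms(3)] by simp
  then have len: "(2 :: nat) ^ length gl \<le> 2 ^ n" by (intro power_increasing) auto
  define bs where "bs = map (\<lambda>t. t * Suc m + m) [0..<2 ^ n]"
  have bs: "distinct bs" "length bs = 2 ^ n"
    by (auto simp: bs_def distinct_map inj_on_def simp del: mult_Suc_right)
  have bs_less: "set bs \<subseteq> {..<Suc m * 2 ^ length (replicate n i)}"
  proof
    fix k assume "k \<in> set bs"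
    then obtain t where t: "t < 2 ^ n" "k = t * Suc m + m" by (auto simp: bs_def)
    have "k < Suc t * Suc m" using t by simp
    also have "\<dots> \<le> 2 ^ n * Suc m" using t by (intro mult_right_mono) auto
    finally show "k \<in> {..<Suc m * 2 ^ length (replicate n i)}" by (simp add: mult.commute)
  qed
  have i: "set (replicate n i) \<subseteq> {1..n}" using Cons.prems(1) assms(3) by auto
  have "well_formed n (halvings (replicate n i) (Suc m)
      (allot bs gs (\<lambda>_. shrink n gl us (Suc m * 2 ^ n + allot_cuts (length gl)) p))) (Suc m)"
  proof (rule wf_halvings[OF i], rule wf_allot[OF bs(1) bs_less])
    show "2 ^ length gs \<le> length bs" using len gs bs by simp
    show "set gs \<subseteq> {1..n}" using gs assms(3) by simp
    have "well_formed n (shrink n gl us (Suc m * 2 ^ n + allot_cuts (length gl)) p) (Suc m * 2 ^ n + allot_cuts (length gl))"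
      using Cons.prems by (intro Cons.IH) auto
    then show "well_formed n (shrink n gl us (Suc m * 2 ^ n + allot_cuts (length gl)) p)
        (Suc m * 2 ^ length (replicate n i) + allot_cuts (length gs))"
      using gs(1) by simp
  qed
  then show ?case
    unfolding shrink.simps gs_def[symmetric] bs_def[symmetric]
    using assms(1) Cons.prems(2) by (intro wf_pack) auto
qed (use assms(6) in simp)

lemma wf_separate:
  assumes n: "1 \<le> n" and G: "G \<subseteq> {1..n}" and lh: "low \<subseteq> G" "high \<subseteq> G" and \<tau>: "0 \<le> \<tau>" "\<tau> \<le> 1"
    and c: "\<And>m. well_formed n c m"
  shows "well_formed n (separate n G r \<tau> p q low high c) (LCM_upto n)"
proof -
  have fin: "finite G" "finite low" "finite high"
    using finite_subset[OF G] finite_subset[OF lh(1)] finite_subset[OF lh(2)] by auto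
  have "card low \<le> n" "card high \<le> n"
    using card_mono[of "{1..n}" low] card_mono[of "{1..n}" high] G lh by auto
  then have pow: "(2 :: nat) ^ card low \<le> 2 ^ n" "(2 :: nat) ^ card high \<le> 2 ^ n"
    by (auto intro: power_increasing)
  have m: "0 < crumb_count n r (card G)"
    "crumb_count n r (card G) = LCM_upto n * 2 ^ length (concat (map (replicate (crumb_exp n r)) (sorted_list_of_set G)))"
    using fin LCM_upto_pos[of n] by (auto simp: crumb_count_def length_concat_replicate)
  have less: "bundling n G r \<tau> p q a k < 2 * 2 ^ n + 1" for a k
    unfolding bundling_def using fin(1) \<tau> weight_nonneg weight_sum by (intro assignment) auto
  define gl where "gl = sorted_list_of_set G"
  define ll where "ll = sorted_list_of_set low"
  define hl where "hl = sorted_list_of_set high"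
  have lists: "set gl = G" "distinct gl" "set ll = low" "length ll = card low" "set hl = high" "length hl = card high"
    using fin by (auto simp: gl_def ll_def hl_def)
  define N :: nat where "N = 2 ^ n"
  define m where "m = crumb_count n r (card G)"
  define us where "us = concat (map (replicate (N * (16 * r * n * N))) hl)"
  have us: "set us \<subseteq> set gl"
    using set_concat_replicate[of "N * (16 * r * n * N)" hl] lists lh unfolding us_def by blast
  define m' where "m' = m + (2 * N + 1) + allot_cuts (card low) + allot_cuts (card high)"
  have "well_formed n (shrink n gl us m' c) m'"
    using n lists G us c m(1) by (intro wf_shrink) (auto simp: m'_def m_def)
  then have w1: "well_formed n (allot [m + N..<m + 2 * N] hl (\<lambda>_. shrink n gl us m' c)) (m + (2 * N + 1) + allot_cuts (length ll))"
    by (intro wf_allot) (use lists lh G pow in \<open>auto simp: m'_def N_def\<close>)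
  have w2: "well_formed n (allot [m..<m + N] ll (\<lambda>_. allot [m + N..<m + 2 * N] hl (\<lambda>_. shrink n gl us m' c))) (m + (2 * N + 1))"
    by (rule wf_allot[OF _ _ _ _ w1]) (use lists lh G pow in \<open>auto simp: N_def\<close>)
  then have "well_formed n (pack (2 * N + 1) (bundling n G r \<tau> p q a) m
      (allot [m..<m + N] ll (\<lambda>_. allot [m + N..<m + 2 * N] hl (\<lambda>_. shrink n gl us m' c)))) m" for a
    using n m(1) less unfolding N_def m_def by (intro wf_pack) auto
  then have "well_formed n (ask_all gl (\<lambda>_. report (scale n r (card G)))
      (\<lambda>a. pack (2 * N + 1) (bundling n G r \<tau> p q a) m
        (allot [m..<m + N] ll (\<lambda>_. allot [m + N..<m + 2 * N] hl (\<lambda>_. shrink n gl us m' c))))) m"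
    using lists G by (intro wf_ask_all) auto
  then have "well_formed n (halvings (concat (map (replicate (crumb_exp n r)) gl)) (LCM_upto n)
      (ask_all gl (\<lambda>_. report (scale n r (card G)))
        (\<lambda>a. pack (2 * N + 1) (bundling n G r \<tau> p q a) m
          (allot [m..<m + N] ll (\<lambda>_. allot [m + N..<m + 2 * N] hl (\<lambda>_. shrink n gl us m' c)))))) (LCM_upto n)"
    using set_concat_replicate[of "crumb_exp n r" gl] lists G m(2)
    by (intro wf_halvings) (auto simp: m_def gl_def)
  then show ?thesis
    unfolding separate_def Let_def gl_def ll_def hl_def N_def m_def us_def m'_def .
qed

lemma wf_gain:
  assumes G: "G \<subseteq> {1..n}" "1 \<in> G" "d \<in> G" "d \<noteq> 1"
    and c: "\<And>low m. low \<subset> G \<Longrightarrow> 1 \<in> low \<Longrightarrow> well_formed n (c low) m"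
  shows "well_formed n (gain n G d c) (LCM_upto n)"
proof -
  have "well_formed n (split_group n G p q (Suc r) c (\<kappa>(1 := 0, d := n))) (LCM_upto n)" for p q r \<kappa>
  proof -
    define \<kappa>' where "\<kappa>' = \<kappa>(1 := 0, d := n)"
    define j where "j = free_cell n G \<kappa>'"
    have j: "0 < j" "j < n" "j \<notin> \<kappa>' ` G"
      unfolding j_def by (rule free_cell[OF G]; use G(4) in \<open>simp add: \<kappa>'_def\<close>)+
    have n: "1 \<le> n" using j by simp
    have "(real j + 1 / 2) / (real (Suc r) * real n) \<le> 1"
    proof -
      have "real j + 1 / 2 \<le> real n" using j(2) by linarith
      also have "\<dots> \<le> real (Suc r) * real n" using mult_right_mono[of 1 "real (Suc r)" "real n"] by simp
      finally show ?thesis using n by simp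
    qed
    moreover have "0 \<le> (real j + 1 / 2) / (real (Suc r) * real n)" by simp
    moreover have "{i \<in> G. \<kappa>' i < j} \<subset> G" "1 \<in> {i \<in> G. \<kappa>' i < j}"
      using G j by (auto simp: \<kappa>'_def)
    ultimately show ?thesis
      unfolding split_group_def \<kappa>'_def[symmetric] j_def[symmetric]
      by (intro wf_separate n G(1) c) auto
  qed
  then show ?thesis
    unfolding gain_def using G finite_subset[OF G(1)] by (auto intro!: wf_ask_all)
qed

text \<open>Any \<open>m\<close> works, as \<open>Round\<close> replaces the whole list of pieces.
  This is why the blocks above may ask for continuations that are well-formed for every number of
  pieces.\<close>

lemma wf_proto: "G \<subseteq> {1..n} \<Longrightarrow> 1 \<in> G \<Longrightarrow> well_formed n (proto n f G) m"
proof (induction f arbitrary: G m)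
  case (Suc f)
  have fin: "finite G" using finite_subset[OF Suc.prems(1)] by simp
  have "well_formed n (if D \<inter> G = {} then deal n G else gain n G (Min (D \<inter> G)) (\<lambda>low. proto n f low)) (LCM_upto n)"
    if D: "D \<subseteq> {2..n}" for D
  proof (cases "D \<inter> G = {}")
    case True
    have "sorted_list_of_set G ! (k mod card G) \<in> {1..n}" for k
      using Suc.prems fin nth_mem[of "k mod card G" "sorted_list_of_set G"] card_gt_0_iff[of G] by auto
    then show ?thesis using True unfolding deal_def by (auto intro!: wf_gives)
  next
    case False
    have "Min (D \<inter> G) \<in> D \<inter> G" using fin False by (intro Min_in) auto
    then have "Min (D \<inter> G) \<in> G" "Min (D \<inter> G) \<noteq> 1" using D by auto
    then have "well_formed n (gain n G (Min (D \<inter> G)) (\<lambda>low. proto n f low)) (LCM_upto n)"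
      using Suc.prems by (intro wf_gain Suc.IH) auto
    then show ?thesis using False by simp
  qed
  then show ?case by simp
qed simp

section \<open>Counting cuts\<close>

lemma Om_le: "Om a b \<le> Om a' b' \<longleftrightarrow> a < a' \<or> a = a' \<and> b \<le> b'"
  by (auto simp: less_eq_omega_ord_def less_omega_ord_def)

lemma Om_less: "Om a b < Om a' b' \<longleftrightarrow> a < a' \<or> a = a' \<and> b < b'"
  by (auto simp: less_omega_ord_def)

text \<open>Only the first decrease is rerouted. For \<open>m = 0\<close> there is none and the end
  point itself moves up, hence \<open>y' \<ge> y\<close>.\<close>

lemma decreases_mono:
  assumes "decreases m z y" "z \<le> z'"
  shows "\<exists>y'\<ge>y. decreases m z' y'"
proof (cases m)
  case 0
  then show ?thesis using assms by (auto simp: decreases_def)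
next
  case (Suc l)
  obtain b where b: "b < z" "(b, y) \<in> {(a, b). b < a} ^^ l"
    using assms(1) unfolding decreases_def Suc by (blast dest: relpow_Suc_D2)
  then have "b < z'" using assms(2) by simp
  then have "decreases m z' y" using b(2) unfolding decreases_def Suc by (intro relpow_Suc_I2) auto
  then show ?thesis by blast
qed

lemma decreases_Om: "decreases m (Om k (z + m)) (Om k z)"
proof (induction m)
  case (Suc m)
  then have "(Om k (z + Suc m), Om k z) \<in> {(a, b). b < a} ^^ Suc m"
    unfolding decreases_def by (intro relpow_Suc_I2[of _ "Om k (z + m)"]) (auto simp: Om_less)
  then show ?case unfolding decreases_def .
qed (simp add: decreases_def)

lemma takes_cuts_mono: "takes_cuts n p z \<Longrightarrow> z \<le> z' \<Longrightarrow> takes_cuts n p z'"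
proof (induction p arbitrary: z z')
  case (Round c)
  then obtain y where y: "decreases (LCM_upto n - 1) z y" "\<forall>D\<subseteq>{2..n}. takes_cuts n (c D) y" by auto
  obtain y' where y': "y \<le> y'" "decreases (LCM_upto n - 1) z' y'" using decreases_mono[OF y(1) Round.prems(2)] by blast
  have "takes_cuts n (c D) y'" if "D \<subseteq> {2..n}" for D
    by (rule Round.IH[OF rangeI _ y'(1)]) (use y(2) that in simp)
  then show ?case using y'(2) unfolding takes_cuts.simps by blast
next
  case (Cut i k t p)
  obtain y where y: "y < z" "takes_cuts n p y" using Cut.prems(1) by auto
  have "y < z'" using y(1) Cut.prems(2) by (rule less_le_trans)
  then show ?case using y(2) by auto
next
  case (Ask i f c)
  have "takes_cuts n (c a) z'" for a
    by (rule Ask.IH[OF rangeI _ Ask.prems(2)]) (use Ask.prems(1) in simp)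
  then show ?case by simp
qed auto

text \<open>A worst case bound holds along every sequence of partitions; the average case is derived
  from this.\<close>

lemma takes_cuts_along:
  "takes_cuts n p z \<Longrightarrow> (\<And>r. d r \<subseteq> {2..n}) \<Longrightarrow> takes_cuts_along n p d z"
proof (induction p arbitrary: z d)
  case (Round c)
  then obtain y where y: "decreases (LCM_upto n - 1) z y" "\<forall>D\<subseteq>{2..n}. takes_cuts n (c D) y" by auto
  have "takes_cuts_along n (c (d 0)) (\<lambda>r. d (Suc r)) y"
    using y(2) Round.prems(2) by (intro Round.IH) auto
  then show ?case using y(1) by auto
qed auto

lemma takes_ask_all: "(\<And>h. takes_cuts n (c h) z) \<Longrightarrow> takes_cuts n (ask_all us f c) z"
  by (induction us arbitrary: c) auto

lemma takes_cuts_cuts: "takes_cuts n p (Om k z) \<Longrightarrow> takes_cuts n (cuts i t ks p) (Om k (z + length ks))"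
  by (induction ks) (auto intro!: exI[of _ "Om k (z + length _)"] simp: Om_less)

lemma takes_joins: "takes_cuts n p z \<Longrightarrow> takes_cuts n (joins f ks p) z"
  by (induction ks) auto

lemma takes_gives: "takes_cuts n p z \<Longrightarrow> takes_cuts n (gives f ks p) z"
  by (induction ks) auto

text \<open>\<open>N\<close> is uniform in the continuation and the counter, so such bounds can be
  chained. Its size does not matter, as it will be absorbed by an \<omega>.\<close>

lemma takes_halvings:
  "\<exists>N. \<forall>p k z. takes_cuts n p (Om k z) \<longrightarrow> takes_cuts n (halvings us m p) (Om k (z + N))"
proof (induction us arbitrary: m)
  case (Cons i us)
  obtain N where N: "\<forall>p k z. takes_cuts n p (Om k z) \<longrightarrow> takes_cuts n (halvings us (2 * m) p) (Om k (z + N))"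
    using Cons by blast
  have "takes_cuts n (halvings (i # us) m p) (Om k (z + (N + m)))" if "takes_cuts n p (Om k z)" for p k z
    using takes_cuts_cuts[of n "halvings us (2 * m) p" k "z + N" i _ "[0..<m]"] N that by (simp add: add.assoc)
  then show ?case by blast
qed (auto intro!: exI[of _ 0])

lemma takes_slots: "takes_cuts n p (Om k z) \<Longrightarrow> takes_cuts n (slots q m p) (Om k (z + q))"
proof (induction q arbitrary: m)
  case (Suc q)
  then show ?case by (auto intro!: exI[of _ "Om k (z + q)"] simp: Om_less)
qed simp

lemma takes_pack: "takes_cuts n p (Om k z) \<Longrightarrow> takes_cuts n (pack q \<phi> m p) (Om k (z + q))"
  unfolding pack_def by (intro takes_slots takes_joins)

lemma takes_allot:
  "(\<And>U. takes_cuts n (c U) (Om k z)) \<Longrightarrow> takes_cuts n (allot bs gs c) (Om k (z + allot_cuts (length gs)))"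
proof (induction gs arbitrary: c)
  case (Cons g gs)
  have *: "takes_cuts n (cuts g t (take (2 ^ length gs - 1) xs) (allot bs gs (\<lambda>U. Give g (f U) (c (h U)))))
      (Om k (z + allot_cuts (length (g # gs))))" for t xs f h
  proof -
    have "takes_cuts n (allot bs gs (\<lambda>U. Give g (f U) (c (h U)))) (Om k (z + allot_cuts (length gs)))"
      using Cons.prems by (intro Cons.IH) simp
    from takes_cuts_cuts[OF this, of g t "take (2 ^ length gs - 1) xs"] show ?thesis
    proof (rule takes_cuts_mono)
      have "allot_cuts (length (g # gs)) = (2 ^ length gs - 1) + allot_cuts (length gs)" by simp
      moreover have "length (take (2 ^ length gs - 1) xs) \<le> 2 ^ length gs - 1" by simp
      ultimately have "z + allot_cuts (length gs) + length (take (2 ^ length gs - 1) xs) \<le> z + allot_cuts (length (g # gs))"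
        by linarith
      then show "Om k (z + allot_cuts (length gs) + length (take (2 ^ length gs - 1) xs)) \<le> Om k (z + allot_cuts (length (g # gs)))"
        unfolding Om_le by blast
    qed
  qed
  show ?case unfolding allot.simps takes_cuts.simps by (intro allI *)
qed simp

lemma takes_shrink:
  "\<exists>N. \<forall>p k z. takes_cuts n p (Om k z) \<longrightarrow> takes_cuts n (shrink n gl us m p) (Om k (z + N))"
proof (induction us arbitrary: m)
  case (Cons i us)
  define gs where "gs = i # filter (\<lambda>j. j \<noteq> i) gl"
  define bs where "bs = map (\<lambda>t. t * Suc m + m) [0..<2 ^ n :: nat]"
  define m' where "m' = Suc m * 2 ^ n + allot_cuts (length gl)"
  obtain N where N: "\<forall>p k z. takes_cuts n p (Om k z) \<longrightarrow> takes_cuts n (shrink n gl us m' p) (Om k (z + N))"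
    using Cons by blast
  obtain N' where N': "\<forall>p k z. takes_cuts n p (Om k z) \<longrightarrow> takes_cuts n (halvings (replicate n i) (Suc m) p) (Om k (z + N'))"
    using takes_halvings by blast
  have "takes_cuts n (shrink n gl (i # us) m p) (Om k (z + N + allot_cuts (length gs) + N' + 1))"
    if "takes_cuts n p (Om k z)" for p k z
    unfolding shrink.simps gs_def[symmetric] bs_def[symmetric] m'_def[symmetric]
    by (intro takes_pack N'[rule_format] takes_allot N[rule_format] that)
  then show ?case by (metis add.assoc)
qed (auto intro!: exI[of _ 0])

lemma takes_separate:
  "\<exists>N. takes_cuts n c (Om k z) \<longrightarrow> takes_cuts n (separate n G r \<tau> p q low high c) (Om k N)"
proof -
  define gl where "gl = sorted_list_of_set G"
  define m where "m = crumb_count n r (card G)"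
  define us where "us = concat (map (replicate (2 ^ n * (16 * r * n * 2 ^ n))) (sorted_list_of_set high))"
  define m' where "m' = m + (2 * 2 ^ n + 1) + allot_cuts (card low) + allot_cuts (card high)"
  obtain N where N: "\<forall>p k z. takes_cuts n p (Om k z) \<longrightarrow> takes_cuts n (shrink n gl us m' p) (Om k (z + N))"
    using takes_shrink by blast
  obtain N' where N': "\<forall>p k z. takes_cuts n p (Om k z) \<longrightarrow>
      takes_cuts n (halvings (concat (map (replicate (crumb_exp n r)) gl)) (LCM_upto n) p) (Om k (z + N'))"
    using takes_halvings by blast
  have "takes_cuts n (separate n G r \<tau> p q low high c)
      (Om k (z + N + allot_cuts (length (sorted_list_of_set high)) + allot_cuts (length (sorted_list_of_set low))
        + (2 * 2 ^ n + 1) + N'))" if "takes_cuts n c (Om k z)"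
    unfolding separate_def Let_def m_def[symmetric] gl_def[symmetric] us_def[symmetric] m'_def[symmetric]
    by (intro N'[rule_format] takes_ask_all takes_pack takes_allot N[rule_format] that)
  then show ?thesis by blast
qed

text \<open>The finite part is chosen only after all answers, when \<open>separate\<close> has fixed
  parameters. It contains \<open>z\<close>, that is, also the cuts of the next
  \<open>Round\<close>.\<close>

lemma takes_gain:
  assumes G: "G \<subseteq> {1..n}" "1 \<in> G" "d \<in> G" "d \<noteq> 1"
    and c: "\<And>low. low \<subset> G \<Longrightarrow> 1 \<in> low \<Longrightarrow> takes_cuts n (c low) (Om k z)"
  shows "takes_cuts n (gain n G d c) (Om (Suc k) 0)"
proof -
  have "takes_cuts n (split_group n G p q r c (\<kappa>(1 := 0, d := n))) (Om (Suc k) 0)" for p q r \<kappa>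
  proof -
    define \<kappa>' where "\<kappa>' = \<kappa>(1 := 0, d := n)"
    define j where "j = free_cell n G \<kappa>'"
    have j: "0 < j" "j < n" "j \<notin> \<kappa>' ` G"
      unfolding j_def by (rule free_cell[OF G]; use G(4) in \<open>simp add: \<kappa>'_def\<close>)+
    have "{i \<in> G. \<kappa>' i < j} \<subset> G" "1 \<in> {i \<in> G. \<kappa>' i < j}"
      using G j by (auto simp: \<kappa>'_def)
    then have "takes_cuts n (c {i \<in> G. \<kappa>' i < j}) (Om k z)" by (rule c)
    then obtain N where "takes_cuts n (split_group n G p q r c \<kappa>') (Om k N)"
      using takes_separate unfolding split_group_def j_def by blast
    \<comment> \<open>Any \<open>Om k N\<close> lies below \<open>Om (Suc k) 0\<close>, however
      large the announced bound has made \<open>N\<close>.\<close>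
    then show ?thesis unfolding \<kappa>'_def by (rule takes_cuts_mono) (simp add: Om_le)
  qed
  then show ?thesis unfolding gain_def by (auto intro!: takes_ask_all)
qed

text \<open>The opening \<open>Round\<close> uses up the finite part \<open>L - 1\<close>. A failed
  round then trades one \<omega> for a finite number and loses at least one member of
  \<open>G\<close>, so \<open>card G - 1\<close> of them suffice.\<close>

lemma takes_proto:
  "G \<subseteq> {1..n} \<Longrightarrow> 1 \<in> G \<Longrightarrow> takes_cuts n (proto n f G) (Om (card G - 1) (LCM_upto n - 1))"
proof (induction f arbitrary: G)
  case (Suc f)
  have fin: "finite G" using finite_subset[OF Suc.prems(1)] by simp
  have "takes_cuts n (if D \<inter> G = {} then deal n G else gain n G (Min (D \<inter> G)) (\<lambda>low. proto n f low)) (Om (card G - 1) 0)"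
    if D: "D \<subseteq> {2..n}" for D
  proof (cases "D \<inter> G = {}")
    case True
    then show ?thesis by (simp add: deal_def takes_gives)
  next
    case False
    define d where "d = Min (D \<inter> G)"
    have "d \<in> D \<inter> G" unfolding d_def using fin False by (intro Min_in) auto
    then have d: "d \<in> G" "d \<noteq> 1" using D by auto
    \<comment> \<open>At least two members are present, so the truncated subtraction really leaves
      an \<omega> to spend.\<close>
    have "card {1, d} \<le> card G" using d Suc.prems(2) fin by (intro card_mono) auto
    then have card: "card G - 1 = Suc (card G - 2)" using d by simp
    have "takes_cuts n (proto n f low) (Om (card G - 2) (LCM_upto n - 1))" if low: "low \<subset> G" "1 \<in> low" for low
    proof -
      have "card low < card G" by (rule psubset_card_mono[OF fin low(1)])
      then have "card low - 1 \<le> card G - 2" by simp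
      moreover have "takes_cuts n (proto n f low) (Om (card low - 1) (LCM_upto n - 1))"
        using low Suc.prems by (intro Suc.IH) auto
      ultimately show ?thesis by (elim takes_cuts_mono) (auto simp: Om_le)
    qed
    then have "takes_cuts n (gain n G d (\<lambda>low. proto n f low)) (Om (card G - 1) 0)"
      unfolding card using Suc.prems d by (intro takes_gain) auto
    then show ?thesis using False by (simp add: d_def)
  qed
  moreover have "decreases (LCM_upto n - 1) (Om (card G - 1) (LCM_upto n - 1)) (Om (card G - 1) 0)"
    using decreases_Om[of "LCM_upto n - 1" "card G - 1" 0] by simp
  ultimately show ?case unfolding proto.simps takes_cuts.simps by blast
qed simp

section \<open>Assembling the theorem\<close>

lemma envy_free_proto:
  assumes "algebra C M" "1 \<le> n"
  shows "envy_free_protocol C M n (proto n n {1..n})"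
  unfolding envy_free_protocol_def
proof (intro conjI allI impI)
  show "well_formed n (proto n n {1..n}) 1" using assms(2) by (intro wf_proto) auto
  fix H V X
  assume H: "H \<subseteq> {1..n}" "\<forall>i\<in>H. valuation C M (V i)" and X: "play M n H V (initial C) (proto n n {1..n}) X"
  interpret cake C M n H V
  proof (rule cake.intro)
    show "cake_axioms C M n H V" using H by unfold_locales auto
  qed (rule assms(1))
  have "ok (initial C) (proto n n {1..n})"
    using safe_initial assms(2) by (intro ok_proto) auto
  then have "fair X" using X unfolding ok_def by blast
  then show "division C M n X" "\<forall>i\<in>H. envies_nobody n (V i) X i" unfolding fair_def by auto
qed

lemma prob_space_random_partitions: "prob_space (random_partitions n)"
  unfolding random_partitions_def
  by (intro prob_space_PiM prob_space_uniform_count_measure) auto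

theorem theorem2p5:
  "\<exists>(P :: nat \<Rightarrow> protocol) (e :: nat \<Rightarrow> real).
     e \<in> o(\<lambda>_. 1) \<and>
     (\<forall>n\<ge>1.
        (\<forall>(C :: 'a set) M. algebra C M \<longrightarrow> envy_free_protocol C M n (P n)) \<and>
        proceeds_in_rounds (P n) \<and>
        takes_cuts n (P n)
          (Om (nat \<lceil>(real n ^ 2 - 2 * real n + 2) / 2\<rceil>) (Lcm {2..n} - 1)) \<and>
        takes_cuts_on_average n (P n) (real n + e n) (Lcm {2..n} - 1))"
proof (intro exI[of _ "\<lambda>n. proto n n {1..n}"] exI[of _ "\<lambda>_. 0"] conjI allI impI)
  show "(\<lambda>_. 0 :: real) \<in> o(\<lambda>_ :: nat. 1)" by simp
  fix n :: nat assume n: "1 \<le> n"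
  show "envy_free_protocol C M n (proto n n {1..n})" if "algebra C M" for C :: "'a set" and M
    using that n by (rule envy_free_proto)
  show "proceeds_in_rounds (proto n n {1..n})"
    unfolding proceeds_in_rounds_def using n by (cases n) auto
  have takes: "takes_cuts n (proto n n {1..n}) (Om (n - 1) (LCM_upto n - 1))"
    using takes_proto[of "{1..n}" n n] n by simp
  \<comment> \<open>The difference of the two sides is \<open>(n - 2)^2 / 2\<close>.\<close>
  have "real n - 1 \<le> (real n ^ 2 - 2 * real n + 2) / 2"
    using zero_le_power2[of "real n - 2"] by (simp add: power2_diff field_simps)
  then have "int (n - 1) \<le> \<lceil>(real n ^ 2 - 2 * real n + 2) / 2\<rceil>"
    using n by (simp add: le_ceiling_iff of_nat_diff)
  then have "n - 1 \<le> nat \<lceil>(real n ^ 2 - 2 * real n + 2) / 2\<rceil>" by linarith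
  then have "Om (n - 1) (LCM_upto n - 1) \<le> Om (nat \<lceil>(real n ^ 2 - 2 * real n + 2) / 2\<rceil>) (LCM_upto n - 1)"
    by (auto simp: Om_le)
  with takes show "takes_cuts n (proto n n {1..n})
      (Om (nat \<lceil>(real n ^ 2 - 2 * real n + 2) / 2\<rceil>) (LCM_upto n - 1))"
    by (rule takes_cuts_mono)
  interpret R: prob_space "random_partitions n" by (rule prob_space_random_partitions)
  show "takes_cuts_on_average n (proto n n {1..n}) (real n + 0) (LCM_upto n - 1)"
    unfolding takes_cuts_on_average_def
  \<comment> \<open>The coefficient is constant, so its expectation is \<open>n - 1\<close>, below
    the required \<open>n\<close> even with error term 0.\<close>
  proof (intro exI[of _ "\<lambda>_. n - 1"] conjI ballI)
    show "takes_cuts_along n (proto n n {1..n}) d (Om (n - 1) (LCM_upto n - 1))"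
      if d: "d \<in> space (random_partitions n)" for d
    proof (rule takes_cuts_along[OF takes])
      show "d r \<subseteq> {2..n}" for r
        using d by (auto simp: random_partitions_def space_PiM space_uniform_count_measure PiE_def Pi_def)
    qed
  qed (simp_all add: R.prob_space)
qed

end
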